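(* Let $(\Gamma,A,R)$ be a finitely presented group such that $\Gamma=\langle A\mid R\rangle$ is amenable. Then the word problem for $(\Gamma,A,R)$ is decidable if and only if the function $\mathbb{Z}\Gamma\ni a\mapsto \|a\|_{\lambda}\in\mathbb{R}$ is computable.
   Context: A finitely presented group is a triple $(\Gamma,A,R)$ where $A$ is a finite set, $R$ is a finite subset of the free group $F_A$ on $A$, and $\Gamma=\langle A\mid R\rangle$ is the quotient of $F_A$ by the normal subgroup generated by $R$. The canonical surjection $F_A\to\Gamma$ is written $g\mapsto\bar g$, and the induced map of integral group rings $\mathbb{Z}F_A\to\mathbb{Z}\Gamma$ is written $a\mapsto\bar a$. The word problem for $(\Gamma,A,R)$ is decidable if there is an algorithm which, given $g\in F_A$ (as a word), decides whether $\bar g=e_\Gamma$ or not. $\|\cdot\|_\lambda$ is the operator norm in the left-regular representation of $\Gamma$ on $\ell^2(\Gamma)$, extended linearly to the group ring. A function $f\colon\mathbb{Z}\Gamma\to\mathbb{R}$ is computable if there is an algorithm that takes as input an element $a\in\mathbb{Z}F_A$ and produces two sequences of rational numbers $(p_n)_{n\in\mathbb{N}}$ and $(q_n)_{n\in\mathbb{N}}$ such that $(p_n)$ is monotone increasing, $(q_n)$ is monotone decreasing, and $\sup_n p_n=f(\bar a)=\inf_n q_n$. *)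

theory Defs
  imports
    "HOL-Analysis.Infinite_Sum"
    "HOL-Algebra.Free_Abelian_Groups"
    "HOL-Library.Countable_Set"
    "HOL-Library.Nat_Bijection"
begin

section \<open>Free groups and group presentations\<close>

text \<open>The letter \<open>(x, True)\<close> is the generator \<open>x\<close>, and \<open>(x, False)\<close> is its formal inverse.
  An element of the free group on \<open>A\<close> is a reduced word.\<close>

type_synonym 'a letter = "'a \<times> bool"
type_synonym 'a word = "'a letter list"

definition inv_letter :: "'a letter \<Rightarrow> 'a letter" where
  "inv_letter l = (fst l, \<not> snd l)"

definition words :: "'a set \<Rightarrow> 'a word set" where
  "words A = lists (A \<times> UNIV)"

definition reduced :: "'a word \<Rightarrow> bool" where
  "reduced w \<longleftrightarrow> successively (\<lambda>l m. m \<noteq> inv_letter l) w"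

fun push_letter :: "'a letter \<Rightarrow> 'a word \<Rightarrow> 'a word" where
  "push_letter l [] = [l]"
| "push_letter l (m # w) = (if m = inv_letter l then w else l # m # w)"

definition reduce :: "'a word \<Rightarrow> 'a word" where
  "reduce w = foldr push_letter w []"

definition free_group :: "'a set \<Rightarrow> 'a word monoid" where
  "free_group A =
     \<lparr>carrier = {w \<in> words A. reduced w}, mult = (\<lambda>u v. reduce (u @ v)), one = []\<rparr>"

definition finite_presentation :: "'a set \<Rightarrow> 'a word set \<Rightarrow> bool" where
  "finite_presentation A R \<longleftrightarrow> finite A \<and> finite R \<and> R \<subseteq> carrier (free_group A)"

text \<open>The normal subgroup of the free group generated by \<open>R\<close>, as the intersection of all normal
  subgroups containing \<open>R\<close>.\<close>

definition relator_subgroup :: "'a set \<Rightarrow> 'a word set \<Rightarrow> 'a word set" where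
  "relator_subgroup A R = (\<lambda>N. N \<lhd> free_group A) hull R"

definition presented_group :: "'a set \<Rightarrow> 'a word set \<Rightarrow> 'a word set monoid" where
  "presented_group A R = free_group A Mod relator_subgroup A R"

definition proj :: "'a set \<Rightarrow> 'a word set \<Rightarrow> 'a word \<Rightarrow> 'a word set" where
  "proj A R g = relator_subgroup A R #>\<^bsub>free_group A\<^esub> g"

text \<open>An element of the integral group ring of \<open>G\<close> is a finitely supported function
  \<open>'g \<Rightarrow>\<^sub>0 int\<close> whose support lies in \<open>carrier G\<close>. Only the additive structure is needed below, so
  the group ring is not set up as a ring.\<close>

definition proj_ring :: "'a set \<Rightarrow> 'a word set \<Rightarrow> ('a word \<Rightarrow>\<^sub>0 int) \<Rightarrow> ('a word set \<Rightarrow>\<^sub>0 int)" where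
  "proj_ring A R = frag_extend (\<lambda>g. frag_of (proj A R g))"

text \<open>Sanity checks: these are indeed groups, and \<open>reduce\<close> maps every word to an element of the free
  group.\<close>

lemma inv_letter_inv_letter [simp]: "inv_letter (inv_letter l) = l"
  by (simp add: inv_letter_def)

lemma inv_letter_eq_iff: "m = inv_letter l \<longleftrightarrow> l = inv_letter m"
  by auto

lemma reduced_Nil [simp]: "reduced []"
  by (simp add: reduced_def)

lemma reduced_Cons: "reduced (l # w) \<longleftrightarrow> (w = [] \<or> hd w \<noteq> inv_letter l) \<and> reduced w"
  by (auto simp: reduced_def successively_Cons)

lemma reduced_push: "reduced w \<Longrightarrow> reduced (push_letter l w)"
  by (cases w) (auto simp: reduced_Cons)

lemma push_inv: "reduced w \<Longrightarrow> push_letter l (push_letter (inv_letter l) w) = w"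
proof (cases w)
  case (Cons m v)
  assume "reduced w"
  then show ?thesis using Cons
    by (cases v) (auto simp: reduced_Cons inv_letter_eq_iff)
qed simp

lemma reduced_foldr: "reduced w \<Longrightarrow> reduced (foldr push_letter u w)"
  by (induction u) (auto intro: reduced_push)

lemma reduced_reduce: "reduced (reduce w)"
  by (simp add: reduce_def reduced_foldr)

lemma reduce_reduced: "reduced w \<Longrightarrow> reduce w = w"
proof (induction w)
  case (Cons l w)
  then show ?case
    by (cases w) (auto simp: reduce_def reduced_Cons)
qed (simp add: reduce_def)

lemma reduce_append: "reduce (u @ v) = foldr push_letter u (reduce v)"
  by (simp add: reduce_def)

lemma foldr_push_letter:
  "reduced w \<Longrightarrow> foldr push_letter (push_letter l u) w = push_letter l (foldr push_letter u w)"
proof (cases u)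
  case (Cons m v)
  assume w: "reduced w"
  show ?thesis
    using Cons push_inv[OF reduced_foldr[OF w], of l v] by auto
qed simp

lemma foldr_reduce: "reduced w \<Longrightarrow> foldr push_letter (reduce u) w = foldr push_letter u w"
  by (induction u) (simp_all add: reduce_def foldr_push_letter)

lemma push_letter_words: "l \<in> A \<times> UNIV \<Longrightarrow> w \<in> words A \<Longrightarrow> push_letter l w \<in> words A"
  by (cases w) (auto simp: words_def)

lemma reduce_words: "w \<in> words A \<Longrightarrow> reduce w \<in> words A"
proof (induction w)
  case (Cons l w)
  then have "l \<in> A \<times> UNIV" "reduce w \<in> words A" by (auto simp: words_def)
  then show ?case using push_letter_words by (auto simp: reduce_def)
qed (simp add: reduce_def words_def)

lemma reduce_in_free_group: "w \<in> words A \<Longrightarrow> reduce w \<in> carrier (free_group A)"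
  by (simp add: free_group_def reduced_reduce reduce_words)

lemma reduce_rev_inverse: "reduce (map inv_letter (rev w) @ w) = []"
proof (induction w)
  case (Cons l w)
  have "push_letter (inv_letter l) (push_letter l (reduce w)) = reduce w"
    using push_inv[of "reduce w" "inv_letter l"] by (simp add: reduced_reduce)
  then have "reduce (map inv_letter (rev (l # w)) @ l # w) = foldr push_letter (map inv_letter (rev w)) (reduce w)"
    by (simp add: reduce_def)
  then show ?case using Cons by (simp add: reduce_append)
qed (simp add: reduce_def)

lemma group_free_group: "group (free_group A)"
proof (rule groupI)
  fix x y assume "x \<in> carrier (free_group A)" "y \<in> carrier (free_group A)"
  then have "x @ y \<in> words A" by (simp add: free_group_def words_def)
  then show "x \<otimes>\<^bsub>free_group A\<^esub> y \<in> carrier (free_group A)"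
    using reduce_in_free_group by (simp add: free_group_def)
next
  fix x y z :: "'a word"
  have "foldr push_letter (reduce (x @ y)) (reduce z) = foldr push_letter (x @ y) (reduce z)"
    by (rule foldr_reduce[OF reduced_reduce])
  then show "x \<otimes>\<^bsub>free_group A\<^esub> y \<otimes>\<^bsub>free_group A\<^esub> z = x \<otimes>\<^bsub>free_group A\<^esub> (y \<otimes>\<^bsub>free_group A\<^esub> z)"
    by (simp add: free_group_def reduce_append reduce_reduced[OF reduced_reduce]
        reduce_reduced[OF reduced_foldr[OF reduced_reduce]])
next
  fix x assume x: "x \<in> carrier (free_group A)"
  show "\<exists>y\<in>carrier (free_group A). y \<otimes>\<^bsub>free_group A\<^esub> x = \<one>\<^bsub>free_group A\<^esub>"
  proof (intro bexI)
    let ?v = "map inv_letter (rev x)"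
    have red: "reduced x" and wx: "x \<in> words A" using x by (auto simp: free_group_def)
    have "reduce (reduce ?v @ x) = reduce (?v @ x)"
      using foldr_reduce[OF reduced_reduce, of ?v x] by (simp add: reduce_append)
    then show "reduce ?v \<otimes>\<^bsub>free_group A\<^esub> x = \<one>\<^bsub>free_group A\<^esub>"
      using reduce_rev_inverse[of x] by (simp add: free_group_def)
    have "?v \<in> words A" using wx by (fastforce simp: words_def inv_letter_def mem_Times_iff)
    then show "reduce ?v \<in> carrier (free_group A)" by (rule reduce_in_free_group)
  qed
qed (auto simp: free_group_def words_def reduce_reduced)

lemma relator_subgroup_normal:
  assumes "R \<subseteq> carrier (free_group A)"
  shows "relator_subgroup A R \<lhd> free_group A"
proof -
  interpret F: group "free_group A" by (rule group_free_group)
  let ?\<N> = "{N. N \<lhd> free_group A \<and> R \<subseteq> N}"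
  have "carrier (free_group A) \<lhd> free_group A"
    by (rule F.normal_invI[OF F.subgroup_self]) auto
  then have ne: "?\<N> \<noteq> {}" using assms by blast
  have "subgroup (\<Inter>?\<N>) (free_group A)"
    by (rule F.subgroups_Inter[OF _ ne]) (auto simp: normal_def)
  then have "\<Inter>?\<N> \<lhd> free_group A"
    by (rule F.normal_invI) (auto intro: normal.inv_op_closed2)
  then show ?thesis by (simp add: relator_subgroup_def hull_def)
qed

lemma group_presented_group:
  "R \<subseteq> carrier (free_group A) \<Longrightarrow> group (presented_group A R)"
  unfolding presented_group_def by (intro normal.factorgroup_is_group relator_subgroup_normal)


section \<open>Amenability\<close>

text \<open>Amenability of the discrete group \<open>G\<close>: there is a left-invariant finitely additive
  probability measure defined on all subsets of \<open>G\<close>.\<close>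

definition amenable :: "('g, 'm) monoid_scheme \<Rightarrow> bool" where
  "amenable G \<longleftrightarrow>
     (\<exists>\<mu> :: 'g set \<Rightarrow> real.
        (\<forall>S. S \<subseteq> carrier G \<longrightarrow> 0 \<le> \<mu> S) \<and>
        \<mu> (carrier G) = 1 \<and>
        (\<forall>S T. S \<subseteq> carrier G \<longrightarrow> T \<subseteq> carrier G \<longrightarrow> S \<inter> T = {} \<longrightarrow> \<mu> (S \<union> T) = \<mu> S + \<mu> T) \<and>
        (\<forall>g \<in> carrier G. \<forall>S. S \<subseteq> carrier G \<longrightarrow> \<mu> (g <#\<^bsub>G\<^esub> S) = \<mu> S))"


section \<open>The operator norm in the left-regular representation\<close>

text \<open>Vectors of \<open>\<ell>\<^sup>2(I)\<close> are square-summable functions that vanish outside the index set \<open>I\<close>.\<close>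

definition ell2 :: "'g set \<Rightarrow> ('g \<Rightarrow> complex) set" where
  "ell2 I = {\<xi>. (\<forall>x. x \<notin> I \<longrightarrow> \<xi> x = 0) \<and> (\<lambda>x. (cmod (\<xi> x))\<^sup>2) summable_on I}"

definition ell2_norm :: "'g set \<Rightarrow> ('g \<Rightarrow> complex) \<Rightarrow> real" where
  "ell2_norm I \<xi> = sqrt (\<Sum>\<^sub>\<infinity>x\<in>I. (cmod (\<xi> x))\<^sup>2)"

text \<open>This real-valued supremum is meaningful for bounded operators only. The operators used below are
  finite linear combinations of unitaries, hence bounded.\<close>

definition ell2_opnorm :: "'g set \<Rightarrow> (('g \<Rightarrow> complex) \<Rightarrow> ('g \<Rightarrow> complex)) \<Rightarrow> real" where
  "ell2_opnorm I T = (SUP \<xi> \<in> {\<xi> \<in> ell2 I. ell2_norm I \<xi> \<le> 1}. ell2_norm I (T \<xi>))"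

definition left_regular ::
    "('g, 'm) monoid_scheme \<Rightarrow> 'g \<Rightarrow> ('g \<Rightarrow> complex) \<Rightarrow> ('g \<Rightarrow> complex)" where
  "left_regular G g \<xi> = (\<lambda>h. if h \<in> carrier G then \<xi> (inv\<^bsub>G\<^esub> g \<otimes>\<^bsub>G\<^esub> h) else 0)"

definition left_regular_ring ::
    "('g, 'm) monoid_scheme \<Rightarrow> ('g \<Rightarrow>\<^sub>0 int) \<Rightarrow> ('g \<Rightarrow> complex) \<Rightarrow> ('g \<Rightarrow> complex)" where
  "left_regular_ring G a \<xi> =
     (\<lambda>h. \<Sum>g\<in>Poly_Mapping.keys a. of_int (Poly_Mapping.lookup a g) * left_regular G g \<xi> h)"

definition lambda_norm :: "('g, 'm) monoid_scheme \<Rightarrow> ('g \<Rightarrow>\<^sub>0 int) \<Rightarrow> real" where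
  "lambda_norm G a = ell2_opnorm (carrier G) (left_regular_ring G a)"


section \<open>Algorithms\<close>

text \<open>Algorithms are Kleene's programs for partial recursive functions on natural numbers:
  zero, successor, projection, composition, primitive recursion and minimisation.
  The result \<open>None\<close> means that the program diverges (or is applied to too few arguments).\<close>

datatype recf =
    Zero
  | Succ
  | Proj nat
  | Comp recf "recf list"
  | PrimRec recf recf
  | Minim recf

primrec run :: "recf \<Rightarrow> nat list \<Rightarrow> nat option" where
  "run Zero xs = Some 0"
| "run Succ xs = (case xs of [] \<Rightarrow> None | x # _ \<Rightarrow> Some (Suc x))"
| "run (Proj i) xs = (if i < length xs then Some (xs ! i) else None)"
| "run (Comp f gs) xs = Option.bind (those (map (\<lambda>g. run g xs) gs)) (run f)"
| "run (PrimRec f g) xs =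
     (case xs of
        [] \<Rightarrow> None
      | n # ys \<Rightarrow> rec_nat (run f ys) (\<lambda>k r. Option.bind r (\<lambda>v. run g (k # v # ys))) n)"
| "run (Minim f) xs =
     (if \<exists>n. run f (n # xs) = Some 0 \<and> (\<forall>k<n. \<exists>v. run f (k # xs) = Some (Suc v))
      then Some (LEAST n. run f (n # xs) = Some 0) else None)"

text \<open>Inputs are coded by natural numbers. The enumeration \<open>to_nat_on A\<close> of the finite set \<open>A\<close> is an
  arbitrary fixed bijection onto \<open>{..<card A}\<close>; since any two such bijections differ by a finite
  permutation, the choice does not affect decidability or computability.\<close>

definition letter_code :: "'a set \<Rightarrow> 'a letter \<Rightarrow> nat" where
  "letter_code A l = prod_encode (to_nat_on A (fst l), of_bool (snd l))"

definition word_code :: "'a set \<Rightarrow> 'a word \<Rightarrow> nat" where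
  "word_code A w = list_encode (map (letter_code A) w)"

text \<open>An element of the group ring of the free group is given to an algorithm as a formal sum, i.e. a
  list of pairs of an integer coefficient and a word. Words need not be reduced, and different formal
  sums may denote the same element.\<close>

type_synonym 'a formal_sum = "(int \<times> 'a word) list"

definition formal_sums :: "'a set \<Rightarrow> 'a formal_sum set" where
  "formal_sums A = lists (UNIV \<times> words A)"

definition formal_sum_value :: "'a formal_sum \<Rightarrow> ('a word \<Rightarrow>\<^sub>0 int)" where
  "formal_sum_value s = (\<Sum>(c, w)\<leftarrow>s. Poly_Mapping.single (reduce w) c)"

definition formal_sum_code :: "'a set \<Rightarrow> 'a formal_sum \<Rightarrow> nat" where
  "formal_sum_code A s = list_encode (map (\<lambda>(c, w). prod_encode (int_encode c, word_code A w)) s)"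


section \<open>Decidability of the word problem and computability of functions on the group ring\<close>

definition word_problem_decidable :: "'a set \<Rightarrow> 'a word set \<Rightarrow> bool" where
  "word_problem_decidable A R \<longleftrightarrow>
     (\<exists>P. \<forall>w \<in> words A.
        run P [word_code A w] =
          Some (if proj A R (reduce w) = \<one>\<^bsub>presented_group A R\<^esub> then 1 else 0))"

text \<open>On input \<open>s\<close> and \<open>n\<close>, the algorithm outputs the pair of the rational numbers \<open>p n\<close> and \<open>q n\<close>,
  each coded via the (computable) surjection \<open>nat_to_rat_surj\<close>. Only the values of \<open>f\<close> on elements
  of the group ring of the presented group matter. The boundedness conditions are needed since
  suprema and infima of unbounded sets of reals are unspecified.\<close>

definition group_ring_computable ::
    "'a set \<Rightarrow> 'a word set \<Rightarrow> (('a word set \<Rightarrow>\<^sub>0 int) \<Rightarrow> real) \<Rightarrow> bool" where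
  "group_ring_computable A R f \<longleftrightarrow>
     (\<exists>P. \<forall>s \<in> formal_sums A. \<exists>p q :: nat \<Rightarrow> rat.
        (\<forall>n. \<exists>i j. run P [formal_sum_code A s, n] = Some (prod_encode (i, j)) \<and>
                   nat_to_rat_surj i = p n \<and> nat_to_rat_surj j = q n) \<and>
        mono p \<and> antimono q \<and>
        bdd_above (range (\<lambda>n. real_of_rat (p n))) \<and>
        bdd_below (range (\<lambda>n. real_of_rat (q n))) \<and>
        (SUP n. real_of_rat (p n)) = f (proj_ring A R (formal_sum_value s)) \<and>
        (INF n. real_of_rat (q n)) = f (proj_ring A R (formal_sum_value s)))"

end

theory Submission
  imports Defs "HOL-Analysis.L2_Norm"
begin

text \<open>The norm of \<open>1 - g\<close> vanishes if \<open>g\<close> is trivial in \<open>\<Gamma>\<close> and is at least \<open>1\<close> otherwise, so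
  rational approximations to the norm decide the word problem.

  Conversely, the norm of \<open>a\<close> is the supremum of the norms of its compressions \<open>B\<close> to finite subsets
  \<open>F\<close> of \<open>\<Gamma>\<close>, and averaging over the right translates of \<open>F\<close> shows
  \<open>\<parallel>a\<parallel> \<le> \<parallel>B\<parallel> + (\<Sum>g. \<bar>a g\<bar> * card {x \<in> F. g x \<notin> F} / card F)\<close>. By amenability the last term can be made
  arbitrarily small: otherwise the marriage theorem yields two disjoint copies of \<open>\<Gamma>\<close> inside
  \<open>\<Gamma>\<close> that are obtained by piecewise left translations, which an invariant mean forbids.
  If the word problem is decidable, then \<open>B\<close>, this term and the sum \<open>S\<close> of the squares of the entries
  of \<open>(B\<^sup>T B)\<^sup>k\<close> can be computed from \<open>F\<close>, and \<open>\<parallel>B\<parallel>\<^sup>4\<^sup>k \<le> S \<le> card F * \<parallel>B\<parallel>\<^sup>4\<^sup>k\<close>. Enumerating all \<open>F\<close>, \<open>k\<close> and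
  all rational numbers therefore approximates the norm from both sides.\<close>

section \<open>Recursive functions of several arguments\<close>

text \<open>The factor 4 in the exponents arises because the sum of the squares of the entries of
  (B^T B)^k is the trace of (B^T B)^(2k), that is, the sum of the 4k-th powers of the singular
  values of B. It is an integer polynomial in the integer entries of B, so testing it against powers
  of a rational number is exact arithmetic. Log-convexity of the norms of (B^T B)^k at a fixed
  vector takes the place of diagonalisation. By itself a compression bounds the norm only from
  below. Averaging gives the reverse estimate because right translations commute with the left
  regular representation: the compressions to all translates of F have the same matrix. If Folner's
  condition fails for K, finite sets grow by a factor 1 + eps only, whereas two disjoint copies of
  the group require a factor 2. Passing to a product set K^n closes this gap. In the other
  direction, approximations alone can never confirm that a real number is zero. The gap between 0
  and 1 is what makes the search stop.\<close>

definition rec_computable :: "nat \<Rightarrow> (nat list \<Rightarrow> nat) \<Rightarrow> bool" where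
  "rec_computable n f \<longleftrightarrow> (\<exists>P. \<forall>xs. length xs = n \<longrightarrow> run P xs = Some (f xs))"

lemma those_map_Some: "(\<And>x. x \<in> set xs \<Longrightarrow> f x = Some (g x)) \<Longrightarrow> those (map f xs) = Some (map g xs)"
  by (induction xs) auto

lemma rec_computable_comp:
  assumes f: "rec_computable m f" and len: "length gs = m" and gs: "list_all (rec_computable n) gs"
  shows "rec_computable n (\<lambda>xs. f (map (\<lambda>g. g xs) gs))"
proof -
  obtain P where P: "\<And>xs. length xs = m \<Longrightarrow> run P xs = Some (f xs)"
    using f by (auto simp: rec_computable_def)
  obtain Q where Q: "\<And>g xs. g \<in> set gs \<Longrightarrow> length xs = n \<Longrightarrow> run (Q g) xs = Some (g xs)"
    using gs unfolding rec_computable_def list_all_iff by metis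
  have "run (Comp P (map Q gs)) xs = Some (f (map (\<lambda>g. g xs) gs))" if "length xs = n" for xs
  proof -
    have "those (map (\<lambda>g. run (Q g) xs) gs) = Some (map (\<lambda>g. g xs) gs)"
      by (rule those_map_Some) (use Q that in auto)
    then show ?thesis by (simp add: P comp_def len)
  qed
  then show ?thesis unfolding rec_computable_def by blast
qed

lemma rec_computable_cong:
  "(\<And>xs. length xs = n \<Longrightarrow> f xs = g xs) \<Longrightarrow> rec_computable n f \<Longrightarrow> rec_computable n g"
  by (simp add: rec_computable_def)

lemma rec_computable_nth: "i < n \<Longrightarrow> rec_computable n (\<lambda>xs. xs ! i)"
  unfolding rec_computable_def by (rule exI[of _ "Proj i"]) auto

lemma rec_computable_zero: "rec_computable n (\<lambda>xs. 0)"
  unfolding rec_computable_def by (rule exI[of _ "Zero"]) auto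

lemma rec_computable_Suc:
  assumes "rec_computable n f" shows "rec_computable n (\<lambda>xs. Suc (f xs))"
proof -
  have "rec_computable 1 (\<lambda>xs. Suc (xs ! 0))"
    unfolding rec_computable_def by (rule exI[of _ "Succ"]) (auto simp: length_Suc_conv)
  from rec_computable_comp[OF this, of "[f]" n] assms show ?thesis by simp
qed

lemma rec_computable_const: "rec_computable n (\<lambda>xs. c)"
  by (induction c) (auto intro: rec_computable_zero rec_computable_Suc)

lemma rec_computable_rec_nat:
  assumes a: "rec_computable n a"
    and g: "rec_computable (Suc (Suc n)) (\<lambda>xs. g (drop 2 xs) (xs ! 0) (xs ! 1))"
    and h: "rec_computable n h"
  shows "rec_computable n (\<lambda>ys. rec_nat (a ys) (g ys) (h ys))"
proof -
  obtain P where P: "\<And>xs. length xs = n \<Longrightarrow> run P xs = Some (a xs)"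
    using a by (auto simp: rec_computable_def)
  obtain Q where Q: "\<And>xs. length xs = Suc (Suc n) \<Longrightarrow> run Q xs = Some (g (drop 2 xs) (xs ! 0) (xs ! 1))"
    using g by (auto simp: rec_computable_def)
  have rec: "rec_nat (run P ys) (\<lambda>k r. Option.bind r (\<lambda>v. run Q (k # v # ys))) m =
      Some (rec_nat (a ys) (g ys) m)" if "length ys = n" for ys m
    using that by (induction m) (auto simp: P Q)
  have "rec_computable (Suc n) (\<lambda>xs. rec_nat (a (tl xs)) (g (tl xs)) (xs ! 0))"
    unfolding rec_computable_def
    by (rule exI[of _ "PrimRec P Q"]) (auto simp: length_Suc_conv rec)
  \<comment> \<open>\<open>PrimRec\<close> recurses on its first argument; composing with
    \<open>h\<close> and all projections puts \<open>h ys\<close> there and keeps \<open>ys\<close>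
    as parameters.\<close>
  from rec_computable_comp[OF this, of "h # map (\<lambda>i xs. xs ! i) [0..<n]" n]
  have "rec_computable n (\<lambda>xs. rec_nat (a (map (\<lambda>i. xs ! i) [0..<n])) (g (map (\<lambda>i. xs ! i) [0..<n])) (h xs))"
    using h by (simp add: list_all_iff rec_computable_nth comp_def)
  then show ?thesis
    by (rule rec_computable_cong[rotated]) (auto simp: map_nth)
qed

definition rec_computable2 :: "(nat \<Rightarrow> nat \<Rightarrow> nat) \<Rightarrow> bool" where
  "rec_computable2 f \<longleftrightarrow> rec_computable 2 (\<lambda>xs. f (xs ! 0) (xs ! 1))"

lemma rec_computable2_comp:
  assumes "rec_computable2 f" "rec_computable n g" "rec_computable n h"
  shows "rec_computable n (\<lambda>xs. f (g xs) (h xs))"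
  using rec_computable_comp[of 2 "\<lambda>xs. f (xs ! 0) (xs ! 1)" "[g, h]" n] assms
  by (simp add: rec_computable2_def)

definition rec_computable1 :: "(nat \<Rightarrow> nat) \<Rightarrow> bool" where
  "rec_computable1 f \<longleftrightarrow> rec_computable 1 (\<lambda>xs. f (xs ! 0))"

lemma rec_computable1_comp:
  assumes "rec_computable1 f" "rec_computable n g"
  shows "rec_computable n (\<lambda>xs. f (g xs))"
  using rec_computable_comp[of 1 "\<lambda>xs. f (xs ! 0)" "[g]" n] assms
  by (auto simp: rec_computable1_def)

lemma rec_computable2_rec_nat:
  assumes a: "rec_computable1 a" and g: "rec_computable 3 (\<lambda>xs. g (xs ! 2) (xs ! 0) (xs ! 1))"
  shows "rec_computable2 (\<lambda>m y. rec_nat (a y) (g y) m)"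
proof -
  have "rec_computable 2 (\<lambda>xs. rec_nat (a (xs ! 1)) (\<lambda>k v. g (xs ! 1) k v) (xs ! 0))"
  proof (rule rec_computable_rec_nat)
    show "rec_computable 2 (\<lambda>xs. a (xs ! 1))" by (intro rec_computable1_comp[OF a] rec_computable_nth) auto
    have "rec_computable 4 (\<lambda>xs. g (xs ! 3) (xs ! 0) (xs ! 1))"
      using rec_computable_comp[OF g, of "[\<lambda>xs. xs ! 0, \<lambda>xs. xs ! 1, \<lambda>xs. xs ! 3]" 4]
      by (simp add: rec_computable_nth)
    then have "rec_computable (Suc (Suc 2)) (\<lambda>xs. g (xs ! 3) (xs ! 0) (xs ! 1))" by simp
    then show "rec_computable (Suc (Suc 2)) (\<lambda>xs. g (drop 2 xs ! 1) (xs ! 0) (xs ! 1))"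
      by (rule rec_computable_cong[rotated]) auto
  qed (auto intro: rec_computable_nth)
  then show ?thesis by (simp add: rec_computable2_def)
qed

lemma rec_computable1_rec_nat:
  assumes g: "rec_computable2 g"
  shows "rec_computable1 (\<lambda>m. rec_nat a g m)"
  unfolding rec_computable1_def
proof (rule rec_computable_rec_nat)
  show "rec_computable (Suc (Suc 1)) (\<lambda>xs. g (xs ! 0) (xs ! 1))"
    by (intro rec_computable2_comp[OF g] rec_computable_nth) auto
qed (auto intro: rec_computable_nth rec_computable_const)

section \<open>Arithmetic and the Cantor pairing function\<close>

lemma rec_computable2_add: "rec_computable2 (+)"
proof -
  have "rec_computable2 (\<lambda>m y. rec_nat y (\<lambda>k v. Suc v) m)"
    by (rule rec_computable2_rec_nat)
       (auto simp: rec_computable1_def intro!: rec_computable_nth rec_computable_Suc)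
  moreover have "rec_nat y (\<lambda>k v. Suc v) m = m + y" for m y by (induction m) auto
  ultimately show ?thesis by simp
qed

lemma rec_computable1_pred: "rec_computable1 (\<lambda>x. x - 1)"
proof -
  have "rec_computable1 (\<lambda>m. rec_nat 0 (\<lambda>k v. k) m)"
    by (rule rec_computable1_rec_nat) (auto simp: rec_computable2_def intro!: rec_computable_nth)
  moreover have "rec_nat 0 (\<lambda>k v. k) m = m - 1" for m :: nat by (cases m) auto
  ultimately show ?thesis by simp
qed

lemma rec_computable2_diff: "rec_computable2 (-)"
proof -
  have "rec_computable2 (\<lambda>m y. rec_nat y (\<lambda>k v. v - 1) m)"
    by (rule rec_computable2_rec_nat)
       (auto simp: rec_computable1_def intro!: rec_computable_nth rec_computable1_comp[OF rec_computable1_pred, simplified])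
  moreover have "rec_nat y (\<lambda>k v. v - 1) m = y - m" for m y :: nat by (induction m) auto
  ultimately have "rec_computable2 (\<lambda>m y. y - m)" by simp
  \<comment> \<open>The recursion runs on the subtrahend, so the arguments have to be
    exchanged.\<close>
  from rec_computable2_comp[OF this, of 2 "\<lambda>xs. xs ! 1" "\<lambda>xs. xs ! 0"] show ?thesis
    by (simp add: rec_computable2_def rec_computable_nth)
qed

lemma rec_computable2_mult: "rec_computable2 (*)"
proof -
  have "rec_computable2 (\<lambda>m y. rec_nat 0 (\<lambda>k v. v + y) m)"
    by (rule rec_computable2_rec_nat)
       (auto simp: rec_computable1_def intro!: rec_computable_nth rec_computable_const rec_computable2_comp[OF rec_computable2_add])
  moreover have "rec_nat 0 (\<lambda>k v. v + y) m = m * y" for m y :: nat by (induction m) auto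
  ultimately show ?thesis by simp
qed

lemma rec_computable1_triangle: "rec_computable1 triangle"
proof -
  have "rec_computable1 (\<lambda>m. rec_nat 0 (\<lambda>k v. v + Suc k) m)"
    by (rule rec_computable1_rec_nat)
       (auto simp: rec_computable2_def simp del: add_Suc_right intro!: rec_computable_nth rec_computable_Suc rec_computable2_comp[OF rec_computable2_add])
  moreover have "rec_nat 0 (\<lambda>k v. v + Suc k) m = triangle m" for m by (induction m) auto
  ultimately have "rec_computable1 (\<lambda>m. triangle m)" by (simp only:)
  then show ?thesis by simp
qed

lemma rec_computable2_prod_encode: "rec_computable2 (\<lambda>a b. prod_encode (a, b))"
  unfolding prod_encode_def rec_computable2_def split
  by (intro rec_computable2_comp[OF rec_computable2_add] rec_computable1_comp[OF rec_computable1_triangle] rec_computable_nth) auto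

text \<open>Unlike \<^const>\<open>prod_decode\<close> itself, the index of the diagonal of a pair satisfies a
  recursion with a single natural number as state.\<close>

lemma diagonal_prod_decode_Suc:
  "fst (prod_decode (Suc x)) + snd (prod_decode (Suc x)) =
    (let s = fst (prod_decode x) + snd (prod_decode x) in s + (1 - (triangle (Suc s) - Suc x)))"
proof -
  obtain a b where ab: "prod_decode x = (a, b)" by fastforce
  then have x: "x = triangle (a + b) + a"
    using prod_decode_inverse[of x] by (simp add: prod_encode_def)
  \<comment> \<open>Subtraction is truncated, so the increment is 1 exactly when
    \<open>Suc x\<close> reaches \<open>triangle (Suc s)\<close>, that is, when \<open>b = 0\<close>
    and the diagonal is exhausted.\<close>
  show ?thesis
  proof (cases b)
    case 0
    have "prod_encode (0, Suc a) = Suc x" by (simp add: prod_encode_def x 0)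
    then have d: "prod_decode (Suc x) = (0, Suc a)" by (metis prod_encode_inverse)
    show ?thesis unfolding ab d by (simp add: x 0)
  next
    case (Suc c)
    have "prod_encode (Suc a, c) = Suc x" by (simp add: prod_encode_def x Suc)
    then have d: "prod_decode (Suc x) = (Suc a, c)" by (metis prod_encode_inverse)
    show ?thesis unfolding ab d by (simp add: x Suc)
  qed
qed

lemma rec_computable1_diagonal: "rec_computable1 (\<lambda>x. fst (prod_decode x) + snd (prod_decode x))"
proof -
  have "rec_computable1 (\<lambda>m. rec_nat 0 (\<lambda>k s. s + (1 - (triangle (Suc s) - Suc k))) m)"
    by (rule rec_computable1_rec_nat)
       (auto simp: rec_computable2_def simp del: add_Suc_right triangle_Suc intro!: rec_computable_nth rec_computable_const rec_computable_Suc
         rec_computable2_comp[OF rec_computable2_diff] rec_computable1_comp[OF rec_computable1_triangle] rec_computable2_comp[OF rec_computable2_add])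
  moreover have "rec_nat 0 (\<lambda>k s. s + (1 - (triangle (Suc s) - Suc k))) m
      = fst (prod_decode m) + snd (prod_decode m)" for m
  proof (induction m)
    case 0
    have "prod_decode 0 = (0, 0)" by (simp add: prod_decode_def prod_decode_aux.simps)
    then show ?case by simp
  next
    case (Suc m)
    then show ?case unfolding diagonal_prod_decode_Suc by (simp only: Let_def old.nat.rec(2))
  qed
  ultimately show ?thesis by (simp only:)
qed

lemma rec_computable1_fst: "rec_computable1 (\<lambda>x. fst (prod_decode x))"
proof -
  have "rec_computable1 (\<lambda>x. x - triangle (fst (prod_decode x) + snd (prod_decode x)))"
    unfolding rec_computable1_def
    by (intro rec_computable2_comp[OF rec_computable2_diff] rec_computable1_comp[OF rec_computable1_triangle]
        rec_computable1_comp[OF rec_computable1_diagonal] rec_computable_nth) auto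
  moreover have "x - triangle (fst (prod_decode x) + snd (prod_decode x)) = fst (prod_decode x)" for x
    using prod_decode_inverse[of x] by (cases "prod_decode x") (simp add: prod_encode_def)
  ultimately show ?thesis by simp
qed

lemma rec_computable1_snd: "rec_computable1 (\<lambda>x. snd (prod_decode x))"
proof -
  have "rec_computable1 (\<lambda>x. (fst (prod_decode x) + snd (prod_decode x)) - fst (prod_decode x))"
    unfolding rec_computable1_def
    by (intro rec_computable2_comp[OF rec_computable2_diff] 
        rec_computable1_comp[OF rec_computable1_diagonal] rec_computable1_comp[OF rec_computable1_fst] rec_computable_nth) auto
  then show ?thesis by simp
qed

section \<open>Computability on encodable types\<close>

text \<open>Injectivity is all that is required: a program for a computable function is
  unconstrained on numbers that code nothing. Once generators are replaced by numbers, the instances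
  reproduce \<open>letter_code\<close>, \<open>word_code\<close> and \<open>formal_sum_code\<close>,
  so inputs never have to be recoded.\<close>

class encodable =
  fixes encode :: "'a \<Rightarrow> nat"
  assumes inj_encode: "inj encode"

lemma encode_eq_iff [simp]: "encode x = encode y \<longleftrightarrow> x = y"
  using inj_encode by (auto dest: injD)

instantiation nat :: encodable
begin
definition encode_nat :: "nat \<Rightarrow> nat" where "encode_nat n = n"
instance by standard (simp add: inj_def encode_nat_def)
end

instantiation bool :: encodable
begin
definition encode_bool :: "bool \<Rightarrow> nat" where "encode_bool b = of_bool b"
instance by standard (simp add: inj_def encode_bool_def)
end

instantiation int :: encodable
begin
definition encode_int :: "int \<Rightarrow> nat" where "encode_int i = int_encode i"
instance by standard (rule injI, metis encode_int_def int_encode_inverse)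
end

instantiation prod :: (encodable, encodable) encodable
begin
definition encode_prod :: "'a \<times> 'b \<Rightarrow> nat" where
  "encode_prod p = prod_encode (encode (fst p), encode (snd p))"
instance by standard (auto simp: inj_def encode_prod_def prod_eq_iff)
end

instantiation list :: (encodable) encodable
begin
definition encode_list :: "'a list \<Rightarrow> nat" where "encode_list xs = list_encode (map encode xs)"
instance
  by standard (metis comp_def encode_list_def inj_def inj_encode inj_mapI list_encode_eq)
end

definition computable :: "('a :: encodable \<Rightarrow> 'b :: encodable) \<Rightarrow> bool" where
  "computable f \<longleftrightarrow> (\<exists>P. \<forall>x. run P [encode x] = Some (encode (f x)))"

named_theorems computable_intros

text \<open>The code of a number is the number itself, so a numerical program that produces codes is
  a program for values of any encodable type.\<close>

lemma computable_encode: "computable (\<lambda>x. encode (f x)) \<longleftrightarrow> computable f"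
  by (simp add: computable_def encode_nat_def)

lemma computable_rec_computable:
  assumes "rec_computable1 F" "\<And>x. F (encode x) = encode (f x)"
  shows "computable f"
proof -
  obtain P where "\<And>xs. length xs = 1 \<Longrightarrow> run P xs = Some (F (xs ! 0))"
    using assms(1) by (auto simp: rec_computable1_def rec_computable_def)
  then show ?thesis unfolding computable_def by (intro exI[of _ P]) (simp add: assms(2))
qed

lemma computable_const [computable_intros]: "computable (\<lambda>x. c)"
  by (rule computable_rec_computable[of "\<lambda>x. encode c"])
     (simp_all add: rec_computable1_def rec_computable_const)

lemma computable_ident [computable_intros]: "computable (\<lambda>x. x)"
  by (rule computable_rec_computable[of "\<lambda>x. x"]) (simp_all add: rec_computable1_def rec_computable_nth)

lemma computable_comp:
  assumes "computable g" "computable f" shows "computable (\<lambda>x. g (f x))"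
proof -
  obtain P Q where "\<And>x. run P [encode x] = Some (encode (f x))" "\<And>x. run Q [encode x] = Some (encode (g x))"
    using assms by (auto simp: computable_def)
  then show ?thesis unfolding computable_def by (intro exI[of _ "Comp Q [P]"]) simp
qed

lemma computable_nat2:
  assumes "rec_computable2 oper" "computable f" "computable g"
  shows "computable (\<lambda>x. oper (f x) (g x) :: nat)"
proof -
  obtain P Q R where "\<And>x. run P [encode x] = Some (f x)" "\<And>x. run Q [encode x] = Some (g x)"
    "\<And>xs. length xs = 2 \<Longrightarrow> run R xs = Some (oper (xs ! 0) (xs ! 1))"
    using assms by (auto simp: computable_def rec_computable2_def rec_computable_def encode_nat_def)
  then show ?thesis unfolding computable_def encode_nat_def by (intro exI[of _ "Comp R [P, Q]"]) simp
qed

lemmas computable_add_nat [computable_intros] = computable_nat2[OF rec_computable2_add]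
  and computable_diff_nat [computable_intros] = computable_nat2[OF rec_computable2_diff]
  and computable_mult_nat [computable_intros] = computable_nat2[OF rec_computable2_mult]

lemma computable_Suc [computable_intros]: "computable f \<Longrightarrow> computable (\<lambda>x. Suc (f x))"
  using computable_add_nat[OF _ computable_const[of 1]] by simp

lemma computable_Pair [computable_intros]:
  assumes "computable f" "computable g" shows "computable (\<lambda>x. (f x, g x))"
proof -
  have "computable (\<lambda>x. prod_encode (encode (f x), encode (g x)))"
    by (rule computable_nat2[OF rec_computable2_prod_encode]) (simp_all add: computable_encode assms)
  then show ?thesis
    using computable_encode[of "\<lambda>x. (f x, g x)"] by (simp add: encode_prod_def)
qed

lemma computable_fst [computable_intros]:
  assumes "computable f" shows "computable (\<lambda>x. fst (f x))"
proof -
  have "computable fst" by (rule computable_rec_computable[OF rec_computable1_fst]) (simp add: encode_prod_def)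
  from computable_comp[OF this assms] show ?thesis .
qed

lemma computable_snd [computable_intros]:
  assumes "computable f" shows "computable (\<lambda>x. snd (f x))"
proof -
  have "computable snd" by (rule computable_rec_computable[OF rec_computable1_snd]) (simp add: encode_prod_def)
  from computable_comp[OF this assms] show ?thesis .
qed

lemma computable_rec_nat [computable_intros]:
  assumes a: "computable a" and g: "computable (\<lambda>p. g (fst p) (fst (snd p)) (snd (snd p)))"
    and h: "computable h"
  shows "computable (\<lambda>x. rec_nat (a x) (g x) (h x))"
proof -
  obtain P where P: "\<And>x. run P [encode x] = Some (encode (a x))" using a by (auto simp: computable_def)
  obtain Q where Q: "\<And>x k v. run Q [encode (x, k :: nat, v)] = Some (encode (g x k v))"
    using g by (force simp: computable_def)
  obtain H where H: "\<And>x. run H [encode x] = Some (h x)" using h by (auto simp: computable_def encode_nat_def)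
  obtain E where E: "\<And>xs. length xs = 2 \<Longrightarrow> run E xs = Some (prod_encode (xs ! 0, xs ! 1))"
    using rec_computable2_prod_encode by (auto simp: rec_computable2_def rec_computable_def)
  \<comment> \<open>\<open>PrimRec\<close> hands over counter, accumulator and input separately,
    whereas \<open>Q\<close> expects the code of the nested pair \<open>(x, k, v)\<close>.\<close>
  define S where "S = Comp Q [Comp E [Proj 2, Comp E [Proj 0, Proj 1]]]"
  have S: "run S [k, encode v, encode x] = Some (encode (g x k v))" for k v x
    using Q[of x k v] by (simp add: S_def E encode_prod_def encode_nat_def)
  have "rec_nat (run P [encode x]) (\<lambda>k r. Option.bind r (\<lambda>v. run S (k # v # [encode x]))) m =
      Some (encode (rec_nat (a x) (g x) m))" for x m
    by (induction m) (auto simp: P S)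
  then have "run (Comp (PrimRec P S) [H, Proj 0]) [encode x] = Some (encode (rec_nat (a x) (g x) (h x)))" for x
    by (simp add: H)
  then show ?thesis unfolding computable_def by blast
qed

lemma computable_of_bool [computable_intros]: "computable f \<Longrightarrow> computable (\<lambda>x. of_bool (f x) :: nat)"
  by (simp add: computable_def encode_nat_def encode_bool_def)

lemma computable_If [computable_intros]:
  assumes "computable c" "computable f" "computable g"
  shows "computable (\<lambda>x. if c x then f x else g x)"
proof -
  \<comment> \<open>A recursion of length 0 or 1 serves as the case distinction.\<close>
  have "computable (\<lambda>x. rec_nat (g x) (\<lambda>k v. f x) (of_bool (c x)))"
    by (intro computable_intros assms computable_comp[OF assms(2)])
  moreover have "rec_nat (g x) (\<lambda>k v. f x) (of_bool (c x)) = (if c x then f x else g x)" for x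
    by simp
  ultimately show ?thesis by simp
qed

lemma computable_Not [computable_intros]:
  assumes "computable f" shows "computable (\<lambda>x. \<not> f x)"
  using computable_If[OF assms computable_const[of False] computable_const[of True]] by (simp add: if_bool_eq_conj)

lemma computable_conj [computable_intros]:
  assumes "computable f" "computable g" shows "computable (\<lambda>x. f x \<and> g x)"
proof -
  have "(\<lambda>x. f x \<and> g x) = (\<lambda>x. if f x then g x else False)" by auto
  then show ?thesis using computable_If[OF assms computable_const[of False]] by simp
qed

lemma computable_disj [computable_intros]:
  assumes "computable f" "computable g" shows "computable (\<lambda>x. f x \<or> g x)"
proof -
  have "(\<lambda>x. f x \<or> g x) = (\<lambda>x. if f x then True else g x)" by auto
  then show ?thesis using computable_If[OF assms(1) computable_const[of True] assms(2)] by simp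
qed

lemma computable_positive: assumes "computable f" shows "computable (\<lambda>x. 0 < (f x :: nat))"
proof -
  have "computable (\<lambda>x. 1 - (1 - f x))" by (intro computable_intros assms)
  moreover have "1 - (1 - n) = encode (0 < n)" for n :: nat by (cases n) (auto simp: encode_bool_def)
  ultimately show ?thesis using computable_encode[of "\<lambda>x. 0 < f x"] by simp
qed

lemma computable_less_nat [computable_intros]:
  assumes "computable f" "computable g" shows "computable (\<lambda>x. (f x :: nat) < g x)"
proof -
  have "computable (\<lambda>x. 0 < g x - f x)" by (intro computable_positive computable_intros assms)
  then show ?thesis by simp
qed

lemma computable_le_nat [computable_intros]:
  assumes "computable f" "computable g" shows "computable (\<lambda>x. (f x :: nat) \<le> g x)"
  using computable_Not[OF computable_less_nat[OF assms(2,1)]] by (simp add: not_less)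

text \<open>Injectivity of \<open>encode\<close> reduces equality in every encodable type to
  equality of numbers.\<close>

lemma computable_eq [computable_intros]:
  assumes "computable f" "computable g" shows "computable (\<lambda>x. f x = g x)"
proof -
  have "computable (\<lambda>x. encode (f x) \<le> encode (g x) \<and> encode (g x) \<le> encode (f x))"
    by (intro computable_intros) (simp_all add: computable_encode assms)
  then show ?thesis by (simp add: eq_iff[symmetric])
qed

lemma computable_power_nat [computable_intros]:
  assumes "computable f" "computable g" shows "computable (\<lambda>x. (f x :: nat) ^ g x)"
proof -
  have "computable (\<lambda>x. rec_nat 1 (\<lambda>k v. f x * v) (g x))"
    by (intro computable_intros assms computable_comp[OF assms(1)])
  moreover have "rec_nat 1 (\<lambda>k v. m * v) n = m ^ n" for m n :: nat by (induction n) auto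
  ultimately show ?thesis by simp
qed

text \<open>A bijective encoding is decoded by the identity program.\<close>

lemma computable_inv_encode: "surj (encode :: 'a :: encodable \<Rightarrow> nat) \<Longrightarrow> computable (inv_into UNIV encode :: nat \<Rightarrow> 'a)"
  unfolding computable_def encode_nat_def by (rule exI[of _ "Proj 0"]) (simp add: surj_f_inv_f)

lemma surj_encode_nat: "surj (encode :: nat \<Rightarrow> nat)"
  by (auto simp: surj_def encode_nat_def)

lemma surj_encode_prod:
  assumes "surj (encode :: 'a :: encodable \<Rightarrow> nat)" "surj (encode :: 'b :: encodable \<Rightarrow> nat)"
  shows "surj (encode :: 'a \<times> 'b \<Rightarrow> nat)"
proof (rule surjI)
  fix n
  show "encode (inv_into UNIV encode (fst (prod_decode n)) :: 'a, inv_into UNIV encode (snd (prod_decode n)) :: 'b) = n"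
    by (simp add: encode_prod_def surj_f_inv_f assms)
qed

lemma surj_encode_list:
  assumes "surj (encode :: 'a :: encodable \<Rightarrow> nat)"
  shows "surj (encode :: 'a list \<Rightarrow> nat)"
proof (rule surjI)
  fix n
  show "encode (map (inv_into UNIV encode) (list_decode n) :: 'a list) = n"
    by (simp add: encode_list_def comp_def surj_f_inv_f assms)
qed

section \<open>Lists and bounded iteration\<close>

lemma encode_Nil: "encode ([] :: 'a :: encodable list) = 0"
  by (simp add: encode_list_def)

lemma encode_Cons: "encode (x # xs) = Suc (prod_encode (encode x, encode xs))"
  by (simp add: encode_list_def)

lemma computable_Cons [computable_intros]:
  assumes "computable f" "computable g" shows "computable (\<lambda>x. f x # g x)"
proof -
  have "computable (\<lambda>x. Suc (encode (f x, g x)))"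
    by (intro computable_intros) (simp add: computable_encode computable_Pair assms)
  then show ?thesis
    using computable_encode[of "\<lambda>x. f x # g x"] by (simp add: encode_Cons encode_prod_def)
qed

lemma computable_tl [computable_intros]:
  assumes "computable f" shows "computable (\<lambda>x. tl (f x))"
proof -
  \<comment> \<open>\<open>1 - (1 - n)\<close> is the sign of \<open>n\<close>; it keeps the code 0
    of the empty list fixed, in agreement with \<open>tl [] = []\<close>.\<close>
  have 1: "rec_computable1 (\<lambda>n. (1 - (1 - n)) * snd (prod_decode (n - 1)))"
    unfolding rec_computable1_def
    by (intro rec_computable2_comp[OF rec_computable2_mult] rec_computable2_comp[OF rec_computable2_diff]
        rec_computable1_comp[OF rec_computable1_snd] rec_computable_const rec_computable_nth) auto
  have "computable (tl :: 'b list \<Rightarrow> 'b list)"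
  proof (rule computable_rec_computable[OF 1])
    fix xs :: "'b list"
    show "(1 - (1 - encode xs)) * snd (prod_decode (encode xs - 1)) = encode (tl xs)"
      by (cases xs) (simp_all add: encode_Nil encode_Cons)
  qed
  from computable_comp[OF this assms] show ?thesis .
qed

lemma computable_hd [computable_intros]:
  assumes "computable f" shows "computable (\<lambda>x. hd (f x))"
proof -
  \<comment> \<open>The last summand supplies the code of the unspecified value \<open>hd []\<close>
    when the input code is 0.\<close>
  have 1: "rec_computable1 (\<lambda>n. (1 - (1 - n)) * fst (prod_decode (n - 1)) + (1 - n) * encode (hd ([] :: 'b list)))"
    unfolding rec_computable1_def
    by (intro rec_computable2_comp[OF rec_computable2_mult] rec_computable2_comp[OF rec_computable2_diff]
        rec_computable2_comp[OF rec_computable2_add]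
        rec_computable1_comp[OF rec_computable1_fst] rec_computable_const rec_computable_nth) auto
  have "computable (hd :: 'b list \<Rightarrow> 'b)"
  proof (rule computable_rec_computable[OF 1])
    fix xs :: "'b list"
    show "(1 - (1 - encode xs)) * fst (prod_decode (encode xs - 1)) + (1 - encode xs) * encode (hd ([] :: 'b list)) = encode (hd xs)"
      by (cases xs) (simp_all add: encode_Nil encode_Cons)
  qed
  from computable_comp[OF this assms] show ?thesis .
qed

text \<open>Makes the code of a list usable as a number of iterations that is certainly large
  enough; \<open>length\<close> itself is only obtained afterwards, from
  \<open>foldl\<close>.\<close>

lemma length_le_encode: "length xs \<le> encode xs"
proof (induction xs)
  case (Cons x xs)
  have "encode xs \<le> prod_encode (encode x, encode xs)" by (rule le_prod_encode_2)
  with Cons show ?case by (simp add: encode_Cons)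
qed simp

text \<open>The accumulator and the rest of the list form the state of an iteration that stands
  still once the list is used up, so running it too long is harmless.\<close>

lemma computable_foldl [computable_intros]:
  assumes a: "computable a" and g: "computable (\<lambda>p. g (fst p) (fst (snd p)) (snd (snd p)))"
    and h: "computable h"
  shows "computable (\<lambda>x. foldl (g x) (a x) (h x))"
proof -
  define step where "step x st = (if snd st = [] then st else (g x (fst st) (hd (snd st)), tl (snd st)))" for x st
  have step: "computable (\<lambda>x. step (f1 x) (f2 x))" if "computable f1" "computable f2"
    for f1 :: "'z::encodable \<Rightarrow> 'a" and f2 :: "'z \<Rightarrow> 'b \<times> 'c list"
  proof -
    have "computable (\<lambda>x. g (f1 x) (fst (f2 x)) (hd (snd (f2 x))))"
      using computable_comp[OF g, of "\<lambda>x. (f1 x, fst (f2 x), hd (snd (f2 x)))"] that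
      by (simp add: computable_intros)
    then show ?thesis unfolding step_def
      by (intro computable_intros that)
  qed
  have "rec_nat (b, xs) (\<lambda>_. step x) m = (foldl (g x) b (take m xs), drop m xs)" for x b xs m
  proof (induction m)
    case (Suc m)
    then show ?case
      by (cases "m < length xs") (auto simp: step_def take_Suc_conv_app_nth hd_drop_conv_nth drop_Suc tl_drop)
  qed simp
  then have "fst (rec_nat (a x, h x) (\<lambda>_. step x) (encode (h x))) = foldl (g x) (a x) (h x)" for x
    by (simp add: length_le_encode)
  moreover have "computable (\<lambda>x. fst (rec_nat (a x, h x) (\<lambda>_. step x) (encode (h x))))"
    by (intro computable_intros step a h) (simp add: computable_encode h)
  ultimately show ?thesis by simp
qed

lemma computable_rev [computable_intros]:
  assumes "computable f" shows "computable (\<lambda>x. rev (f x))"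
proof -
  have "computable (\<lambda>x. foldl (\<lambda>acc y. y # acc) [] (f x))"
    by (intro computable_intros assms)
  moreover have "foldl (\<lambda>acc y. y # acc) [] xs = rev xs" for xs :: "'b list"
    by (simp add: foldl_conv_fold fold_Cons_rev)
  ultimately show ?thesis by simp
qed

lemma computable_append [computable_intros]:
  assumes "computable f" "computable g" shows "computable (\<lambda>x. f x @ g x)"
proof -
  have "computable (\<lambda>x. foldl (\<lambda>acc y. y # acc) (g x) (rev (f x)))"
    by (intro computable_intros assms)
  moreover have "foldl (\<lambda>acc y. y # acc) ys xs = rev xs @ ys" for xs ys :: "'b list"
    by (simp add: foldl_conv_fold fold_Cons_rev)
  ultimately show ?thesis by simp
qed

lemma computable_map [computable_intros]:
  assumes g: "computable (\<lambda>p. g (fst p) (snd p))" and f: "computable f"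
  shows "computable (\<lambda>x. map (g x) (f x))"
proof -
  have "computable (\<lambda>x. rev (foldl (\<lambda>acc y. g x y # acc) [] (f x)))"
    using computable_comp[OF g, of "\<lambda>p. (fst p, snd (snd p))"]
    by (intro computable_intros f) (simp_all add: computable_intros)
  moreover have "foldl (\<lambda>acc y. h y # acc) zs xs = rev (map h xs) @ zs" for h :: "'b \<Rightarrow> 'c" and xs zs
    by (induction xs arbitrary: zs) auto
  ultimately show ?thesis by simp
qed

lemma computable_filter [computable_intros]:
  assumes g: "computable (\<lambda>p. g (fst p) (snd p))" and f: "computable f"
  shows "computable (\<lambda>x. filter (g x) (f x))"
proof -
  have "computable (\<lambda>x. rev (foldl (\<lambda>acc y. if g x y then y # acc else acc) [] (f x)))"
    using computable_comp[OF g, of "\<lambda>p. (fst p, snd (snd p))"]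
    by (intro computable_intros f) (simp_all add: computable_intros)
  moreover have "foldl (\<lambda>acc y. if h y then y # acc else acc) zs xs = rev (filter h xs) @ zs" for h :: "'b \<Rightarrow> bool" and xs zs
    by (induction xs arbitrary: zs) auto
  ultimately show ?thesis by simp
qed

lemma computable_length [computable_intros]:
  assumes "computable f" shows "computable (\<lambda>x. length (f x))"
proof -
  have "computable (\<lambda>x. foldl (\<lambda>acc y. Suc acc) 0 (f x))"
    by (intro computable_intros assms)
  moreover have "foldl (\<lambda>acc y. Suc acc) n xs = length xs + n" for xs :: "'b list" and n
    by (induction xs arbitrary: n) auto
  ultimately show ?thesis by simp
qed

lemma computable_nth_default [computable_intros]:
  assumes "computable f" "computable g" shows "computable (\<lambda>x. nth_default d (f x) (g x))"
proof -
  have "computable (\<lambda>x. let l = rec_nat (f x) (\<lambda>k. tl) (g x) in if l = [] then d else hd l)"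
    unfolding Let_def by (intro computable_intros assms)
  moreover have "rec_nat xs (\<lambda>k. tl) n = drop n xs" for xs :: "'b list" and n
    by (induction n) (auto simp: drop_Suc tl_drop)
  moreover have "(let l = drop n xs in if l = [] then d else hd l) = nth_default d xs n" for xs n
    by (simp add: nth_default_def hd_drop_conv_nth)
  ultimately show ?thesis by (simp only:)
qed

lemma computable_map_upt [computable_intros]:
  assumes g: "computable (\<lambda>p. g (fst p) (snd p))" and f: "computable f"
  shows "computable (\<lambda>x. map (g x) [0..<f x])"
proof -
  have "computable (\<lambda>x. rev (rec_nat [] (\<lambda>k v. g x k # v) (f x)))"
    using computable_comp[OF g, of "\<lambda>p. (fst p, fst (snd p))"]
    by (intro computable_intros f) (simp_all add: computable_intros)
  moreover have "rec_nat [] (\<lambda>k v. h k # v) n = rev (map h [0..<n])" for h :: "nat \<Rightarrow> 'b" and n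
    by (induction n) auto
  ultimately show ?thesis by simp
qed

section \<open>Integers\<close>

lemma computable_decode_int:
  assumes "computable (\<lambda>n. f (int_decode n))" shows "computable f"
proof -
  obtain P where "\<And>n. run P [n] = Some (encode (f (int_decode n)))"
    using assms by (auto simp: computable_def encode_nat_def)
  then have "run P [encode i] = Some (encode (f i))" for i by (simp add: encode_int_def)
  then show ?thesis unfolding computable_def by blast
qed

text \<open>\<open>n div 2\<close> is the number of odd numbers below \<open>n\<close>, and parity
  comes from iterating \<open>1 - v\<close>.\<close>

lemma computable_div2:
  assumes "computable f" shows "computable (\<lambda>x. f x div (2::nat))"
proof -
  have "computable (\<lambda>x. rec_nat (0::nat) (\<lambda>k v. v + rec_nat 0 (\<lambda>k v. 1 - v) k) (f x))"
    by (intro computable_intros assms)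
  moreover have par: "rec_nat 0 (\<lambda>k v. 1 - v) n = n mod (2::nat)" for n by (induction n) (auto simp: mod_Suc)
  moreover have "rec_nat 0 (\<lambda>k v. v + k mod 2) n = n div 2" for n :: nat
    by (induction n) (auto simp: div_Suc mod_Suc)
  ultimately show ?thesis by simp
qed

lemma computable_even:
  assumes "computable f" shows "computable (\<lambda>x. even (f x :: nat))"
proof -
  have "computable (\<lambda>x. f x div 2 + f x div 2 = f x)"
    by (intro computable_intros computable_div2 assms)
  moreover have "(n div 2 + n div 2 = n) = even n" for n :: nat by presburger
  ultimately show ?thesis by simp
qed

text \<open>The coding of integers is a bijection, so the code can be inspected directly:
  nonnegative integers have even codes, negative ones odd codes.\<close>

lemma computable_nat [computable_intros]:
  assumes "computable f" shows "computable (\<lambda>x. nat (f x))"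
proof -
  have "computable (\<lambda>n. if even n then n div 2 else (0::nat))"
    by (intro computable_intros computable_div2 computable_even)
  moreover have "nat (int_decode n) = (if even n then n div 2 else 0)" for n
    by (auto simp: int_decode_def sum_decode_def)
  ultimately have "computable nat" by (intro computable_decode_int) simp
  from computable_comp[OF this assms] show ?thesis .
qed

lemma computable_nat_uminus:
  assumes "computable f" shows "computable (\<lambda>x. nat (- f x))"
proof -
  have "computable (\<lambda>n. if even n then 0 else Suc (n div 2))"
    by (intro computable_intros computable_div2 computable_even)
  moreover have "nat (- int_decode n) = (if even n then 0 else Suc (n div 2))" for n
    by (auto simp: int_decode_def sum_decode_def)
  ultimately have "computable (\<lambda>x. nat (- x))" by (intro computable_decode_int) simp
  from computable_comp[OF this assms] show ?thesis .
qed

text \<open>Integer operations are carried out on positive and negative parts; this step turns the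
  result back into a code, which for \<open>- n\<close> with positive \<open>n\<close> is
  \<open>2 * n - 1\<close>.\<close>

lemma computable_diff_int_nat:
  assumes "computable f" "computable g" shows "computable (\<lambda>x. int (f x) - int (g x))"
proof -
  have "computable (\<lambda>x. if g x \<le> f x then 2 * (f x - g x) else 2 * (g x - f x) - 1)"
    by (intro computable_intros assms)
  moreover have "encode (int a - int b) = (if b \<le> a then 2 * (a - b) else 2 * (b - a) - 1)" for a b
    by (auto simp: encode_int_def int_encode_def sum_encode_def nat_diff_distrib not_le)
  ultimately show ?thesis using computable_encode[of "\<lambda>x. int (f x) - int (g x)"] by simp
qed

lemma computable_int [computable_intros]:
  assumes "computable f" shows "computable (\<lambda>x. int (f x))"
  using computable_diff_int_nat[OF assms computable_const[of 0]] by simp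

lemma computable_uminus_int [computable_intros]:
  assumes "computable f" shows "computable (\<lambda>x. - f x :: int)"
proof -
  have "computable (\<lambda>x. int (nat (- f x)) - int (nat (f x)))"
    by (intro computable_diff_int_nat computable_intros computable_nat_uminus assms)
  moreover have "int (nat (- i)) - int (nat i) = - i" for i by simp
  ultimately show ?thesis by simp
qed

lemma computable_add_int [computable_intros]:
  assumes "computable f" "computable g" shows "computable (\<lambda>x. f x + g x :: int)"
proof -
  have "computable (\<lambda>x. int (nat (f x) + nat (g x)) - int (nat (- f x) + nat (- g x)))"
    by (intro computable_diff_int_nat computable_intros computable_nat_uminus assms)
  moreover have "int (nat i + nat j) - int (nat (- i) + nat (- j)) = i + j" for i j by simp
  ultimately show ?thesis by (simp only:)
qed

lemma computable_mult_int [computable_intros]: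
  assumes "computable f" "computable g" shows "computable (\<lambda>x. f x * g x :: int)"
proof -
  have "computable (\<lambda>x. int (nat (f x) * nat (g x) + nat (- f x) * nat (- g x))
      - int (nat (f x) * nat (- g x) + nat (- f x) * nat (g x)))"
    by (intro computable_diff_int_nat computable_intros computable_nat_uminus assms)
  moreover have "int (nat i * nat j + nat (- i) * nat (- j)) - int (nat i * nat (- j) + nat (- i) * nat j) = i * j" for i j
    by (cases "0 \<le> i"; cases "0 \<le> j") auto
  ultimately show ?thesis by (simp only:)
qed

lemma computable_less_int [computable_intros]:
  assumes "computable f" "computable g" shows "computable (\<lambda>x. (f x :: int) < g x)"
proof -
  have "computable (\<lambda>x. 0 < nat (g x + - f x))"
    by (intro computable_intros assms)
  then show ?thesis by simp
qed

lemma computable_sum_list [computable_intros]: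
  assumes g: "computable (\<lambda>p. g (fst p) (snd p))" and f: "computable f"
  shows "computable (\<lambda>x. \<Sum>y\<leftarrow>f x. (g x y :: int))"
proof -
  have "computable (\<lambda>x. foldl (\<lambda>acc y. acc + g x y) 0 (f x))"
    using computable_comp[OF g, of "\<lambda>p. (fst p, snd (snd p))"]
    by (intro computable_intros f) (simp_all add: computable_intros)
  moreover have "foldl (\<lambda>acc y. acc + h y) z xs = z + (\<Sum>y\<leftarrow>xs. h y)" for h :: "'b \<Rightarrow> int" and xs z
    by (induction xs arbitrary: z) auto
  ultimately show ?thesis by simp
qed

lemma computable_sum [computable_intros]:
  fixes g :: "'a :: encodable \<Rightarrow> nat \<Rightarrow> int"
  assumes g: "computable (\<lambda>p. g (fst p) (snd p))" and f: "computable f"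
  shows "computable (\<lambda>x. \<Sum>k<f x. g x k)"
proof -
  have "computable (\<lambda>x. rec_nat 0 (\<lambda>k v. v + g x k) (f x))"
    using computable_comp[OF g, of "\<lambda>p. (fst p, fst (snd p))"]
    by (intro computable_intros f) (simp_all add: computable_intros)
  moreover have "rec_nat 0 (\<lambda>k v. v + h k) n = (\<Sum>k<n. h k)" for h :: "nat \<Rightarrow> int" and n
    by (induction n) auto
  ultimately show ?thesis by simp
qed

lemma computable_Ball [computable_intros]:
  fixes g :: "'a :: encodable \<Rightarrow> nat \<Rightarrow> bool"
  assumes g: "computable (\<lambda>p. g (fst p) (snd p))" and f: "computable f"
  shows "computable (\<lambda>x. \<forall>k<f x. g x k)"
proof -
  have "computable (\<lambda>x. rec_nat True (\<lambda>k v. v \<and> g x k) (f x))"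
    using computable_comp[OF g, of "\<lambda>p. (fst p, fst (snd p))"]
    by (intro computable_intros f) (simp_all add: computable_intros)
  moreover have "rec_nat True (\<lambda>k v. v \<and> h k) n = (\<forall>k<n. h k)" for h :: "nat \<Rightarrow> bool" and n
    by (induction n) (auto simp: less_Suc_eq)
  ultimately show ?thesis by simp
qed

text \<open>The one use of minimisation. A solution for every argument keeps the function
  total.\<close>

lemma computable_Least:
  fixes P :: "'a :: encodable \<Rightarrow> nat \<Rightarrow> bool"
  assumes P: "computable (\<lambda>p. P (fst p) (snd p))" and ex: "\<And>x. \<exists>n. P x n"
  shows "computable (\<lambda>x. LEAST n. P x n)"
proof -
  obtain M where M: "\<And>x n. run M [encode (x, n :: nat)] = Some (encode (\<not> P x n))"
    using computable_Not[OF P] by (force simp: computable_def)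
  obtain E where E: "\<And>xs. length xs = 2 \<Longrightarrow> run E xs = Some (prod_encode (xs ! 0, xs ! 1))"
    using rec_computable2_prod_encode by (auto simp: rec_computable2_def rec_computable_def)
  \<comment> \<open>\<open>Minim\<close> searches for a zero and puts the search variable first,
    hence the negated predicate and the exchanged arguments.\<close>
  define S where "S = Comp M [Comp E [Proj 1, Proj 0]]"
  have S: "run S [n, encode x] = Some (of_bool (\<not> P x n))" for x n
    using M[of x n] by (simp add: S_def E encode_prod_def encode_nat_def encode_bool_def)
  have "run (Minim S) [encode x] = Some (LEAST n. P x n)" for x
  proof -
    define N where "N = (LEAST n. P x n)"
    have "P x N" using ex[of x] unfolding N_def by (auto intro: LeastI)
    then have zero: "run S (N # [encode x]) = Some 0" by (simp add: S)
    have "run S (k # [encode x]) = Some (Suc 0)" if "k < N" for k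
      using not_less_Least[OF that[unfolded N_def]] by (simp add: S)
    with zero have "\<exists>n. run S (n # [encode x]) = Some 0 \<and> (\<forall>k<n. \<exists>v. run S (k # [encode x]) = Some (Suc v))"
      by blast
    moreover have "(LEAST n. run S (n # [encode x]) = Some 0) = (LEAST n. P x n)" by (simp add: S)
    ultimately show ?thesis by simp
  qed
  then show ?thesis unfolding computable_def encode_nat_def by blast
qed

section \<open>Norms of finite matrices\<close>

text \<open>The entries range over a semiring because the algorithm computes with integers while the
  estimates concern reals; \<open>gram_power_norm_of_int\<close> links the two.\<close>

definition mat_vec :: "'i set \<Rightarrow> ('i \<Rightarrow> 'i \<Rightarrow> 'a :: comm_semiring_1) \<Rightarrow> ('i \<Rightarrow> 'a) \<Rightarrow> 'i \<Rightarrow> 'a" where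
  "mat_vec I K \<xi> = (\<lambda>i. \<Sum>j\<in>I. K i j * \<xi> j)"

definition gram :: "'i set \<Rightarrow> ('i \<Rightarrow> 'i \<Rightarrow> 'a :: comm_semiring_1) \<Rightarrow> 'i \<Rightarrow> 'i \<Rightarrow> 'a" where
  "gram I K = (\<lambda>i j. \<Sum>l\<in>I. K l i * K l j)"

text \<open>The squared Hilbert-Schmidt norm of the \<open>k\<close>-th power of the Gram matrix:
  column \<open>j\<close> is the image of the \<open>j\<close>-th unit vector.\<close>

definition gram_power_norm :: "'i set \<Rightarrow> ('i \<Rightarrow> 'i \<Rightarrow> 'a :: comm_semiring_1) \<Rightarrow> nat \<Rightarrow> 'a" where
  "gram_power_norm I K k = (\<Sum>j\<in>I. \<Sum>i\<in>I. ((mat_vec I (gram I K) ^^ k) (\<lambda>i. of_bool (i = j)) i)\<^sup>2)"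

text \<open>For \<open>0 \<le> c\<close>, operator norm at most \<open>c\<close>, expressed without
  a supremum. A bilinear form is indifferent to transposition, and such forms can be summed over
  translates.\<close>

definition bounded_form :: "'i set \<Rightarrow> ('i \<Rightarrow> 'i \<Rightarrow> real) \<Rightarrow> real \<Rightarrow> bool" where
  "bounded_form I K c \<longleftrightarrow>
    (\<forall>\<eta> \<xi>. (\<Sum>x\<in>I. \<Sum>y\<in>I. \<eta> x * K x y * \<xi> y) \<le> c * L2_set \<eta> I * L2_set \<xi> I)"

lemma L2_set_power2: "(L2_set f I)\<^sup>2 = (\<Sum>i\<in>I. (f i)\<^sup>2)"
  by (simp add: L2_set_def sum_nonneg)

lemma L2_set_inner_le: "(\<Sum>i\<in>I. f i * g i) \<le> L2_set f I * L2_set g I"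
proof -
  have "(\<Sum>i\<in>I. f i * g i) \<le> (\<Sum>i\<in>I. \<bar>f i\<bar> * \<bar>g i\<bar>)"
    by (intro sum_mono) (metis abs_ge_self abs_mult)
  also have "\<dots> \<le> L2_set f I * L2_set g I" by (rule L2_set_mult_ineq)
  finally show ?thesis .
qed

lemma sum_form_mat_vec: "(\<Sum>x\<in>I. \<Sum>y\<in>I. \<eta> x * K x y * \<xi> y) = (\<Sum>x\<in>I. \<eta> x * mat_vec I K \<xi> x)"
  by (simp add: mat_vec_def sum_distrib_left mult.assoc)

text \<open>From left to right, the form is tested at \<open>\<eta> = mat_vec I K \<xi>\<close> and
  one factor is cancelled; the converse is the Cauchy-Schwarz inequality.\<close>

lemma bounded_form_iff:
  assumes "0 \<le> c"
  shows "bounded_form I K c \<longleftrightarrow> (\<forall>\<xi>. L2_set (mat_vec I K \<xi>) I \<le> c * L2_set \<xi> I)"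
proof safe
  fix \<xi> assume "bounded_form I K c"
  then have "(\<Sum>x\<in>I. mat_vec I K \<xi> x * mat_vec I K \<xi> x) \<le> c * L2_set (mat_vec I K \<xi>) I * L2_set \<xi> I"
    unfolding bounded_form_def sum_form_mat_vec by blast
  moreover have "(\<Sum>x\<in>I. mat_vec I K \<xi> x * mat_vec I K \<xi> x) = L2_set (mat_vec I K \<xi>) I * L2_set (mat_vec I K \<xi>) I"
    by (metis (no_types, lifting) L2_set_power2 power2_eq_square sum.cong)
  ultimately have *: "L2_set (mat_vec I K \<xi>) I * L2_set (mat_vec I K \<xi>) I \<le> L2_set (mat_vec I K \<xi>) I * (c * L2_set \<xi> I)"
    by (simp only: ac_simps)
  show "L2_set (mat_vec I K \<xi>) I \<le> c * L2_set \<xi> I"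
  proof (cases "L2_set (mat_vec I K \<xi>) I = 0")
    case False
    then have "0 < L2_set (mat_vec I K \<xi>) I" by (simp add: less_le)
    with * show ?thesis by simp
  qed (use assms in simp)
next
  assume *: "\<forall>\<xi>. L2_set (mat_vec I K \<xi>) I \<le> c * L2_set \<xi> I"
  show "bounded_form I K c" unfolding bounded_form_def sum_form_mat_vec
  proof (intro allI)
    fix \<eta> \<xi> :: "'a \<Rightarrow> real"
    have "(\<Sum>x\<in>I. \<eta> x * mat_vec I K \<xi> x) \<le> L2_set \<eta> I * L2_set (mat_vec I K \<xi>) I"
      by (rule L2_set_inner_le)
    also have "\<dots> \<le> L2_set \<eta> I * (c * L2_set \<xi> I)"
      by (intro mult_left_mono) (use * in auto)
    finally show "(\<Sum>x\<in>I. \<eta> x * mat_vec I K \<xi> x) \<le> c * L2_set \<eta> I * L2_set \<xi> I"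
      by (simp add: mult_ac)
  qed
qed

lemma bounded_form_transpose:
  assumes "bounded_form I K c" shows "bounded_form I (\<lambda>x y. K y x) c"
  unfolding bounded_form_def
proof (intro allI)
  fix \<eta> \<xi> :: "'a \<Rightarrow> real"
  have "(\<Sum>x\<in>I. \<Sum>y\<in>I. \<eta> x * K y x * \<xi> y) = (\<Sum>y\<in>I. \<Sum>x\<in>I. \<eta> x * K y x * \<xi> y)"
    by (rule sum.swap)
  also have "\<dots> = (\<Sum>y\<in>I. \<Sum>x\<in>I. \<xi> y * K y x * \<eta> x)" by (simp only: ac_simps)
  also have "\<dots> \<le> c * L2_set \<xi> I * L2_set \<eta> I" using assms by (simp add: bounded_form_def)
  finally show "(\<Sum>x\<in>I. \<Sum>y\<in>I. \<eta> x * K y x * \<xi> y) \<le> c * L2_set \<eta> I * L2_set \<xi> I"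
    by (simp only: ac_simps)
qed

lemma mat_vec_gram: "mat_vec I (gram I K) \<xi> = mat_vec I (\<lambda>x y. K y x) (mat_vec I K \<xi>)"
proof
  fix i
  have "mat_vec I (gram I K) \<xi> i = (\<Sum>j\<in>I. \<Sum>l\<in>I. K l i * K l j * \<xi> j)"
    by (simp add: mat_vec_def gram_def sum_distrib_right)
  also have "\<dots> = (\<Sum>l\<in>I. \<Sum>j\<in>I. K l i * K l j * \<xi> j)" by (rule sum.swap)
  also have "\<dots> = mat_vec I (\<lambda>x y. K y x) (mat_vec I K \<xi>) i"
    by (simp add: mat_vec_def sum_distrib_left mult.assoc)
  finally show "mat_vec I (gram I K) \<xi> i = mat_vec I (\<lambda>x y. K y x) (mat_vec I K \<xi>) i" .
qed

section \<open>Powers of the Gram matrix\<close>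

lemma gram_power_norm_eq:
  "gram_power_norm I K k = (\<Sum>j\<in>I. (L2_set ((mat_vec I (gram I K) ^^ k) (\<lambda>i. of_bool (i = j))) I)\<^sup>2)"
  by (simp add: gram_power_norm_def L2_set_power2)

text \<open>The Gram matrix is \<open>K\<close> followed by its transpose, and each of the two
  contributes a factor \<open>c\<close>.\<close>

lemma L2_set_gram_power_le:
  assumes "bounded_form I K c" "0 \<le> c"
  shows "L2_set ((mat_vec I (gram I K) ^^ k) \<xi>) I \<le> c ^ (2 * k) * L2_set \<xi> I"
proof (induction k)
  case (Suc k)
  let ?\<zeta> = "(mat_vec I (gram I K) ^^ k) \<xi>"
  have "L2_set (mat_vec I (gram I K) ?\<zeta>) I \<le> c * L2_set (mat_vec I K ?\<zeta>) I"
    unfolding mat_vec_gram using assms bounded_form_transpose[of I K c] bounded_form_iff[of c I "\<lambda>x y. K y x"]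
    by blast
  also have "\<dots> \<le> c * (c * L2_set ?\<zeta> I)"
    using assms bounded_form_iff[of c I K] by (intro mult_left_mono) blast+
  also have "\<dots> \<le> c * (c * (c ^ (2 * k) * L2_set \<xi> I))"
    by (intro mult_left_mono Suc assms)
  finally show ?case by (simp add: mult_ac)
qed simp

lemma L2_set_unit: "finite I \<Longrightarrow> j \<in> I \<Longrightarrow> L2_set (\<lambda>i. of_bool (i = j)) I = 1"
  by (simp add: L2_set_def of_bool_def if_distrib[of "\<lambda>x. x ^ 2"] cong: if_cong)

text \<open>Each of the \<open>card I\<close> columns has norm at most \<open>c ^ (2 * k)\<close>,
  being the image of a unit vector.\<close>

lemma gram_power_norm_le:
  assumes "bounded_form I K c" "0 \<le> c" "finite I"
  shows "gram_power_norm I K k \<le> real (card I) * c ^ (4 * k)"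
proof -
  have "gram_power_norm I K k \<le> (\<Sum>j\<in>I. (c ^ (2 * k) * 1)\<^sup>2)"
    unfolding gram_power_norm_eq
  proof (intro sum_mono power_mono)
    fix j assume "j \<in> I"
    then show "L2_set ((mat_vec I (gram I K) ^^ k) (\<lambda>i. of_bool (i = j))) I \<le> c ^ (2 * k) * 1"
      using L2_set_gram_power_le[OF assms(1,2), of k "\<lambda>i. of_bool (i = j)"] L2_set_unit[OF assms(3)] by simp
  qed auto
  then show ?thesis by (simp add: power_mult[symmetric])
qed

lemma mat_vec_gram_power:
  assumes "finite I" "i \<in> I"
  shows "(mat_vec I (gram I K) ^^ k) \<xi> i = (\<Sum>j\<in>I. \<xi> j * (mat_vec I (gram I K) ^^ k) (\<lambda>i. of_bool (i = j)) i)"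
  using assms(2)
proof (induction k arbitrary: i)
  case 0
  then show ?case using assms by (simp add: of_bool_def if_distrib cong: if_cong)
next
  case (Suc k)
  have "mat_vec I (gram I K) ((mat_vec I (gram I K) ^^ k) \<xi>) i =
      (\<Sum>m\<in>I. gram I K i m * (\<Sum>j\<in>I. \<xi> j * (mat_vec I (gram I K) ^^ k) (\<lambda>i. of_bool (i = j)) m))"
    unfolding mat_vec_def[of I "gram I K" "(mat_vec I (gram I K) ^^ k) \<xi>"] by (intro sum.cong refl) (simp add: Suc)
  also have "\<dots> = (\<Sum>j\<in>I. \<xi> j * mat_vec I (gram I K) ((mat_vec I (gram I K) ^^ k) (\<lambda>i. of_bool (i = j))) i)"
    unfolding mat_vec_def[of I "gram I K" "(mat_vec I (gram I K) ^^ k) (\<lambda>i. of_bool (i = _))"]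
    unfolding sum_distrib_left by (subst sum.swap) (simp add: mult_ac)
  finally show ?case by simp
qed

text \<open>The Hilbert-Schmidt norm dominates the operator norm, by Cauchy-Schwarz in every
  row.\<close>

lemma L2_set_gram_power_le_gram_power_norm:
  assumes "finite I"
  shows "(L2_set ((mat_vec I (gram I K) ^^ k) \<xi>) I)\<^sup>2 \<le> gram_power_norm I K k * (L2_set \<xi> I)\<^sup>2"
proof -
  let ?y = "\<lambda>j. (mat_vec I (gram I K) ^^ k) (\<lambda>i. of_bool (i = j))"
  have "(L2_set ((mat_vec I (gram I K) ^^ k) \<xi>) I)\<^sup>2 = (\<Sum>i\<in>I. (\<Sum>j\<in>I. \<xi> j * ?y j i)\<^sup>2)"
    unfolding L2_set_power2 by (intro sum.cong refl) (simp add: mat_vec_gram_power[OF assms, of _ k K \<xi>])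
  also have "\<dots> \<le> (\<Sum>i\<in>I. (\<Sum>j\<in>I. (\<xi> j)\<^sup>2) * (\<Sum>j\<in>I. (?y j i)\<^sup>2))"
  proof (rule sum_mono)
    fix i
    have "\<bar>\<Sum>j\<in>I. \<xi> j * ?y j i\<bar> \<le> L2_set \<xi> I * L2_set (\<lambda>j. ?y j i) I"
      by (rule order_trans[OF sum_abs]) (simp add: abs_mult L2_set_mult_ineq)
    then have "(\<Sum>j\<in>I. \<xi> j * ?y j i)\<^sup>2 \<le> (L2_set \<xi> I * L2_set (\<lambda>j. ?y j i) I)\<^sup>2"
      using power_mono[of "\<bar>\<Sum>j\<in>I. \<xi> j * ?y j i\<bar>" _ 2] by simp
    then show "(\<Sum>j\<in>I. \<xi> j * ?y j i)\<^sup>2 \<le> (\<Sum>j\<in>I. (\<xi> j)\<^sup>2) * (\<Sum>j\<in>I. (?y j i)\<^sup>2)"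
      by (simp add: power_mult_distrib L2_set_power2)
  qed
  also have "\<dots> = (L2_set \<xi> I)\<^sup>2 * (\<Sum>i\<in>I. \<Sum>j\<in>I. (?y j i)\<^sup>2)"
    by (simp add: L2_set_power2 sum_distrib_left)
  also have "(\<Sum>i\<in>I. \<Sum>j\<in>I. (?y j i)\<^sup>2) = gram_power_norm I K k"
    unfolding gram_power_norm_def by (rule sum.swap)
  finally show ?thesis by (simp add: mult_ac)
qed

text \<open>Log-convexity makes the ratios of consecutive terms increase, so
  \<open>m (Suc k) / m 0\<close> is at least the \<open>Suc k\<close>-th power of the first ratio
  \<open>m 1 / m 0\<close>.\<close>

lemma log_convex_sequence:
  fixes m :: "nat \<Rightarrow> real"
  assumes nonneg: "\<And>k. 0 \<le> m k" and convex: "\<And>k. (m (Suc k))\<^sup>2 \<le> m k * m (Suc (Suc k))"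
  shows "m 1 ^ Suc k \<le> m (Suc k) * m 0 ^ k"
proof -
  \<comment> \<open>Ratios are compared in cross-multiplied form because terms may vanish.\<close>
  have ratio: "m 1 * m k \<le> m (Suc k) * m 0" for k
  proof (induction k)
    case (Suc k)
    show ?case
    proof (cases "m (Suc k) = 0")
      case False
      then have pos: "0 < m (Suc k)" using nonneg[of "Suc k"] by simp
      have "m (Suc k) * (m 1 * m (Suc k)) = m 1 * (m (Suc k))\<^sup>2" by (simp add: power2_eq_square)
      also have "\<dots> \<le> (m 1 * m k) * m (Suc (Suc k))"
        using mult_left_mono[OF convex nonneg, of 1 k] by (simp add: mult_ac)
      also have "\<dots> \<le> (m (Suc k) * m 0) * m (Suc (Suc k))"
        by (rule mult_right_mono[OF Suc nonneg])
      finally have "m (Suc k) * (m 1 * m (Suc k)) \<le> m (Suc k) * (m (Suc (Suc k)) * m 0)"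
        by (simp add: mult_ac)
      then show ?thesis using pos by simp
    qed (simp add: nonneg)
  qed simp
  show ?thesis
  proof (induction k)
    case (Suc k)
    have "m 1 ^ Suc (Suc k) \<le> m 1 * (m (Suc k) * m 0 ^ k)"
      using mult_left_mono[OF Suc nonneg, of 1] by simp
    also have "\<dots> \<le> (m (Suc (Suc k)) * m 0) * m 0 ^ k"
      using mult_right_mono[OF ratio[of "Suc k"], of "m 0 ^ k"] nonneg by (simp add: mult_ac)
    finally show ?case by (simp add: mult_ac)
  qed simp
qed

lemma inner_mat_vec:
  fixes \<xi> \<eta> :: "'i \<Rightarrow> real"
  shows "(\<Sum>i\<in>I. mat_vec I K \<xi> i * \<eta> i) = (\<Sum>i\<in>I. \<xi> i * mat_vec I (\<lambda>x y. K y x) \<eta> i)"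
proof -
  have "(\<Sum>i\<in>I. mat_vec I K \<xi> i * \<eta> i) = (\<Sum>i\<in>I. \<Sum>j\<in>I. K i j * \<xi> j * \<eta> i)"
    by (simp add: mat_vec_def sum_distrib_right)
  also have "\<dots> = (\<Sum>j\<in>I. \<Sum>i\<in>I. K i j * \<xi> j * \<eta> i)" by (rule sum.swap)
  also have "\<dots> = (\<Sum>j\<in>I. \<xi> j * mat_vec I (\<lambda>x y. K y x) \<eta> j)"
    by (simp add: mat_vec_def sum_distrib_left mult_ac)
  finally show ?thesis .
qed

lemma inner_mat_vec_gram:
  fixes \<xi> \<eta> :: "'i \<Rightarrow> real"
  shows "(\<Sum>i\<in>I. mat_vec I (gram I K) \<xi> i * \<eta> i) = (\<Sum>i\<in>I. \<xi> i * mat_vec I (gram I K) \<eta> i)"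
proof -
  have "(\<lambda>x y. gram I K y x) = gram I K" by (simp add: gram_def mult.commute)
  then show ?thesis using inner_mat_vec[of I "gram I K"] by simp
qed

text \<open>The norms of the iterates of the Gram matrix at \<open>\<xi>\<close> are log-convex, so
  a bound on a high iterate descends to the first one, which controls \<open>K\<close> since |K
  \<xi>|^2 is the inner product of \<xi> with K^T K \<xi>. The exponent is positive because the
  zeroth power carries no information about \<open>K\<close>.\<close>

lemma bounded_form_if_gram_power_norm_le:
  assumes S: "gram_power_norm I K (Suc k) \<le> c ^ (4 * Suc k)" and "0 \<le> c" "finite I"
  shows "bounded_form I K c"
  unfolding bounded_form_iff[OF \<open>0 \<le> c\<close>]
proof
  fix \<xi> :: "'a \<Rightarrow> real"
  define z where "z k = (mat_vec I (gram I K) ^^ k) \<xi>" for k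
  define m where "m k = L2_set (z k) I" for k
  have z_Suc: "z (Suc k) = mat_vec I (gram I K) (z k)" for k by (simp add: z_def)
  have m0: "0 \<le> m k" for k by (simp add: m_def)
  \<comment> \<open>Symmetry of the Gram matrix moves one factor across the inner product;
    Cauchy-Schwarz then gives log-convexity.\<close>
  have "(m (Suc k))\<^sup>2 = (\<Sum>i\<in>I. z k i * z (Suc (Suc k)) i)" for k
    unfolding z_Suc[of "Suc k"] inner_mat_vec_gram[symmetric]
    by (simp add: z_Suc m_def L2_set_power2 power2_eq_square[of "mat_vec _ _ _ _"])
  then have "m 1 ^ Suc k \<le> m (Suc k) * m 0 ^ k"
    by (intro log_convex_sequence m0) (simp add: m_def L2_set_inner_le)
  moreover have "m (Suc k) \<le> c ^ (2 * Suc k) * m 0"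
  proof (rule power2_le_imp_le)
    have "(m (Suc k))\<^sup>2 \<le> gram_power_norm I K (Suc k) * (m 0)\<^sup>2"
      unfolding m_def z_def using L2_set_gram_power_le_gram_power_norm[OF assms(3), of "Suc k" K \<xi>] by simp
    also have "\<dots> \<le> c ^ (4 * Suc k) * (m 0)\<^sup>2" by (intro mult_right_mono S) simp
    also have "c ^ (4 * Suc k) = c ^ (2 * Suc k * 2)" by (intro arg_cong2[where f=power]) simp_all
    finally show "(m (Suc k))\<^sup>2 \<le> (c ^ (2 * Suc k) * m 0)\<^sup>2"
      unfolding power_mult_distrib power_mult[of c "2 * Suc k" 2] .
  qed (simp add: m0 assms)
  then have "m (Suc k) * m 0 ^ k \<le> (c ^ (2 * Suc k) * m 0) * m 0 ^ k"
    by (intro mult_right_mono) (simp_all add: m0)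
  ultimately have "m 1 ^ Suc k \<le> (c ^ (2 * Suc k) * m 0) * m 0 ^ k" by (rule order_trans)
  also have "\<dots> = (c\<^sup>2 * m 0) ^ Suc k"
    unfolding power_mult_distrib power_mult[of c 2 "Suc k"] power_Suc[of "m 0"] by (rule mult.assoc)
  finally have m1: "m 1 \<le> c\<^sup>2 * m 0"
    by (rule power_le_imp_le_base) (simp add: m0)
  have "(L2_set (mat_vec I K \<xi>) I)\<^sup>2 = (\<Sum>i\<in>I. \<xi> i * mat_vec I (gram I K) \<xi> i)"
    using inner_mat_vec[of I K \<xi> "mat_vec I K \<xi>"] unfolding L2_set_power2 mat_vec_gram unfolding power2_eq_square .
  also have "\<dots> \<le> m 0 * m 1" unfolding m_def z_def by (simp add: L2_set_inner_le)
  also have "\<dots> \<le> m 0 * (c\<^sup>2 * m 0)" by (rule mult_left_mono[OF m1 m0])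
  also have "\<dots> = (c * m 0)\<^sup>2" by (simp add: power2_eq_square)
  finally have "L2_set (mat_vec I K \<xi>) I \<le> c * m 0"
    by (rule power2_le_imp_le) (simp add: m0 assms(2))
  moreover have "m 0 = L2_set \<xi> I" by (simp add: m_def z_def)
  ultimately show "L2_set (mat_vec I K \<xi>) I \<le> c * L2_set \<xi> I" by simp
qed

lemma mat_vec_of_int: "mat_vec I (\<lambda>i j. of_int (K i j)) (\<lambda>i. of_int (\<xi> i)) = (\<lambda>i. of_int (mat_vec I K \<xi> i) :: real)"
  by (simp add: mat_vec_def)

lemma gram_power_norm_of_int:
  "gram_power_norm I (\<lambda>i j. of_int (K i j)) k = (of_int (gram_power_norm I K k) :: real)"
proof -
  have gram: "gram I (\<lambda>i j. of_int (K i j)) = (\<lambda>i j. of_int (gram I K i j) :: real)"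
    by (simp add: gram_def)
  have "(mat_vec I (gram I (\<lambda>i j. of_int (K i j))) ^^ k) (\<lambda>i. of_int (\<xi> i)) =
      (\<lambda>i. of_int ((mat_vec I (gram I K) ^^ k) \<xi> i) :: real)" for \<xi>
    by (induction k) (simp_all add: gram mat_vec_of_int)
  from this[of "\<lambda>i. of_bool (i = _)"] show ?thesis
    by (simp add: gram_power_norm_def)
qed

section \<open>Sums, multiples and reindexing of bounded forms\<close>

lemma bounded_form_add:
  assumes "bounded_form I K c" "bounded_form I L d"
  shows "bounded_form I (\<lambda>x y. K x y + L x y) (c + d)"
  unfolding bounded_form_def
proof (intro allI)
  fix \<eta> \<xi> :: "'a \<Rightarrow> real"
  have "(\<Sum>x\<in>I. \<Sum>y\<in>I. \<eta> x * (K x y + L x y) * \<xi> y) =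
      (\<Sum>x\<in>I. \<Sum>y\<in>I. \<eta> x * K x y * \<xi> y) + (\<Sum>x\<in>I. \<Sum>y\<in>I. \<eta> x * L x y * \<xi> y)"
    by (simp add: distrib_left distrib_right sum.distrib)
  also have "\<dots> \<le> c * L2_set \<eta> I * L2_set \<xi> I + d * L2_set \<eta> I * L2_set \<xi> I"
    using assms unfolding bounded_form_def by (intro add_mono) blast+
  finally show "(\<Sum>x\<in>I. \<Sum>y\<in>I. \<eta> x * (K x y + L x y) * \<xi> y) \<le> (c + d) * L2_set \<eta> I * L2_set \<xi> I"
    by (simp add: distrib_right)
qed

lemma L2_set_scale: "L2_set (\<lambda>x. a * f x) I = \<bar>a\<bar> * L2_set f I"
  by (simp add: L2_set_def power_mult_distrib sum_distrib_left[symmetric] real_sqrt_mult)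

lemma mat_vec_scale: "mat_vec I K (\<lambda>x. a * \<xi> x) = (\<lambda>i. a * mat_vec I K \<xi> i)"
  by (simp add: fun_eq_iff mat_vec_def sum_distrib_left mult_ac)

lemma bounded_form_scale:
  assumes "bounded_form I K c" "0 \<le> c"
  shows "bounded_form I (\<lambda>x y. a * K x y) (\<bar>a\<bar> * c)"
proof -
  have "mat_vec I (\<lambda>x y. a * K x y) \<xi> = (\<lambda>x. a * mat_vec I K \<xi> x)" for \<xi>
    by (simp add: mat_vec_def sum_distrib_left mult_ac)
  moreover have "\<bar>a\<bar> * L2_set (mat_vec I K \<xi>) I \<le> \<bar>a\<bar> * c * L2_set \<xi> I" for \<xi>
    using assms bounded_form_iff[OF assms(2), of I K] mult_left_mono[of "L2_set (mat_vec I K \<xi>) I" "c * L2_set \<xi> I" "\<bar>a\<bar>"]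
    by (simp add: mult.assoc)
  ultimately show ?thesis
    using assms(2) bounded_form_iff[of "\<bar>a\<bar> * c" I "\<lambda>x y. a * K x y"] by (simp add: L2_set_scale)
qed

lemma L2_set_reindex: "inj_on f J \<Longrightarrow> L2_set g (f ` J) = L2_set (\<lambda>i. g (f i)) J"
  by (simp add: L2_set_def sum.reindex)

text \<open>The estimates index matrices by group elements, the algorithm by positions in a
  list.\<close>

lemma bounded_form_reindex:
  fixes f :: "'b \<Rightarrow> 'a"
  assumes "inj_on f J"
  shows "bounded_form (f ` J) K c \<longleftrightarrow> bounded_form J (\<lambda>i j. K (f i) (f j)) c"
proof
  assume *: "bounded_form (f ` J) K c"
  show "bounded_form J (\<lambda>i j. K (f i) (f j)) c"
    unfolding bounded_form_def
  proof (intro allI)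
    fix \<eta> \<xi> :: "'b \<Rightarrow> real"
    let ?e = "\<lambda>x. \<eta> (inv_into J f x)" and ?x = "\<lambda>x. \<xi> (inv_into J f x)"
    have "(\<Sum>x\<in>f ` J. \<Sum>y\<in>f ` J. ?e x * K x y * ?x y) \<le> c * L2_set ?e (f ` J) * L2_set ?x (f ` J)"
      using * by (auto simp: bounded_form_def)
    also have "(\<Sum>x\<in>f ` J. \<Sum>y\<in>f ` J. ?e x * K x y * ?x y) = (\<Sum>x\<in>J. \<Sum>y\<in>J. \<eta> x * K (f x) (f y) * \<xi> y)"
      using assms by (simp add: sum.reindex cong: sum.cong)
    also have "L2_set ?e (f ` J) = L2_set \<eta> J" unfolding L2_set_reindex[OF assms]
      using assms by (intro L2_set_cong refl) simp
    also have "L2_set ?x (f ` J) = L2_set \<xi> J" unfolding L2_set_reindex[OF assms]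
      using assms by (intro L2_set_cong refl) simp
    finally show "(\<Sum>x\<in>J. \<Sum>y\<in>J. \<eta> x * K (f x) (f y) * \<xi> y) \<le> c * L2_set \<eta> J * L2_set \<xi> J" .
  qed
next
  assume *: "bounded_form J (\<lambda>i j. K (f i) (f j)) c"
  show "bounded_form (f ` J) K c"
    unfolding bounded_form_def
  proof (intro allI)
    fix \<eta> \<xi> :: "'a \<Rightarrow> real"
    have "(\<Sum>x\<in>f ` J. \<Sum>y\<in>f ` J. \<eta> x * K x y * \<xi> y) = (\<Sum>x\<in>J. \<Sum>y\<in>J. \<eta> (f x) * K (f x) (f y) * \<xi> (f y))"
      using assms by (simp add: sum.reindex)
    also have "\<dots> \<le> c * L2_set (\<lambda>x. \<eta> (f x)) J * L2_set (\<lambda>x. \<xi> (f x)) J"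
      using *[unfolded bounded_form_def, rule_format, of "\<lambda>x. \<eta> (f x)" "\<lambda>x. \<xi> (f x)"] .
    finally show "(\<Sum>x\<in>f ` J. \<Sum>y\<in>f ` J. \<eta> x * K x y * \<xi> y) \<le> c * L2_set \<eta> (f ` J) * L2_set \<xi> (f ` J)"
      by (simp add: L2_set_reindex[OF assms])
  qed
qed

section \<open>The marriage theorem and Folner sets\<close>

text \<open>Rado's proof of the marriage theorem. The relation \<open>D\<close> collects the pairs removed from the
  family \<open>S\<close>; if \<open>D\<close> is maximal subject to Hall's condition, submodularity of the cardinality of a
  union leaves a single candidate for every index.\<close>

lemma hall_marriage:
  fixes S :: "'i \<Rightarrow> 'b set"
  assumes fin: "\<And>i. i \<in> I \<Longrightarrow> finite (S i)"
    and hall: "\<And>J. J \<subseteq> I \<Longrightarrow> finite J \<Longrightarrow> card J \<le> card (\<Union>i\<in>J. S i)"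
  obtains f where "inj_on f I" "\<And>i. i \<in> I \<Longrightarrow> f i \<in> S i"
proof -
  define \<D> where "\<D> = {D :: ('i \<times> 'b) set. \<forall>J\<subseteq>I. finite J \<longrightarrow> card J \<le> card (\<Union>i\<in>J. S i - D `` {i})}"
  have chain: "\<Union>\<C> \<in> \<D>" if \<C>: "subset.chain \<D> \<C>" for \<C>
    unfolding \<D>_def
  proof safe
    fix J assume J: "J \<subseteq> I" "finite J"
    show "card J \<le> card (\<Union>i\<in>J. S i - \<Union>\<C> `` {i})"
    proof (cases "\<C> = {}")
      case True
      then show ?thesis using hall[OF J] by simp
    next
      case False
      \<comment> \<open>Over a finite \<open>J\<close> only finitely many removed pairs matter, and
        a single member of the chain already contains them.\<close>
      have "finite (Sigma J S)" using J fin by (auto intro: finite_SigmaI)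
      then have "finite (Sigma J S \<inter> \<Union>\<C>)" by simp
      from finite_subset_Union_chain[OF this inf_le2 False \<C>]
      obtain D where D: "D \<in> \<C>" "Sigma J S \<inter> \<Union>\<C> \<subseteq> D" by blast
      have "(\<Union>i\<in>J. S i - \<Union>\<C> `` {i}) = (\<Union>i\<in>J. S i - D `` {i})"
        using D by auto
      moreover have "D \<in> \<D>" using \<C> D(1) by (auto simp: subset.chain_def)
      ultimately show ?thesis using J by (simp add: \<D>_def)
    qed
  qed
  have "\<exists>M\<in>\<D>. \<forall>X\<in>\<D>. M \<subseteq> X \<longrightarrow> X = M" by (rule subset_Zorn') (rule chain)
  then obtain D where D: "D \<in> \<D>" and max: "\<And>X. X \<in> \<D> \<Longrightarrow> D \<subseteq> X \<Longrightarrow> X = D"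
    by blast
  define T where "T i = S i - D `` {i}" for i
  have T: "card J \<le> card (\<Union>i\<in>J. T i)" if "J \<subseteq> I" "finite J" for J
    using D that by (simp add: \<D>_def T_def)
  have fT: "finite (T i)" if "i \<in> I" for i using fin[OF that] by (simp add: T_def)
  \<comment> \<open>By maximality of \<open>D\<close>, removing one more candidate \<open>y\<close>
    of \<open>i\<close> violates Hall's condition, necessarily at a set containing \<open>i\<close>;
    the witness is that set without \<open>i\<close>.\<close>
  have critical: "\<exists>J. J \<subseteq> I - {i} \<and> finite J \<and> card ((\<Union>j\<in>J. T j) \<union> (T i - {y})) \<le> card J"
    if "i \<in> I" "y \<in> T i" for i y
  proof -
    have "(i, y) \<notin> D" using that by (auto simp: T_def)
    then have "insert (i, y) D \<notin> \<D>" using max[of "insert (i, y) D"] by auto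
    then obtain J where J: "J \<subseteq> I" "finite J" "\<not> card J \<le> card (\<Union>j\<in>J. S j - insert (i, y) D `` {j})"
      by (auto simp: \<D>_def)
    have other: "S j - insert (i, y) D `` {j} = T j" if "j \<noteq> i" for j
      using that by (auto simp: T_def)
    have same: "S i - insert (i, y) D `` {i} = T i - {y}" by (auto simp: T_def)
    have "i \<in> J"
    proof (rule ccontr)
      assume "i \<notin> J"
      then have "(\<Union>j\<in>J. S j - insert (i, y) D `` {j}) = (\<Union>j\<in>J. T j)"
        by (intro SUP_cong refl other) auto
      then show False using T J by auto
    qed
    then have "J = insert i (J - {i})" by auto
    then have "(\<Union>j\<in>J. S j - insert (i, y) D `` {j}) =
        (S i - insert (i, y) D `` {i}) \<union> (\<Union>j\<in>J - {i}. S j - insert (i, y) D `` {j})"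
      by (metis (no_types, lifting) UN_insert)
    also have "(\<Union>j\<in>J - {i}. S j - insert (i, y) D `` {j}) = (\<Union>j\<in>J - {i}. T j)"
      by (intro SUP_cong refl other) auto
    finally have "(\<Union>j\<in>J. S j - insert (i, y) D `` {j}) = (\<Union>j\<in>J - {i}. T j) \<union> (T i - {y})"
      unfolding same by (simp add: Un_commute)
    moreover have "card J = Suc (card (J - {i}))" using \<open>i \<in> J\<close> J by (simp add: card_Suc_Diff1)
    ultimately show ?thesis using J by (intro exI[of _ "J - {i}"]) auto
  qed
  \<comment> \<open>Two candidates would give critical sets \<open>J\<close> and \<open>L\<close>.
    Hall's condition for \<open>insert i (J \<union> L)\<close> and for \<open>J \<inter> L\<close>
    bounds \<open>card ?A + card ?B\<close> below by \<open>card J + card L + 1\<close>, while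
    criticality bounds it above by \<open>card J + card L\<close>.\<close>
  have unique: "y = z" if i: "i \<in> I" and y: "y \<in> T i" and z: "z \<in> T i" for i y z
  proof (rule ccontr)
    assume "y \<noteq> z"
    obtain J where J: "J \<subseteq> I - {i}" "finite J" "card ((\<Union>j\<in>J. T j) \<union> (T i - {y})) \<le> card J"
      using critical[OF i y] by blast
    obtain L where L: "L \<subseteq> I - {i}" "finite L" "card ((\<Union>j\<in>L. T j) \<union> (T i - {z})) \<le> card L"
      using critical[OF i z] by blast
    let ?A = "(\<Union>j\<in>J. T j) \<union> (T i - {y})" and ?B = "(\<Union>j\<in>L. T j) \<union> (T i - {z})"
    have fA: "finite ?A" using J fT i by auto
    have fB: "finite ?B" using L fT i by auto
    have "?A \<union> ?B = (\<Union>j\<in>insert i (J \<union> L). T j)" using \<open>y \<noteq> z\<close> by auto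
    moreover have "insert i (J \<union> L) \<subseteq> I" using J L i by auto
    ultimately have "card (insert i (J \<union> L)) \<le> card (?A \<union> ?B)" using T[of "insert i (J \<union> L)"] J L by simp
    moreover have "card (insert i (J \<union> L)) = Suc (card (J \<union> L))"
      using J L by (intro card_insert_disjoint) auto
    moreover have "card (J \<inter> L) \<le> card (\<Union>j\<in>J \<inter> L. T j)" using T[of "J \<inter> L"] J by auto
    moreover have "card (\<Union>j\<in>J \<inter> L. T j) \<le> card (?A \<inter> ?B)"
      by (rule card_mono) (use fA in auto)
    moreover have "card ?A + card ?B = card (?A \<union> ?B) + card (?A \<inter> ?B)" by (rule card_Un_Int[OF fA fB])
    moreover have "card J + card L = card (J \<union> L) + card (J \<inter> L)" by (rule card_Un_Int[OF J(2) L(2)])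
    ultimately show False using J(3) L(3) by linarith
  qed
  have nonempty: "T i \<noteq> {}" if "i \<in> I" for i using T[of "{i}"] that by auto
  define f where "f i = (SOME y. y \<in> T i)" for i
  have f: "f i \<in> T i" if "i \<in> I" for i unfolding f_def using nonempty[OF that] by (simp add: some_in_eq)
  have "inj_on f I"
  proof (rule inj_onI, rule ccontr)
    fix i j assume ij: "i \<in> I" "j \<in> I" "f i = f j" "i \<noteq> j"
    then have "T i = {f i}" "T j = {f i}"
      using unique[OF ij(1) _ f[OF ij(1)]] f[OF ij(1)] unique[OF ij(2) _ f[OF ij(2)]] f[OF ij(2)]
      unfolding ij(3)[symmetric] by blast+
    then have "T i \<union> T j = {f i}" by simp
    moreover have "card {i, j} \<le> card (T i \<union> T j)" using T[of "{i, j}"] ij by simp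
    ultimately show False using ij by simp
  qed
  moreover have "f i \<in> S i" if "i \<in> I" for i using f[OF that] by (simp add: T_def)
  ultimately show thesis using that by blast
qed

section \<open>Folner sets from an invariant mean\<close>

lemma finite_additive_Union:
  fixes \<mu> :: "'g set \<Rightarrow> real"
  assumes add: "\<And>S T. S \<subseteq> X \<Longrightarrow> T \<subseteq> X \<Longrightarrow> S \<inter> T = {} \<Longrightarrow> \<mu> (S \<union> T) = \<mu> S + \<mu> T"
    and "finite K" "\<And>k. k \<in> K \<Longrightarrow> B k \<subseteq> X" "disjoint_family_on B K"
  shows "\<mu> (\<Union>k\<in>K. B k) = (\<Sum>k\<in>K. \<mu> (B k))"
  using assms(2-4)
proof (induction K)
  case empty
  \<comment> \<open>Additivity for two empty sets forces \<open>\<mu> {} = 0\<close>.\<close>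
  show ?case using add[of "{}" "{}"] by simp
next
  case (insert k K)
  then have "B k \<inter> (\<Union>k\<in>K. B k) = {}" by (auto simp: disjoint_family_on_def)
  moreover have "\<mu> (\<Union>k\<in>K. B k) = (\<Sum>k\<in>K. \<mu> (B k))"
    using insert by (auto simp: disjoint_family_on_def)
  ultimately show ?case using insert add[of "B k" "\<Union>k\<in>K. B k"] by auto
qed

context group
begin

text \<open>If \<open>K <#> F\<close> always had at least twice as many elements as \<open>F\<close>, the marriage theorem would
  embed two disjoint copies of \<open>G\<close> into \<open>G\<close> by piecewise translations, contradicting
  invariance of the mean.\<close>

lemma amenable_not_doubling:
  assumes "amenable G" and K: "finite K" "K \<subseteq> carrier G"
  shows "\<exists>F. finite F \<and> F \<noteq> {} \<and> F \<subseteq> carrier G \<and> card (K <#> F) < 2 * card F"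
proof (rule ccontr)
  assume "\<not> ?thesis"
  then have doubling: "2 * card F \<le> card (K <#> F)" if "finite F" "F \<noteq> {}" "F \<subseteq> carrier G" for F
    using that not_less by blast
  obtain \<mu> :: "'a set \<Rightarrow> real" where \<mu>: "\<forall>S. S \<subseteq> carrier G \<longrightarrow> 0 \<le> \<mu> S" "\<mu> (carrier G) = 1"
    "\<forall>S T. S \<subseteq> carrier G \<longrightarrow> T \<subseteq> carrier G \<longrightarrow> S \<inter> T = {} \<longrightarrow> \<mu> (S \<union> T) = \<mu> S + \<mu> T"
    "\<forall>g \<in> carrier G. \<forall>S. S \<subseteq> carrier G \<longrightarrow> \<mu> (g <#\<^bsub>G\<^esub> S) = \<mu> S"
    using assms(1) unfolding amenable_def by (elim exE conjE) (rule that)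
  note pos = \<mu>(1)[rule_format] and one = \<mu>(2) and add = \<mu>(3)[rule_format] and inv = \<mu>(4)[rule_format]
  \<comment> \<open>The boolean tag produces two copies of the group; either copy of
    \<open>x\<close> may be sent to any \<open>k \<otimes> x\<close>.\<close>
  let ?S = "\<lambda>(x, b :: bool). (\<lambda>k. k \<otimes> x) ` K"
  have hall: "card J \<le> card (\<Union>i\<in>J. ?S i)" if J: "J \<subseteq> carrier G \<times> UNIV" "finite J" for J
  proof (cases "J = {}")
    case False
    have "card J \<le> card (fst ` J \<times> (UNIV :: bool set))"
      using J by (intro card_mono) (force simp: finite_cartesian_product)+
    also have "\<dots> = 2 * card (fst ` J)" by (simp add: card_cartesian_product)
    also have "\<dots> \<le> card (K <#> fst ` J)" using J False by (intro doubling) auto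
    also have "K <#> fst ` J = (\<Union>i\<in>J. ?S i)" by (force simp: set_mult_def)
    finally show ?thesis .
  qed simp
  obtain f where f: "inj_on f (carrier G \<times> UNIV)"
    and fS: "\<And>i. i \<in> carrier G \<times> UNIV \<Longrightarrow> f i \<in> ?S i"
    using hall_marriage[of "carrier G \<times> UNIV" ?S] hall K by (auto simp: case_prod_beta)
  have "\<exists>k\<in>K. f (x, b) = k \<otimes> x" if "x \<in> carrier G" for x b using fS[of "(x, b)"] that by auto
  then obtain \<kappa> where \<kappa>: "\<And>x b. x \<in> carrier G \<Longrightarrow> \<kappa> x b \<in> K \<and> f (x, b) = \<kappa> x b \<otimes> x"
    by metis
  define R where "R b = (\<lambda>x. f (x, b)) ` carrier G" for b
  have R: "R b \<subseteq> carrier G" for b using \<kappa> K by (auto simp: R_def)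
  have \<mu>R: "\<mu> (R b) = 1" for b
  proof -
    \<comment> \<open>On \<open>A k\<close> the map is left translation by \<open>k\<close>, so
      invariance applies piece by piece.\<close>
    define A where "A k = {x \<in> carrier G. \<kappa> x b = k}" for k
    have A: "A k \<subseteq> carrier G" for k by (auto simp: A_def)
    have kA: "k <#\<^bsub>G\<^esub> A k = (\<lambda>x. f (x, b)) ` A k" for k
      using \<kappa> by (force simp: l_coset_def A_def)
    have disj: "disjoint_family_on A K" by (auto simp: disjoint_family_on_def A_def)
    have "disjoint_family_on (\<lambda>k. k <#\<^bsub>G\<^esub> A k) K"
      unfolding kA disjoint_family_on_def
    proof (intro ballI impI)
      fix m n assume "m \<in> K" "n \<in> K" "m \<noteq> n"
      show "(\<lambda>x. f (x, b)) ` A m \<inter> (\<lambda>x. f (x, b)) ` A n = {}"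
      proof safe
        fix x y assume "x \<in> A m" "y \<in> A n" "f (x, b) = f (y, b)"
        then have "(x, b) = (y, b)" by (intro inj_onD[OF f]) (auto simp: A_def)
        then show "f (x, b) \<in> {}" using \<open>x \<in> A m\<close> \<open>y \<in> A n\<close> \<open>m \<noteq> n\<close> by (auto simp: A_def)
      qed
    qed
    moreover have "k <#\<^bsub>G\<^esub> A k \<subseteq> carrier G" if "k \<in> K" for k
      using l_coset_subset_G[OF A] K that by blast
    ultimately have "\<mu> (\<Union>k\<in>K. k <#\<^bsub>G\<^esub> A k) = (\<Sum>k\<in>K. \<mu> (k <#\<^bsub>G\<^esub> A k))"
      by (intro finite_additive_Union[OF add K(1)])
    also have "\<dots> = (\<Sum>k\<in>K. \<mu> (A k))" using K A by (intro sum.cong refl inv) auto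
    also have "\<dots> = \<mu> (\<Union>k\<in>K. A k)"
      by (rule finite_additive_Union[OF add K(1) A disj, symmetric])
    also have "(\<Union>k\<in>K. A k) = carrier G" using \<kappa> by (auto simp: A_def)
    also have "(\<Union>k\<in>K. k <#\<^bsub>G\<^esub> A k) = R b" unfolding kA R_def using \<kappa> by (auto simp: A_def)
    finally show ?thesis using one by simp
  qed
  \<comment> \<open>Two disjoint sets of mass 1 do not fit into total mass 1.\<close>
  have "R True \<inter> R False = {}"
    using f by (auto simp: R_def dest: inj_onD)
  then have "\<mu> (R True \<union> R False) = 2" using add[OF R R] \<mu>R by simp
  moreover have "\<mu> (carrier G) = \<mu> (R True \<union> R False) + \<mu> (carrier G - (R True \<union> R False))"
    using R by (subst add[symmetric]) (auto intro!: arg_cong[of _ _ \<mu>])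
  ultimately show False using one pos[of "carrier G - (R True \<union> R False)"] by auto
qed

text \<open>If every finite set grew by the factor \<open>1 + \<epsilon>\<close> under
  \<open>K\<close>, the \<open>n\<close>-fold product set of \<open>K\<close> would double every
  nonempty finite set for large \<open>n\<close>, against
  \<open>amenable_not_doubling\<close>.\<close>

lemma amenable_folner_set_mult:
  fixes \<epsilon> :: real
  assumes "amenable G" and K: "finite K" "K \<subseteq> carrier G" and "0 < \<epsilon>"
  shows "\<exists>F. finite F \<and> F \<noteq> {} \<and> F \<subseteq> carrier G \<and> real (card (K <#> F)) < (1 + \<epsilon>) * card F"
proof (rule ccontr)
  assume no: "\<not> ?thesis"
  have growth: "(1 + \<epsilon>) * card F \<le> card (K <#> F)" if "finite F" "F \<noteq> {}" "F \<subseteq> carrier G" for F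
  proof -
    have "\<not> real (card (K <#> F)) < (1 + \<epsilon>) * card F" using no that by blast
    then show ?thesis by simp
  qed
  have finite_mult: "finite (X <#> Y)" if "finite X" "finite Y" for X Y
    using that by (auto simp: set_mult_def)
  have iter: "finite (((<#>) K ^^ n) F) \<and> ((<#>) K ^^ n) F \<subseteq> carrier G \<and> (1 + \<epsilon>) ^ n * card F \<le> card (((<#>) K ^^ n) F)"
    if F: "finite F" "F \<noteq> {}" "F \<subseteq> carrier G" for F n
  proof (induction n)
    case (Suc n)
    let ?X = "((<#>) K ^^ n) F"
    have "0 < (1 + \<epsilon>) ^ n * card F" using F \<open>0 < \<epsilon>\<close> by (simp add: card_gt_0_iff)
    then have "?X \<noteq> {}" using Suc by auto
    then have "(1 + \<epsilon>) * card ?X \<le> card (K <#> ?X)" using Suc by (intro growth) auto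
    moreover have "(1 + \<epsilon>) * ((1 + \<epsilon>) ^ n * card F) \<le> (1 + \<epsilon>) * card ?X"
      using Suc \<open>0 < \<epsilon>\<close> by (intro mult_left_mono) auto
    ultimately show ?case using Suc K by (auto simp: finite_mult set_mult_closed mult.assoc)
  qed (use F in simp)
  obtain n where n: "2 < (1 + \<epsilon>) ^ n" using real_arch_pow[of "1 + \<epsilon>" 2] \<open>0 < \<epsilon>\<close> by auto
  have one: "finite {\<one>}" "{\<one>} \<noteq> {}" "{\<one>} \<subseteq> carrier G" by auto
  let ?L = "((<#>) K ^^ n) {\<one>}"
  \<comment> \<open>Associativity turns \<open>n\<close> multiplications by \<open>K\<close> into
    one by a fixed finite set.\<close>
  have iter_mult: "((<#>) K ^^ n) {\<one>} <#> F = ((<#>) K ^^ n) F" if F: "F \<subseteq> carrier G" for F n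
  proof (induction n)
    case 0
    show ?case using F by (force simp: set_mult_def)
  next
    case (Suc n)
    have "((<#>) K ^^ n) {\<one>} \<subseteq> carrier G" using iter[OF one] by blast
    then show ?case using Suc K F by (simp add: set_mult_assoc)
  qed
  obtain F where F: "finite F" "F \<noteq> {}" "F \<subseteq> carrier G" "card (?L <#> F) < 2 * card F"
    using amenable_not_doubling[OF assms(1), of ?L] iter[OF one] by blast
  have "0 < card F" using F by (simp add: card_gt_0_iff)
  then have "2 * real (card F) < (1 + \<epsilon>) ^ n * card F" using n by simp
  also have "\<dots> \<le> card (?L <#> F)" using iter[OF F(1-3), of n] by (simp add: iter_mult F)
  also have "\<dots> < 2 * card F" using F(4) by simp
  finally show False by simp
qed

lemma amenable_folner:
  fixes \<epsilon> :: real
  assumes "amenable G" and K: "finite K" "K \<subseteq> carrier G" and "0 < \<epsilon>"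
  obtains F where "finite F" "F \<noteq> {}" "F \<subseteq> carrier G"
    "\<And>g. g \<in> K \<Longrightarrow> real (card {x \<in> F. g \<otimes> x \<notin> F}) \<le> \<epsilon> * card F"
proof -
  \<comment> \<open>Adjoining the unit makes \<open>F\<close> a subset of the product set, so the
    points that \<open>g\<close> moves out of \<open>F\<close> are counted by the increase in
    cardinality.\<close>
  obtain F where F: "finite F" "F \<noteq> {}" "F \<subseteq> carrier G"
    and small: "real (card (insert \<one> K <#> F)) < (1 + \<epsilon>) * card F"
    using amenable_folner_set_mult[OF assms(1), of "insert \<one> K" \<epsilon>] K assms(4) by auto
  have fin: "finite (insert \<one> K <#> F)" using F K by (auto simp: set_mult_def)
  have sub: "F \<subseteq> insert \<one> K <#> F" using F by (force simp: set_mult_def)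
  have "real (card {x \<in> F. g \<otimes> x \<notin> F}) \<le> \<epsilon> * card F" if g: "g \<in> K" for g
  proof -
    have "inj_on ((\<otimes>) g) {x \<in> F. g \<otimes> x \<notin> F}"
      using g K F by (auto intro!: inj_onI simp: subset_iff)
    then have "card {x \<in> F. g \<otimes> x \<notin> F} = card ((\<otimes>) g ` {x \<in> F. g \<otimes> x \<notin> F})"
      by (simp add: card_image)
    also have "\<dots> \<le> card ((insert \<one> K <#> F) - F)"
      by (rule card_mono) (use g fin in \<open>auto simp: set_mult_def\<close>)
    also have "\<dots> = card (insert \<one> K <#> F) - card F" using F sub by (simp add: card_Diff_subset)
    finally have "real (card {x \<in> F. g \<otimes> x \<notin> F}) \<le> real (card (insert \<one> K <#> F)) - real (card F)"
      using card_mono[OF fin sub] by linarith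
    then show ?thesis using small by (simp add: algebra_simps)
  qed
  with F show thesis using that by blast
qed

end

section \<open>Convolution operators\<close>

text \<open>The matrix of left convolution by a formal sum. Group elements may be repeated, and the
  coefficients are real because averaging rescales them.\<close>

definition conv_kernel :: "('g, 'm) monoid_scheme \<Rightarrow> (real \<times> 'g) list \<Rightarrow> 'g \<Rightarrow> 'g \<Rightarrow> real" where
  "conv_kernel G l h t = (\<Sum>(c, g)\<leftarrow>l. c * of_bool (h = g \<otimes>\<^bsub>G\<^esub> t))"

definition l1_norm :: "(real \<times> 'g) list \<Rightarrow> real" where
  "l1_norm l = (\<Sum>(c, g)\<leftarrow>l. \<bar>c\<bar>)"

text \<open>The l1 norm of the portion of the formal sum that averaging over \<open>F\<close>
  loses.\<close>

definition folner_defect :: "('g, 'm) monoid_scheme \<Rightarrow> (real \<times> 'g) list \<Rightarrow> 'g set \<Rightarrow> real" where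
  "folner_defect G l F = (\<Sum>(c, g)\<leftarrow>l. \<bar>c\<bar> * (card {x \<in> F. g \<otimes>\<^bsub>G\<^esub> x \<notin> F} / card F))"

lemma conv_kernel_simps [simp]:
  "conv_kernel G [] = (\<lambda>h t. 0)"
  "conv_kernel G ((c, g) # l) = (\<lambda>h t. c * of_bool (h = g \<otimes>\<^bsub>G\<^esub> t) + conv_kernel G l h t)"
  by (simp_all add: conv_kernel_def fun_eq_iff)

lemma l1_norm_simps [simp]: "l1_norm [] = 0" "l1_norm ((c, g) # l) = \<bar>c\<bar> + l1_norm l"
  by (simp_all add: l1_norm_def)

lemma folner_defect_simps [simp]: "folner_defect G [] F = 0"
  "folner_defect G ((c, g) # l) F = \<bar>c\<bar> * (card {x \<in> F. g \<otimes>\<^bsub>G\<^esub> x \<notin> F} / card F) + folner_defect G l F"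
  by (simp_all add: folner_defect_def)

lemma l1_norm_nonneg: "0 \<le> l1_norm l"
  by (induction l) auto

lemma folner_defect_nonneg: "0 \<le> folner_defect G l F"
  by (induction l) auto

context group
begin

section \<open>Compressions and averaging over right translates\<close>

lemma translation_form_eq:
  assumes Q: "finite Q"
  shows "(\<Sum>x\<in>Q. \<Sum>y\<in>Q. \<eta> x * of_bool (x = g \<otimes> y) * \<xi> y) = (\<Sum>y\<in>Q. (if g \<otimes> y \<in> Q then \<eta> (g \<otimes> y) else 0) * (\<xi> y :: real))"
proof -
  have "(\<Sum>x\<in>Q. \<Sum>y\<in>Q. \<eta> x * of_bool (x = g \<otimes> y) * \<xi> y) = (\<Sum>y\<in>Q. \<Sum>x\<in>Q. \<eta> x * of_bool (x = g \<otimes> y) * \<xi> y)"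
    by (rule sum.swap)
  also have "\<dots> = (\<Sum>y\<in>Q. (\<Sum>x\<in>Q. if x = g \<otimes> y then \<eta> x else 0) * \<xi> y)"
    unfolding sum_distrib_right by (intro sum.cong refl) auto
  finally show ?thesis using Q by (simp cong: if_cong)
qed

text \<open>Translation by \<open>g\<close>, cut down to \<open>Q\<close>, is a partial injection
  and hence a contraction.\<close>

lemma bounded_form_translation:
  assumes g: "g \<in> carrier G" and Q: "finite Q" "Q \<subseteq> carrier G"
  shows "bounded_form Q (\<lambda>h t. of_bool (h = g \<otimes> t)) 1"
  unfolding bounded_form_def translation_form_eq[OF Q(1)]
proof (intro allI)
  fix \<eta> \<xi> :: "'a \<Rightarrow> real"
  let ?e = "\<lambda>y. if g \<otimes> y \<in> Q then \<eta> (g \<otimes> y) else 0"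
  have inj: "inj_on (\<lambda>y. g \<otimes> y) Q" using g Q by (auto intro!: inj_onI simp: subset_iff)
  have "L2_set ?e Q \<le> L2_set \<eta> Q"
    unfolding L2_set_def
  proof (rule real_sqrt_le_mono)
    have "(\<Sum>y\<in>Q. (?e y)\<^sup>2) = (\<Sum>y\<in>{y \<in> Q. g \<otimes> y \<in> Q}. (\<eta> (g \<otimes> y))\<^sup>2)"
      using Q(1) by (intro sum.mono_neutral_cong_right) auto
    also have "\<dots> = (\<Sum>x\<in>(\<lambda>y. g \<otimes> y) ` {y \<in> Q. g \<otimes> y \<in> Q}. (\<eta> x)\<^sup>2)"
      by (subst sum.reindex) (auto intro: inj_on_subset[OF inj])
    also have "\<dots> \<le> (\<Sum>x\<in>Q. (\<eta> x)\<^sup>2)" using Q(1) by (intro sum_mono2) auto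
    finally show "(\<Sum>y\<in>Q. (?e y)\<^sup>2) \<le> (\<Sum>x\<in>Q. (\<eta> x)\<^sup>2)" .
  qed
  then have "L2_set ?e Q * L2_set \<xi> Q \<le> L2_set \<eta> Q * L2_set \<xi> Q"
    by (intro mult_right_mono) auto
  then show "(\<Sum>y\<in>Q. ?e y * \<xi> y) \<le> 1 * L2_set \<eta> Q * L2_set \<xi> Q"
    using L2_set_inner_le[of ?e \<xi> Q] by simp
qed

lemma bounded_form_conv_kernel_l1:
  assumes Q: "finite Q" "Q \<subseteq> carrier G" and l: "snd ` set l \<subseteq> carrier G"
  shows "bounded_form Q (conv_kernel G l) (l1_norm l)"
  using l
proof (induction l)
  case Nil
  then show ?case by (simp add: bounded_form_def)
next
  case (Cons a l)
  obtain c g where a: "a = (c, g)" by fastforce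
  with Cons.prems have "bounded_form Q (\<lambda>h t. c * of_bool (h = g \<otimes> t)) (\<bar>c\<bar> * 1)"
    by (intro bounded_form_scale bounded_form_translation Q) auto
  from bounded_form_add[OF this Cons.IH] Cons.prems show ?case by (simp add: a)
qed

text \<open>The index set contains every \<open>x\<close> that some element of \<open>F\<close>
  multiplies into \<open>Q\<close>. One finite set thus serves all \<open>u \<in> F\<close> and
  replaces summation over the whole group.\<close>

lemma sum_translates:
  fixes f :: "'a \<Rightarrow> real"
  assumes F: "finite F" "F \<subseteq> carrier G" and Q: "finite Q" "Q \<subseteq> carrier G"
    and u: "u \<in> F" and f: "\<And>y. y \<notin> Q \<Longrightarrow> f y = 0"
  shows "(\<Sum>x\<in>(\<lambda>(v, q). inv v \<otimes> q) ` (F \<times> Q). f (u \<otimes> x)) = (\<Sum>q\<in>Q. f q)"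
proof -
  let ?X = "(\<lambda>(v, q). inv v \<otimes> q) ` (F \<times> Q)"
  have X: "?X \<subseteq> carrier G" using F Q by auto
  have uG: "u \<in> carrier G" using u F by auto
  have "inj_on (\<lambda>x. u \<otimes> x) ?X" using X uG by (intro inj_onI) (auto simp: subset_iff)
  then have "(\<Sum>x\<in>?X. f (u \<otimes> x)) = (\<Sum>y\<in>(\<lambda>x. u \<otimes> x) ` ?X. f y)"
    by (simp add: sum.reindex)
  also have "\<dots> = (\<Sum>q\<in>Q. f q)"
  proof (rule sum.mono_neutral_right)
    show "Q \<subseteq> (\<lambda>x. u \<otimes> x) ` ?X"
    proof
      fix q assume q: "q \<in> Q"
      then have "q = u \<otimes> (inv u \<otimes> q)" using uG Q by (simp add: m_assoc[symmetric] subset_iff)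
      then show "q \<in> (\<lambda>x. u \<otimes> x) ` ?X" using u q by (intro image_eqI[of _ _ "inv u \<otimes> q"]) auto
    qed
  qed (use F Q f in auto)
  finally show ?thesis .
qed

text \<open>The compressions of convolution to the right translates of \<open>F\<close> add up to convolution by the
  formal sum in which the coefficient of \<open>g\<close> is multiplied by the number of \<open>v \<in> F\<close> with
  \<open>g \<otimes> v \<in> F\<close>.\<close>

lemma sum_translated_forms:
  assumes F: "finite F" "F \<subseteq> carrier G" and Q: "finite Q" "Q \<subseteq> carrier G"
    and l: "snd ` set l \<subseteq> carrier G"
    and \<eta>: "\<And>y. y \<notin> Q \<Longrightarrow> \<eta> y = 0" and \<xi>: "\<And>y. y \<notin> Q \<Longrightarrow> \<xi> y = 0"
  shows "(\<Sum>x\<in>(\<lambda>(v, q). inv v \<otimes> q) ` (F \<times> Q). \<Sum>u\<in>F. \<Sum>v\<in>F. \<eta> (u \<otimes> x) * conv_kernel G l u v * \<xi> (v \<otimes> x)) =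
    (\<Sum>h\<in>Q. \<Sum>t\<in>Q. \<eta> h * conv_kernel G (map (\<lambda>(c, g). (c * real (card {v \<in> F. g \<otimes> v \<in> F}), g)) l) h t * \<xi> t)"
  using l
proof (induction l)
  case (Cons a l)
  obtain c g where a: "a = (c, g)" by fastforce
  then have g: "g \<in> carrier G" using Cons.prems by auto
  let ?X = "(\<lambda>(v, q). inv v \<otimes> q) ` (F \<times> Q)"
  let ?S = "\<Sum>y\<in>Q. \<eta> (g \<otimes> y) * \<xi> y"
  have X: "?X \<subseteq> carrier G" using F Q by auto
  have "(\<Sum>x\<in>?X. \<Sum>u\<in>F. \<Sum>v\<in>F. \<eta> (u \<otimes> x) * of_bool (u = g \<otimes> v) * \<xi> (v \<otimes> x)) =
      (\<Sum>x\<in>?X. \<Sum>v\<in>F. (if g \<otimes> v \<in> F then \<eta> (g \<otimes> v \<otimes> x) else 0) * \<xi> (v \<otimes> x))"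
    by (intro sum.cong refl translation_form_eq F)
  also have "\<dots> = (\<Sum>v\<in>F. \<Sum>x\<in>?X. (if g \<otimes> v \<in> F then \<eta> (g \<otimes> v \<otimes> x) else 0) * \<xi> (v \<otimes> x))"
    by (rule sum.swap)
  also have "\<dots> = (\<Sum>v\<in>F. if g \<otimes> v \<in> F then ?S else 0)"
  proof (intro sum.cong refl)
    fix v assume v: "v \<in> F"
    \<comment> \<open>Associativity is what makes right translation commute with multiplication by
      \<open>g\<close>; the resulting sum no longer depends on \<open>v\<close>.\<close>
    have "(\<Sum>x\<in>?X. \<eta> (g \<otimes> v \<otimes> x) * \<xi> (v \<otimes> x)) = (\<Sum>x\<in>?X. \<eta> (g \<otimes> (v \<otimes> x)) * \<xi> (v \<otimes> x))"
      using g v F X by (intro sum.cong refl) (simp add: m_assoc subset_iff)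
    also have "\<dots> = ?S" using \<xi> by (intro sum_translates[OF F Q v]) simp
    finally show "(\<Sum>x\<in>?X. (if g \<otimes> v \<in> F then \<eta> (g \<otimes> v \<otimes> x) else 0) * \<xi> (v \<otimes> x)) = (if g \<otimes> v \<in> F then ?S else 0)"
      by simp
  qed
  also have "\<dots> = real (card {v \<in> F. g \<otimes> v \<in> F}) * ?S"
    using F(1) by (simp add: sum.If_cases Int_def)
  also have "?S = (\<Sum>h\<in>Q. \<Sum>t\<in>Q. \<eta> h * of_bool (h = g \<otimes> t) * \<xi> t)"
    unfolding translation_form_eq[OF Q(1)] using \<eta> by (intro sum.cong refl) auto
  finally have *: "(\<Sum>x\<in>?X. \<Sum>u\<in>F. \<Sum>v\<in>F. \<eta> (u \<otimes> x) * of_bool (u = g \<otimes> v) * \<xi> (v \<otimes> x)) =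
      card {v \<in> F. g \<otimes> v \<in> F} * (\<Sum>h\<in>Q. \<Sum>t\<in>Q. \<eta> h * of_bool (h = g \<otimes> t) * \<xi> t)" .
  have "(\<Sum>x\<in>?X. \<Sum>u\<in>F. \<Sum>v\<in>F. \<eta> (u \<otimes> x) * conv_kernel G (a # l) u v * \<xi> (v \<otimes> x)) =
      c * (\<Sum>x\<in>?X. \<Sum>u\<in>F. \<Sum>v\<in>F. \<eta> (u \<otimes> x) * of_bool (u = g \<otimes> v) * \<xi> (v \<otimes> x)) +
      (\<Sum>x\<in>?X. \<Sum>u\<in>F. \<Sum>v\<in>F. \<eta> (u \<otimes> x) * conv_kernel G l u v * \<xi> (v \<otimes> x))"
    unfolding a conv_kernel_simps sum_distrib_left sum.distrib[symmetric]
    by (intro sum.cong refl) (simp add: algebra_simps)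
  also have "\<dots> = (\<Sum>h\<in>Q. \<Sum>t\<in>Q. \<eta> h * conv_kernel G (map (\<lambda>(c, g). (c * real (card {v \<in> F. g \<otimes> v \<in> F}), g)) (a # l)) h t * \<xi> t)"
    using Cons.IH Cons.prems
    unfolding * a conv_kernel_simps list.map split sum_distrib_left sum.distrib[symmetric]
    by (simp add: algebra_simps sum_distrib_left sum.distrib)
  finally show ?case .
qed simp

text \<open>Every point of \<open>Q\<close> is hit exactly once for each of the
  \<open>card F\<close> elements \<open>u\<close>.\<close>

lemma L2_set_translates:
  fixes f :: "'a \<Rightarrow> real"
  assumes F: "finite F" "F \<subseteq> carrier G" and Q: "finite Q" "Q \<subseteq> carrier G"
    and f: "\<And>y. y \<notin> Q \<Longrightarrow> f y = 0"
  shows "L2_set (\<lambda>x. L2_set (\<lambda>u. f (u \<otimes> x)) F) ((\<lambda>(v, q). inv v \<otimes> q) ` (F \<times> Q)) =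
    sqrt (card F) * L2_set f Q"
proof -
  let ?X = "(\<lambda>(v, q). inv v \<otimes> q) ` (F \<times> Q)"
  have "(\<Sum>x\<in>?X. \<Sum>u\<in>F. (f (u \<otimes> x))\<^sup>2) = (\<Sum>u\<in>F. \<Sum>x\<in>?X. (f (u \<otimes> x))\<^sup>2)" by (rule sum.swap)
  also have "\<dots> = (\<Sum>u\<in>F. \<Sum>q\<in>Q. (f q)\<^sup>2)"
    using f by (intro sum.cong refl sum_translates[OF F Q, where f = "\<lambda>y. (f y)\<^sup>2"]) auto
  finally show ?thesis
    unfolding L2_set_def[of _ ?X] L2_set_power2 by (simp add: L2_set_def real_sqrt_mult)
qed

text \<open>The bound on \<open>F\<close> is applied to the vectors as seen from each right
  translate, and Cauchy-Schwarz over the translates produces two factors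
  \<open>sqrt (card F)\<close>.\<close>

lemma bounded_form_averaged:
  fixes c :: real
  assumes F: "finite F" "F \<subseteq> carrier G" and Q: "finite Q" "Q \<subseteq> carrier G"
    and l: "snd ` set l \<subseteq> carrier G" and c: "bounded_form F (conv_kernel G l) c" "0 \<le> c"
  shows "bounded_form Q (conv_kernel G (map (\<lambda>(c, g). (c * real (card {v \<in> F. g \<otimes> v \<in> F}), g)) l)) (c * card F)"
  unfolding bounded_form_def
proof (intro allI)
  fix \<eta> \<xi> :: "'a \<Rightarrow> real"
  let ?X = "(\<lambda>(v, q). inv v \<otimes> q) ` (F \<times> Q)"
  let ?l = "map (\<lambda>(c, g). (c * real (card {v \<in> F. g \<otimes> v \<in> F}), g)) l"
  \<comment> \<open>Extension by zero, so that the parts of translates outside \<open>Q\<close>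
    contribute nothing.\<close>
  define e where "e y = (if y \<in> Q then \<eta> y else 0)" for y
  define z where "z y = (if y \<in> Q then \<xi> y else 0)" for y
  have "(\<Sum>h\<in>Q. \<Sum>t\<in>Q. \<eta> h * conv_kernel G ?l h t * \<xi> t) = (\<Sum>h\<in>Q. \<Sum>t\<in>Q. e h * conv_kernel G ?l h t * z t)"
    by (intro sum.cong refl) (simp add: e_def z_def)
  also have "\<dots> = (\<Sum>x\<in>?X. \<Sum>u\<in>F. \<Sum>v\<in>F. e (u \<otimes> x) * conv_kernel G l u v * z (v \<otimes> x))"
    by (rule sum_translated_forms[OF F Q l, symmetric]) (simp_all add: e_def z_def)
  also have "\<dots> \<le> (\<Sum>x\<in>?X. c * L2_set (\<lambda>u. e (u \<otimes> x)) F * L2_set (\<lambda>v. z (v \<otimes> x)) F)"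
    by (intro sum_mono c(1)[unfolded bounded_form_def, rule_format])
  also have "\<dots> = c * (\<Sum>x\<in>?X. L2_set (\<lambda>u. e (u \<otimes> x)) F * L2_set (\<lambda>v. z (v \<otimes> x)) F)"
    by (simp add: sum_distrib_left mult.assoc)
  also have "\<dots> \<le> c * (L2_set (\<lambda>x. L2_set (\<lambda>u. e (u \<otimes> x)) F) ?X * L2_set (\<lambda>x. L2_set (\<lambda>v. z (v \<otimes> x)) F) ?X)"
    by (intro mult_left_mono L2_set_inner_le c)
  also have "\<dots> = c * (sqrt (card F) * L2_set e Q * (sqrt (card F) * L2_set z Q))"
    by (subst (1 2) L2_set_translates[OF F Q]) (simp_all add: e_def z_def)
  also have "\<dots> = c * real (card F) * L2_set e Q * L2_set z Q" by simp
  also have "L2_set e Q = L2_set \<eta> Q" by (rule L2_set_cong) (simp_all add: e_def)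
  also have "L2_set z Q = L2_set \<xi> Q" by (rule L2_set_cong) (simp_all add: z_def)
  finally show "(\<Sum>h\<in>Q. \<Sum>t\<in>Q. \<eta> h * conv_kernel G ?l h t * \<xi> t) \<le> c * real (card F) * L2_set \<eta> Q * L2_set \<xi> Q" .
qed

text \<open>Each coefficient is split according to the proportions of \<open>F\<close> that
  \<open>g\<close> keeps in \<open>F\<close> and moves out of it. The first part is the average,
  bounded by \<open>c\<close>; the second is bounded by its l1 norm, the defect.\<close>

lemma bounded_form_folner:
  fixes c :: real
  assumes F: "finite F" "F \<noteq> {}" "F \<subseteq> carrier G" and Q: "finite Q" "Q \<subseteq> carrier G"
    and l: "snd ` set l \<subseteq> carrier G" and c: "bounded_form F (conv_kernel G l) c" "0 \<le> c"
  shows "bounded_form Q (conv_kernel G l) (c + folner_defect G l F)"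
proof -
  let ?n = "\<lambda>g. card {v \<in> F. g \<otimes> v \<in> F}" and ?m = "\<lambda>g. card {v \<in> F. g \<otimes> v \<notin> F}"
  let ?l1 = "map (\<lambda>(c, g). (c * real (?n g), g)) l" and ?l2 = "map (\<lambda>(c, g). (c * (real (?m g) / real (card F)), g)) l"
  have n: "0 < card F" using F by (simp add: card_gt_0_iff)
  have nm: "real (?n g) + ?m g = card F" for g
  proof -
    have "F = {v \<in> F. g \<otimes> v \<in> F} \<union> {v \<in> F. g \<otimes> v \<notin> F}" by auto
    then have "card F = ?n g + ?m g" using F(1)
      by (metis (no_types, lifting) card_Un_disjoint disjoint_iff finite_Un mem_Collect_eq)
    then show ?thesis by simp
  qed
  have "bounded_form Q (\<lambda>h t. (1 / card F) * conv_kernel G ?l1 h t) (\<bar>1 / card F\<bar> * (c * card F))"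
    using bounded_form_averaged[OF F(1,3) Q l c] c(2) by (intro bounded_form_scale) auto
  then have "bounded_form Q (\<lambda>h t. (1 / card F) * conv_kernel G ?l1 h t) c" using n by simp
  moreover have "bounded_form Q (conv_kernel G ?l2) (l1_norm ?l2)"
    using l by (intro bounded_form_conv_kernel_l1 Q) force
  ultimately have "bounded_form Q (\<lambda>h t. (1 / card F) * conv_kernel G ?l1 h t + conv_kernel G ?l2 h t) (c + l1_norm ?l2)"
    by (rule bounded_form_add)
  moreover have "l1_norm ?l2 = folner_defect G l F"
    by (induction l) (auto simp: abs_mult)
  moreover have "(1 / card F) * conv_kernel G ?l1 h t + conv_kernel G ?l2 h t = conv_kernel G l h t" for h t
  proof (induction l)
    case (Cons a l)
    obtain c g where a: "a = (c, g)" by fastforce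
    have "c * of_bool (h = g \<otimes> t) = (1 / card F) * (c * (?n g + ?m g) * of_bool (h = g \<otimes> t))"
      using n by (simp add: nm)
    also have "\<dots> = (1 / card F) * (c * ?n g * of_bool (h = g \<otimes> t)) + c * (?m g / card F) * of_bool (h = g \<otimes> t)"
      by (simp add: distrib_left distrib_right add_divide_distrib)
    finally show ?case using Cons by (simp add: a distrib_left)
  qed simp
  ultimately show ?thesis by simp
qed

lemma conv_kernel_right:
  assumes Q: "finite Q" "Q \<subseteq> carrier G" and h: "h \<in> carrier G" and l: "snd ` set l \<subseteq> carrier G"
    and \<xi>: "\<And>g. g \<in> snd ` set l \<Longrightarrow> inv g \<otimes> h \<notin> Q \<Longrightarrow> \<xi> (inv g \<otimes> h) = (0 :: complex)"
  shows "(\<Sum>t\<in>Q. of_real (conv_kernel G l h t) * \<xi> t) = (\<Sum>(c, g)\<leftarrow>l. of_real c * \<xi> (inv g \<otimes> h))"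
  using l \<xi>
proof (induction l)
  case (Cons a l)
  obtain c g where a: "a = (c, g)" by fastforce
  then have g: "g \<in> carrier G" using Cons.prems by auto
  have eq: "h = g \<otimes> t \<longleftrightarrow> inv g \<otimes> h = t" if "t \<in> Q" for t
    using that g h Q by (metis inv_solve_left subset_iff)
  have "(\<Sum>t\<in>Q. of_real (conv_kernel G (a # l) h t) * \<xi> t) =
      (\<Sum>t\<in>Q. of_real c * (if inv g \<otimes> h = t then \<xi> t else 0)) + (\<Sum>t\<in>Q. of_real (conv_kernel G l h t) * \<xi> t)"
    unfolding sum.distrib[symmetric] a by (intro sum.cong refl) (auto simp: eq algebra_simps)
  also have "(\<Sum>t\<in>Q. of_real c * (if inv g \<otimes> h = t then \<xi> t else 0)) = of_real c * \<xi> (inv g \<otimes> h)"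
    using Q(1) Cons.prems(2)[of g] by (auto simp: a sum_distrib_left[symmetric])
  finally show ?case using Cons by (simp add: a)
qed simp

end

text \<open>Testing against all functions identifies the list with \<open>a\<close> without
  collecting repeated terms; the values are complex because the regular representation acts on
  complex vectors.\<close>

definition represents :: "(real \<times> 'g) list \<Rightarrow> ('g \<Rightarrow>\<^sub>0 int) \<Rightarrow> bool" where
  "represents l a \<longleftrightarrow> (\<forall>\<phi> :: 'g \<Rightarrow> complex.
     (\<Sum>g\<in>Poly_Mapping.keys a. of_int (Poly_Mapping.lookup a g) * \<phi> g) = (\<Sum>(c, g)\<leftarrow>l. of_real c * \<phi> g))"

section \<open>The regular representation on square-summable vectors\<close>

context group
begin

lemma left_regular_ring_represents:
  assumes "represents l a" "h \<in> carrier G"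
  shows "left_regular_ring G a \<xi> h = (\<Sum>(c, g)\<leftarrow>l. of_real c * \<xi> (inv g \<otimes> h))"
  using assms by (simp add: left_regular_ring_def left_regular_def represents_def)

text \<open>The kernel is real, so real and imaginary parts are transformed separately by one real
  matrix. The last hypothesis lets \<open>Q\<close> miss needed points only where
  \<open>\<xi>\<close> vanishes.\<close>

lemma left_regular_ring_finite:
  assumes l: "represents l a" "snd ` set l \<subseteq> carrier G" and Q: "finite Q" "Q \<subseteq> carrier G"
    and h: "h \<in> carrier G" and \<xi>: "\<And>g. g \<in> snd ` set l \<Longrightarrow> inv g \<otimes> h \<notin> Q \<Longrightarrow> \<xi> (inv g \<otimes> h) = 0"
  shows "left_regular_ring G a \<xi> h =
    Complex (mat_vec Q (conv_kernel G l) (\<lambda>t. Re (\<xi> t)) h) (mat_vec Q (conv_kernel G l) (\<lambda>t. Im (\<xi> t)) h)"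
proof -
  have "left_regular_ring G a \<xi> h = (\<Sum>t\<in>Q. of_real (conv_kernel G l h t) * \<xi> t)"
    unfolding left_regular_ring_represents[OF l(1) h]
    by (rule conv_kernel_right[OF Q h l(2), symmetric]) (rule \<xi>)
  then show ?thesis by (simp add: complex_eq_iff mat_vec_def)
qed

lemma cmod_power2_sum: "(\<Sum>x\<in>Q. (cmod (\<xi> x))\<^sup>2) = (L2_set (\<lambda>x. Re (\<xi> x)) Q)\<^sup>2 + (L2_set (\<lambda>x. Im (\<xi> x)) Q)\<^sup>2"
  by (simp add: L2_set_power2 cmod_power2 sum.distrib)

lemma ell2_norm_nonneg: "0 \<le> ell2_norm I \<xi>"
  by (simp add: ell2_norm_def infsum_nonneg)

lemma ell2_norm_power2: "(ell2_norm I \<xi>)\<^sup>2 = (\<Sum>\<^sub>\<infinity>x\<in>I. (cmod (\<xi> x))\<^sup>2)"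
  by (simp add: ell2_norm_def infsum_nonneg)

lemma left_regular_ring_finite_le:
  assumes l: "represents l a" "snd ` set l \<subseteq> carrier G" and c: "0 \<le> c"
    and bounded: "\<And>Q. finite Q \<Longrightarrow> Q \<subseteq> carrier G \<Longrightarrow> bounded_form Q (conv_kernel G l) c"
    and \<xi>: "\<xi> \<in> ell2 (carrier G)" and H: "finite H" "H \<subseteq> carrier G"
  shows "(\<Sum>h\<in>H. (cmod (left_regular_ring G a \<xi> h))\<^sup>2) \<le> (c * ell2_norm (carrier G) \<xi>)\<^sup>2"
proof -
  \<comment> \<open>\<open>Q\<close> adds to \<open>H\<close> all points at which the operator reads
    \<open>\<xi>\<close> to compute its values on \<open>H\<close>, so the finite matrix reproduces
    these values exactly.\<close>
  define Q where "Q = H \<union> (\<lambda>(g, h). inv g \<otimes> h) ` (snd ` set l \<times> H)"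
  have "g \<in> carrier G" if "(c, g) \<in> set l" for c g using l(2) that by force
  then have Q: "finite Q" "Q \<subseteq> carrier G" using H by (auto simp: Q_def)
  let ?M = "\<lambda>f. mat_vec Q (conv_kernel G l) f"
  have M: "(L2_set (?M f) Q)\<^sup>2 \<le> (c * L2_set f Q)\<^sup>2" for f
    using bounded[OF Q] bounded_form_iff[OF c, of Q "conv_kernel G l"] by (intro power_mono) auto
  have "left_regular_ring G a \<xi> h = Complex (?M (\<lambda>t. Re (\<xi> t)) h) (?M (\<lambda>t. Im (\<xi> t)) h)" if "h \<in> H" for h
    using that H by (intro left_regular_ring_finite[OF l Q]) (force simp: Q_def)+
  then have "(\<Sum>h\<in>H. (cmod (left_regular_ring G a \<xi> h))\<^sup>2) =
      (\<Sum>h\<in>H. (?M (\<lambda>t. Re (\<xi> t)) h)\<^sup>2 + (?M (\<lambda>t. Im (\<xi> t)) h)\<^sup>2)"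
    by (intro sum.cong refl) (simp add: cmod_power2)
  also have "\<dots> \<le> (\<Sum>h\<in>Q. (?M (\<lambda>t. Re (\<xi> t)) h)\<^sup>2 + (?M (\<lambda>t. Im (\<xi> t)) h)\<^sup>2)"
    using Q by (intro sum_mono2) (auto simp: Q_def)
  also have "\<dots> = (L2_set (?M (\<lambda>t. Re (\<xi> t))) Q)\<^sup>2 + (L2_set (?M (\<lambda>t. Im (\<xi> t))) Q)\<^sup>2"
    by (simp add: L2_set_power2 sum.distrib)
  also have "\<dots> \<le> (c * L2_set (\<lambda>t. Re (\<xi> t)) Q)\<^sup>2 + (c * L2_set (\<lambda>t. Im (\<xi> t)) Q)\<^sup>2"
    by (intro add_mono M)
  also have "\<dots> = c\<^sup>2 * (\<Sum>t\<in>Q. (cmod (\<xi> t))\<^sup>2)"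
    unfolding cmod_power2_sum by (simp add: power_mult_distrib distrib_left)
  also have "\<dots> \<le> c\<^sup>2 * (\<Sum>\<^sub>\<infinity>x\<in>carrier G. (cmod (\<xi> x))\<^sup>2)"
    using \<xi> Q by (intro mult_left_mono finite_sum_le_infsum) (auto simp: ell2_def)
  finally show ?thesis by (simp add: power_mult_distrib ell2_norm_power2)
qed

lemma ell2_norm_left_regular_ring_le:
  assumes "represents l a" "snd ` set l \<subseteq> carrier G" "0 \<le> c"
    and "\<And>Q. finite Q \<Longrightarrow> Q \<subseteq> carrier G \<Longrightarrow> bounded_form Q (conv_kernel G l) c"
    and \<xi>: "\<xi> \<in> ell2 (carrier G)"
  shows "(\<lambda>h. (cmod (left_regular_ring G a \<xi> h))\<^sup>2) summable_on carrier G"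
    and "ell2_norm (carrier G) (left_regular_ring G a \<xi>) \<le> c * ell2_norm (carrier G) \<xi>"
proof -
  note le = left_regular_ring_finite_le[OF assms]
  show sum: "(\<lambda>h. (cmod (left_regular_ring G a \<xi> h))\<^sup>2) summable_on carrier G"
  proof (rule nonneg_bdd_above_summable_on)
    show "bdd_above (sum (\<lambda>h. (cmod (left_regular_ring G a \<xi> h))\<^sup>2) ` {F. F \<subseteq> carrier G \<and> finite F})"
      using le by (intro bdd_aboveI2) auto
  qed simp
  have "(ell2_norm (carrier G) (left_regular_ring G a \<xi>))\<^sup>2 \<le> (c * ell2_norm (carrier G) \<xi>)\<^sup>2"
    unfolding ell2_norm_power2 by (intro infsum_le_finite_sums sum le)
  then show "ell2_norm (carrier G) (left_regular_ring G a \<xi>) \<le> c * ell2_norm (carrier G) \<xi>"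
    by (rule power2_le_imp_le) (simp add: assms ell2_norm_nonneg)
qed

lemma lambda_norm_le:
  assumes "represents l a" "snd ` set l \<subseteq> carrier G" "0 \<le> c"
    and "\<And>Q. finite Q \<Longrightarrow> Q \<subseteq> carrier G \<Longrightarrow> bounded_form Q (conv_kernel G l) c"
  shows "lambda_norm G a \<le> c"
  unfolding lambda_norm_def ell2_opnorm_def
proof (rule cSUP_least)
  have "(\<lambda>x. 0) \<in> {\<xi> \<in> ell2 (carrier G). ell2_norm (carrier G) \<xi> \<le> 1}"
    by (simp add: ell2_def ell2_norm_def)
  then show "{\<xi> \<in> ell2 (carrier G). ell2_norm (carrier G) \<xi> \<le> 1} \<noteq> {}" by blast
next
  fix \<xi> assume "\<xi> \<in> {\<xi> \<in> ell2 (carrier G). ell2_norm (carrier G) \<xi> \<le> 1}"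
  then have "\<xi> \<in> ell2 (carrier G)" "ell2_norm (carrier G) \<xi> \<le> 1" by auto
  then show "ell2_norm (carrier G) (left_regular_ring G a \<xi>) \<le> c"
    using ell2_norm_left_regular_ring_le(2)[OF assms] mult_left_mono[of "ell2_norm (carrier G) \<xi>" 1 c] assms(3)
    by (metis mult.right_neutral order_trans)
qed

text \<open>A real supremum dominates its members only for sets bounded above; the l1 norm provides
  the bound.\<close>

lemma ell2_norm_le_lambda_norm:
  assumes l: "represents l a" "snd ` set l \<subseteq> carrier G"
    and \<xi>: "\<xi> \<in> ell2 (carrier G)" "ell2_norm (carrier G) \<xi> \<le> 1"
  shows "ell2_norm (carrier G) (left_regular_ring G a \<xi>) \<le> lambda_norm G a"
  unfolding lambda_norm_def ell2_opnorm_def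
proof (rule cSUP_upper)
  show "bdd_above ((\<lambda>\<xi>. ell2_norm (carrier G) (left_regular_ring G a \<xi>)) ` {\<xi> \<in> ell2 (carrier G). ell2_norm (carrier G) \<xi> \<le> 1})"
  proof (rule bdd_aboveI2)
    fix \<xi> assume "\<xi> \<in> {\<xi> \<in> ell2 (carrier G). ell2_norm (carrier G) \<xi> \<le> 1}"
    then have \<xi>: "\<xi> \<in> ell2 (carrier G)" "ell2_norm (carrier G) \<xi> \<le> 1" by auto
    have "ell2_norm (carrier G) (left_regular_ring G a \<xi>) \<le> l1_norm l * ell2_norm (carrier G) \<xi>"
      by (intro ell2_norm_left_regular_ring_le(2)[OF l] l1_norm_nonneg bounded_form_conv_kernel_l1 l \<xi>)
    also have "\<dots> \<le> l1_norm l * 1" by (intro mult_left_mono \<xi> l1_norm_nonneg)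
    finally show "ell2_norm (carrier G) (left_regular_ring G a \<xi>) \<le> l1_norm l" by simp
  qed
qed (use \<xi> in simp)

lemma lambda_norm_nonneg:
  assumes "represents l a" "snd ` set l \<subseteq> carrier G"
  shows "0 \<le> lambda_norm G a"
proof -
  have "0 \<le> ell2_norm (carrier G) (left_regular_ring G a (\<lambda>x. 0))" by (rule ell2_norm_nonneg)
  also have "\<dots> \<le> lambda_norm G a"
    by (rule ell2_norm_le_lambda_norm[OF assms]) (simp_all add: ell2_def ell2_norm_def)
  finally show ?thesis .
qed

text \<open>The vector is extended by zero, and restricting the image to \<open>Q\<close> can only
  shrink its norm.\<close>

lemma L2_set_le_lambda_norm:
  assumes l: "represents l a" "snd ` set l \<subseteq> carrier G" and Q: "finite Q" "Q \<subseteq> carrier G"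
    and \<xi>: "L2_set \<xi> Q = 1"
  shows "L2_set (mat_vec Q (conv_kernel G l) \<xi>) Q \<le> lambda_norm G a"
proof -
  define \<zeta> where "\<zeta> x = (if x \<in> Q then complex_of_real (\<xi> x) else 0)" for x
  have "(\<lambda>x. (cmod (\<zeta> x))\<^sup>2) summable_on carrier G"
    using Q by (subst summable_on_cong_neutral[of Q _ _ "\<lambda>x. (cmod (\<zeta> x))\<^sup>2"]) (auto simp: \<zeta>_def)
  then have ell2: "\<zeta> \<in> ell2 (carrier G)" using Q by (auto simp: ell2_def \<zeta>_def)
  have "(\<Sum>\<^sub>\<infinity>x\<in>carrier G. (cmod (\<zeta> x))\<^sup>2) = (\<Sum>\<^sub>\<infinity>x\<in>Q. (\<xi> x)\<^sup>2)"
    by (rule infsum_cong_neutral) (use Q in \<open>auto simp: \<zeta>_def\<close>)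
  also have "\<dots> = (L2_set \<xi> Q)\<^sup>2" using Q by (simp add: L2_set_power2)
  finally have "ell2_norm (carrier G) \<zeta> = 1" by (simp add: ell2_norm_def \<xi>)
  then have norm: "ell2_norm (carrier G) (left_regular_ring G a \<zeta>) \<le> lambda_norm G a"
    by (intro ell2_norm_le_lambda_norm[OF l ell2]) simp
  have re: "mat_vec Q (conv_kernel G l) (\<lambda>t. Re (\<zeta> t)) = mat_vec Q (conv_kernel G l) \<xi>"
    and im: "mat_vec Q (conv_kernel G l) (\<lambda>t. Im (\<zeta> t)) = (\<lambda>h. 0)"
    by (auto simp: mat_vec_def \<zeta>_def fun_eq_iff)
  have val: "left_regular_ring G a \<zeta> h = complex_of_real (mat_vec Q (conv_kernel G l) \<xi> h)" if "h \<in> Q" for h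
  proof -
    have "left_regular_ring G a \<zeta> h = Complex (mat_vec Q (conv_kernel G l) (\<lambda>t. Re (\<zeta> t)) h) (mat_vec Q (conv_kernel G l) (\<lambda>t. Im (\<zeta> t)) h)"
      using that Q by (intro left_regular_ring_finite[OF l Q]) (auto simp: \<zeta>_def)
    then show ?thesis by (simp add: re im complex_eq_iff)
  qed
  have "(L2_set (mat_vec Q (conv_kernel G l) \<xi>) Q)\<^sup>2 = (\<Sum>h\<in>Q. (cmod (left_regular_ring G a \<zeta> h))\<^sup>2)"
    unfolding L2_set_power2 by (intro sum.cong refl) (simp add: val)
  also have "\<dots> \<le> (\<Sum>\<^sub>\<infinity>h\<in>carrier G. (cmod (left_regular_ring G a \<zeta> h))\<^sup>2)"
    using ell2_norm_left_regular_ring_le(1)[OF l l1_norm_nonneg bounded_form_conv_kernel_l1[OF _ _ l(2)] ell2] Q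
    by (intro finite_sum_le_infsum) auto
  finally have "(L2_set (mat_vec Q (conv_kernel G l) \<xi>) Q)\<^sup>2 \<le> (ell2_norm (carrier G) (left_regular_ring G a \<zeta>))\<^sup>2"
    by (simp add: ell2_norm_power2)
  then show ?thesis using norm ell2_norm_nonneg power2_le_imp_le order_trans by blast
qed

lemma bounded_form_lambda_norm:
  assumes l: "represents l a" "snd ` set l \<subseteq> carrier G" and Q: "finite Q" "Q \<subseteq> carrier G"
  shows "bounded_form Q (conv_kernel G l) (lambda_norm G a)"
  unfolding bounded_form_iff[OF lambda_norm_nonneg[OF l]]
proof
  fix \<xi> :: "'a \<Rightarrow> real"
  let ?M = "mat_vec Q (conv_kernel G l)"
  show "L2_set (?M \<xi>) Q \<le> lambda_norm G a * L2_set \<xi> Q"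
  proof (cases "L2_set \<xi> Q = 0")
    case True
    then have "\<xi> x = 0" if "x \<in> Q" for x using that Q(1) by (simp add: L2_set_eq_0_iff)
    then have "?M \<xi> = (\<lambda>x. 0)" by (simp add: mat_vec_def)
    then show ?thesis using True by (simp add: L2_set_def)
  next
    case False
    define r where "r = 1 / L2_set \<xi> Q"
    have r: "0 < r" using False by (simp add: r_def less_le)
    have "L2_set (\<lambda>x. r * \<xi> x) Q = 1" using r False by (simp add: L2_set_scale) (simp add: r_def)
    from L2_set_le_lambda_norm[OF l Q this]
    have "r * L2_set (?M \<xi>) Q \<le> lambda_norm G a" using r by (simp add: mat_vec_scale L2_set_scale)
    then show ?thesis using False r by (simp add: r_def divide_le_eq less_le)
  qed
qed

section \<open>Norm bounds read off from powers of the Gram matrix\<close>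

definition conv_power_norm :: "(real \<times> 'a) list \<Rightarrow> 'a list \<Rightarrow> nat \<Rightarrow> real" where
  "conv_power_norm l fs k = gram_power_norm {..<length fs} (\<lambda>i j. conv_kernel G l (fs ! i) (fs ! j)) k"

lemma bounded_form_nth:
  assumes "distinct fs"
  shows "bounded_form (set fs) K c \<longleftrightarrow> bounded_form {..<length fs} (\<lambda>i j. K (fs ! i) (fs ! j)) c"
proof -
  have "(!) fs ` {..<length fs} = set fs" by (auto simp: set_conv_nth)
  then show ?thesis using bounded_form_reindex[OF inj_on_nth[OF assms], of "{..<length fs}" K c] by simp
qed

text \<open>Soundness of lower bounds: the power norm is at most \<open>length fs\<close> times a
  power of the norm of the compression, and compressing does not increase the norm.\<close>

lemma lambda_norm_ge_conv_power_norm: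
  fixes r :: real
  assumes l: "represents l a" "snd ` set l \<subseteq> carrier G" and fs: "distinct fs" "set fs \<subseteq> carrier G" "fs \<noteq> []"
    and r: "0 \<le> r" "length fs * r ^ (4 * Suc k) \<le> conv_power_norm l fs (Suc k)"
  shows "r \<le> lambda_norm G a"
proof -
  have "bounded_form {..<length fs} (\<lambda>i j. conv_kernel G l (fs ! i) (fs ! j)) (lambda_norm G a)"
    using bounded_form_lambda_norm[OF l, of "set fs"] fs by (simp add: bounded_form_nth)
  from gram_power_norm_le[OF this lambda_norm_nonneg[OF l], of "Suc k"]
  have "length fs * r ^ (4 * Suc k) \<le> length fs * lambda_norm G a ^ (4 * Suc k)"
    using r(2) by (simp add: conv_power_norm_def)
  then have "r ^ Suc (4 * k + 3) \<le> lambda_norm G a ^ Suc (4 * k + 3)"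
    using fs(3) by (simp add: algebra_simps)
  then show ?thesis by (rule power_le_imp_le_base) (rule lambda_norm_nonneg[OF l])
qed

lemma bounded_form_imp_lambda_norm_le:
  assumes l: "represents l a" "snd ` set l \<subseteq> carrier G" and F: "finite F" "F \<noteq> {}" "F \<subseteq> carrier G"
    and c: "bounded_form F (conv_kernel G l) c" "0 \<le> c"
  shows "lambda_norm G a \<le> c + folner_defect G l F"
  using c folner_defect_nonneg[of G l F]
  by (intro lambda_norm_le[OF l] bounded_form_folner[OF F _ _ l(2)]) auto

text \<open>Soundness of upper bounds: the power estimate bounds the compression by
  \<open>r\<close>, and averaging adds the defect.\<close>

lemma lambda_norm_le_conv_power_norm:
  fixes r :: real
  assumes l: "represents l a" "snd ` set l \<subseteq> carrier G" and fs: "distinct fs" "set fs \<subseteq> carrier G" "fs \<noteq> []"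
    and r: "0 \<le> r" "conv_power_norm l fs (Suc k) \<le> r ^ (4 * Suc k)"
  shows "lambda_norm G a \<le> r + folner_defect G l (set fs)"
  using bounded_form_if_gram_power_norm_le[OF r(2)[unfolded conv_power_norm_def] r(1)] fs r
  by (intro bounded_form_imp_lambda_norm_le[OF l]) (simp_all add: bounded_form_nth)

text \<open>Exponential growth of \<open>(s / r) ^ k\<close> absorbs the factor \<open>n\<close>,
  which will be the size of a Folner set; the exponent is chosen after the set.\<close>

lemma exists_power_ge_mult:
  fixes r s :: real
  assumes "0 \<le> r" "r < s"
  shows "\<exists>k. n * r ^ (4 * Suc k) \<le> s ^ (4 * Suc k)"
proof (cases "r = 0")
  case True
  then show ?thesis using assms by (intro exI[of _ 0]) simp
next
  case False
  then have r: "0 < r" "1 < s / r" using assms by auto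
  then obtain k where "n < (s / r) ^ k" using real_arch_pow by blast
  also have "(s / r) ^ k \<le> (s / r) ^ (4 * Suc k)" using r by (intro power_increasing) auto
  finally have "n * r ^ (4 * Suc k) \<le> (s / r) ^ (4 * Suc k) * r ^ (4 * Suc k)"
    using r by (intro mult_right_mono) auto
  then show ?thesis using r(1) by (intro exI[of _ k]) (simp only: power_mult_distrib[symmetric], simp)
qed

lemma amenable_folner_defect:
  assumes "amenable G" and l: "snd ` set l \<subseteq> carrier G" and "0 < \<epsilon>"
  obtains fs where "distinct fs" "set fs \<subseteq> carrier G" "fs \<noteq> []" "folner_defect G l (set fs) \<le> \<epsilon>"
proof -
  \<comment> \<open>The summand 1 keeps the denominator positive even if all coefficients
    vanish.\<close>
  let ?\<epsilon> = "\<epsilon> / (l1_norm l + 1)"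
  have pos: "0 < l1_norm l + 1" using l1_norm_nonneg[of l] by simp
  then have "0 < ?\<epsilon>" using assms(3) by simp
  then obtain F where F: "finite F" "F \<noteq> {}" "F \<subseteq> carrier G"
    and small: "\<And>g. g \<in> snd ` set l \<Longrightarrow> real (card {x \<in> F. g \<otimes> x \<notin> F}) \<le> ?\<epsilon> * card F"
    using amenable_folner[OF assms(1) _ l] by blast
  have "0 < card F" using F by (simp add: card_gt_0_iff)
  then have ratio: "card {x \<in> F. g \<otimes> x \<notin> F} / card F \<le> ?\<epsilon>" if "g \<in> snd ` set l" for g
    using small[OF that] by (simp add: divide_le_eq)
  have "folner_defect G m F \<le> l1_norm m * ?\<epsilon>" if "set m \<subseteq> set l" for m
    using that
  proof (induction m)
    case (Cons a m)
    obtain c g where a: "a = (c, g)" by fastforce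
    have "\<bar>c\<bar> * (card {x \<in> F. g \<otimes> x \<notin> F} / card F) \<le> \<bar>c\<bar> * ?\<epsilon>"
      using Cons.prems by (intro mult_left_mono ratio) (force simp: a)+
    then show ?case using Cons by (simp add: a distrib_right del: times_divide_eq_right)
  qed simp
  then have "folner_defect G l F \<le> l1_norm l * ?\<epsilon>" by blast
  also have "\<dots> \<le> \<epsilon>" using pos assms(3) l1_norm_nonneg[of l] by (simp add: divide_le_eq distrib_left mult.commute)
  finally have "folner_defect G l F \<le> \<epsilon>" .
  moreover obtain fs where "set fs = F" "distinct fs" using finite_distinct_list[OF F(1)] by blast
  ultimately show thesis using that F by (metis set_empty)
qed

text \<open>Completeness of lower bounds follows from soundness of upper bounds: a power norm of at
  most \<open>s ^ (4 * Suc k)\<close> would make the norm at most \<open>s\<close> plus the defect,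
  which is too small.\<close>

lemma exists_conv_power_norm_ge:
  fixes r :: real
  assumes "amenable G" and l: "represents l a" "snd ` set l \<subseteq> carrier G"
    and r: "0 \<le> r" "r < lambda_norm G a"
  shows "\<exists>fs k. distinct fs \<and> set fs \<subseteq> carrier G \<and> fs \<noteq> [] \<and> length fs * r ^ (4 * Suc k) \<le> conv_power_norm l fs (Suc k)"
proof -
  \<comment> \<open>Half of the gap is reserved for absorbing \<open>length fs\<close>; the other
    half leaves room for a defect of a quarter of the gap.\<close>
  define s where "s = (r + lambda_norm G a) / 2"
  have s: "0 \<le> s" "r < s" using r by (auto simp: s_def)
  obtain fs where fs: "distinct fs" "set fs \<subseteq> carrier G" "fs \<noteq> []"
    and defect: "folner_defect G l (set fs) \<le> (lambda_norm G a - r) / 4"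
    using amenable_folner_defect[OF assms(1) l(2), of "(lambda_norm G a - r) / 4"] r by auto
  obtain k where k: "length fs * r ^ (4 * Suc k) \<le> s ^ (4 * Suc k)"
    using exists_power_ge_mult[OF r(1) s(2)] by blast
  have "s + folner_defect G l (set fs) < lambda_norm G a" using defect r(2) by (simp add: s_def field_simps)
  then have "\<not> conv_power_norm l fs (Suc k) \<le> s ^ (4 * Suc k)"
    using lambda_norm_le_conv_power_norm[OF l fs s(1), of k] by linarith
  then show ?thesis using fs k by (intro exI[of _ fs] exI[of _ k]) simp
qed

text \<open>The defect is at most half of the gap, so \<open>r\<close> minus the defect still
  exceeds the norm; the exponent then absorbs \<open>length fs\<close>.\<close>

lemma exists_conv_power_norm_le:
  fixes r :: real
  assumes "amenable G" and l: "represents l a" "snd ` set l \<subseteq> carrier G"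
    and r: "lambda_norm G a < r"
  shows "\<exists>fs k. distinct fs \<and> set fs \<subseteq> carrier G \<and> fs \<noteq> [] \<and> folner_defect G l (set fs) \<le> r \<and>
    conv_power_norm l fs (Suc k) \<le> (r - folner_defect G l (set fs)) ^ (4 * Suc k)"
proof -
  obtain fs where fs: "distinct fs" "set fs \<subseteq> carrier G" "fs \<noteq> []"
    and defect: "folner_defect G l (set fs) \<le> (r - lambda_norm G a) / 2"
    using amenable_folner_defect[OF assms(1) l(2), of "(r - lambda_norm G a) / 2"] r by auto
  have s: "lambda_norm G a < r - folner_defect G l (set fs)" using defect r by (simp add: field_simps)
  obtain k where k: "length fs * lambda_norm G a ^ (4 * Suc k) \<le> (r - folner_defect G l (set fs)) ^ (4 * Suc k)"
    using exists_power_ge_mult[OF lambda_norm_nonneg[OF l] s] by blast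
  have "bounded_form {..<length fs} (\<lambda>i j. conv_kernel G l (fs ! i) (fs ! j)) (lambda_norm G a)"
    using bounded_form_lambda_norm[OF l, of "set fs"] fs by (simp add: bounded_form_nth)
  from gram_power_norm_le[OF this lambda_norm_nonneg[OF l], of "Suc k"]
  have "conv_power_norm l fs (Suc k) \<le> length fs * lambda_norm G a ^ (4 * Suc k)"
    by (simp add: conv_power_norm_def)
  with k have "conv_power_norm l fs (Suc k) \<le> (r - folner_defect G l (set fs)) ^ (4 * Suc k)" by linarith
  moreover have "folner_defect G l (set fs) \<le> r" using s lambda_norm_nonneg[OF l] by linarith
  ultimately show ?thesis using fs by blast
qed

end

section \<open>Certificates for bounds on the norm\<close>

type_synonym nat_word = "(nat \<times> bool) list"
type_synonym nat_sum = "(int \<times> nat_word) list"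

definition nat_same :: "(nat_word \<Rightarrow> bool) \<Rightarrow> nat_word \<Rightarrow> nat_word \<Rightarrow> bool" where
  "nat_same triv u v = triv (u @ rev (map (\<lambda>l. (fst l, \<not> snd l)) v))"

definition nat_kernel :: "(nat_word \<Rightarrow> bool) \<Rightarrow> nat_sum \<Rightarrow> nat_word list \<Rightarrow> nat \<Rightarrow> nat \<Rightarrow> int" where
  "nat_kernel triv s fs i j =
    (\<Sum>y\<leftarrow>s. if nat_same triv (nth_default [] fs i) (snd y @ nth_default [] fs j) then fst y else 0)"

definition nat_gram :: "(nat_word \<Rightarrow> bool) \<Rightarrow> nat_sum \<Rightarrow> nat_word list \<Rightarrow> nat \<Rightarrow> nat \<Rightarrow> int" where
  "nat_gram triv s fs i j = (\<Sum>l<length fs. nat_kernel triv s fs l i * nat_kernel triv s fs l j)"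

definition nat_step :: "(nat_word \<Rightarrow> bool) \<Rightarrow> nat_sum \<Rightarrow> nat_word list \<Rightarrow> int list \<Rightarrow> int list" where
  "nat_step triv s fs y = map (\<lambda>i. \<Sum>m<length fs. nat_gram triv s fs i m * nth_default 0 y m) [0..<length fs]"

definition nat_iterate :: "(nat_word \<Rightarrow> bool) \<Rightarrow> nat_sum \<Rightarrow> nat_word list \<Rightarrow> nat \<Rightarrow> nat \<Rightarrow> int list" where
  "nat_iterate triv s fs k j =
    rec_nat (map (\<lambda>i. if i = j then 1 else 0) [0..<length fs]) (\<lambda>_. nat_step triv s fs) k"

definition nat_power_norm :: "(nat_word \<Rightarrow> bool) \<Rightarrow> nat_sum \<Rightarrow> nat_word list \<Rightarrow> nat \<Rightarrow> int" where
  "nat_power_norm triv s fs k = (\<Sum>j<length fs. \<Sum>i<length fs.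
    nth_default 0 (nat_iterate triv s fs k j) i * nth_default 0 (nat_iterate triv s fs k j) i)"

definition nat_distinct :: "(nat_word \<Rightarrow> bool) \<Rightarrow> nat_word list \<Rightarrow> bool" where
  "nat_distinct triv fs \<longleftrightarrow>
    (\<forall>i<length fs. \<forall>j<length fs. i = j \<or> \<not> nat_same triv (nth_default [] fs i) (nth_default [] fs j))"

text \<open>For words with distinct values this is \<open>length fs\<close> times the Folner defect:
  without the division it remains an integer.\<close>

definition nat_defect :: "(nat_word \<Rightarrow> bool) \<Rightarrow> nat_sum \<Rightarrow> nat_word list \<Rightarrow> int" where
  "nat_defect triv s fs = (\<Sum>y\<leftarrow>s. (if fst y < 0 then - fst y else fst y) * (\<Sum>j<length fs.
    if \<forall>i<length fs. \<not> nat_same triv (nth_default [] fs i) (snd y @ nth_default [] fs j) then 1 else 0))"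

text \<open>A certificate \<open>(F, k, p, q)\<close> consists of a finite list of words, an exponent and the rational
  number \<open>p / (q + 1)\<close>. Signs of letters are coded by natural numbers in order to make the encoding
  of certificates surjective.\<close>

type_synonym certificate = "(nat \<times> nat) list list \<times> nat \<times> nat \<times> nat"

definition cert_words :: "certificate \<Rightarrow> nat_word list" where
  "cert_words z = map (map (\<lambda>l. (fst l, snd l = 0))) (fst z)"

text \<open>The lower test at \<open>p / (q + 1)\<close> with denominators cleared, so that only
  naturals are compared.\<close>

definition lower_cert :: "(nat_word \<Rightarrow> bool) \<Rightarrow> nat_sum \<Rightarrow> certificate \<Rightarrow> bool" where
  "lower_cert triv s z \<longleftrightarrow>
    cert_words z \<noteq> [] \<and> nat_distinct triv (cert_words z) \<and>
    length (cert_words z) * fst (snd (snd z)) ^ (4 * Suc (fst (snd z))) \<le>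
      nat (nat_power_norm triv s (cert_words z) (Suc (fst (snd z)))) * Suc (snd (snd (snd z))) ^ (4 * Suc (fst (snd z)))"

text \<open>The upper test with denominators cleared. The third conjunct says that the defect is at
  most \<open>p / (q + 1)\<close> and thereby keeps the truncated subtraction in the last one
  exact.\<close>

definition upper_cert :: "(nat_word \<Rightarrow> bool) \<Rightarrow> nat_sum \<Rightarrow> certificate \<Rightarrow> bool" where
  "upper_cert triv s z \<longleftrightarrow>
    cert_words z \<noteq> [] \<and> nat_distinct triv (cert_words z) \<and>
    nat (nat_defect triv s (cert_words z)) * Suc (snd (snd (snd z))) \<le> fst (snd (snd z)) * length (cert_words z) \<and>
    nat (nat_power_norm triv s (cert_words z) (Suc (fst (snd z)))) *
      (length (cert_words z) * Suc (snd (snd (snd z)))) ^ (4 * Suc (fst (snd z))) \<le>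
      (fst (snd (snd z)) * length (cert_words z)
        - nat (nat_defect triv s (cert_words z)) * Suc (snd (snd (snd z)))) ^ (4 * Suc (fst (snd z)))"

definition frac_less :: "nat \<times> nat \<Rightarrow> nat \<times> nat \<Rightarrow> bool" where
  "frac_less a b \<longleftrightarrow> fst a * Suc (snd b) < fst b * Suc (snd a)"

definition frac_value :: "nat \<times> nat \<Rightarrow> rat" where
  "frac_value a = Fract (int (fst a)) (int (Suc (snd a)))"

definition cert_of_nat :: "nat \<Rightarrow> certificate" where
  "cert_of_nat = inv_into UNIV encode"

text \<open>Keeping the best bound so far makes the output monotone although certificates come in no
  particular order.\<close>

definition best_lower :: "(nat_word \<Rightarrow> bool) \<Rightarrow> nat_sum \<Rightarrow> nat \<Rightarrow> nat \<times> nat" where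
  "best_lower triv s n = rec_nat (0, 0)
    (\<lambda>c a. if lower_cert triv s (cert_of_nat c) \<and> frac_less a (snd (snd (cert_of_nat c)))
      then snd (snd (cert_of_nat c)) else a) n"

text \<open>The start value is the l1 norm of \<open>s\<close>, an upper bound available before any
  certificate is found.\<close>

definition best_upper :: "(nat_word \<Rightarrow> bool) \<Rightarrow> nat_sum \<Rightarrow> nat \<Rightarrow> nat \<times> nat" where
  "best_upper triv s n = rec_nat (nat (\<Sum>y\<leftarrow>s. if fst y < 0 then - fst y else fst y), 0)
    (\<lambda>c a. if upper_cert triv s (cert_of_nat c) \<and> frac_less (snd (snd (cert_of_nat c))) a
      then snd (snd (cert_of_nat c)) else a) n"

section \<open>Computability of the certificate tests\<close>

lemma surj_encode_certificate: "surj (encode :: certificate \<Rightarrow> nat)"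
  by (intro surj_encode_prod surj_encode_list surj_encode_nat)

lemma surj_encode_int: "surj (encode :: int \<Rightarrow> nat)"
  by (rule surjI[of _ int_decode]) (simp add: encode_int_def)

lemma computable_cert_of_nat [computable_intros]:
  "computable f \<Longrightarrow> computable (\<lambda>x. cert_of_nat (f x))"
  unfolding cert_of_nat_def by (intro computable_comp[OF computable_inv_encode[OF surj_encode_certificate]])

lemma cert_of_nat_encode [simp]: "cert_of_nat (encode z) = z"
  by (simp add: cert_of_nat_def inv_into_f_f inj_encode)

lemma computable_cert_words [computable_intros]:
  "computable f \<Longrightarrow> computable (\<lambda>x. cert_words (f x))"
proof -
  have "computable cert_words" unfolding cert_words_def[abs_def] by (intro computable_intros)
  then show "computable f \<Longrightarrow> computable (\<lambda>x. cert_words (f x))" by (rule computable_comp)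
qed

lemma computable_frac_less [computable_intros]:
  "computable f \<Longrightarrow> computable g \<Longrightarrow> computable (\<lambda>x. frac_less (f x) (g x))"
  unfolding frac_less_def by (intro computable_intros)

context
  fixes triv :: "nat_word \<Rightarrow> bool"
  assumes triv: "computable triv"
begin

lemma computable_nat_same:
  "computable f \<Longrightarrow> computable g \<Longrightarrow> computable (\<lambda>x. nat_same triv (f x) (g x))"
  unfolding nat_same_def by (rule computable_comp[OF triv]) (intro computable_intros)

text \<open>First proved for the projections of a tuple, to which the introduction rules apply
  directly, and then composed with arbitrary arguments; several lemmas below repeat this
  pattern.\<close>

lemma computable_nat_kernel:
  assumes "computable s" "computable fs" "computable i" "computable j"
  shows "computable (\<lambda>x. nat_kernel triv (s x) (fs x) (i x) (j x))"
proof -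
  have "computable (\<lambda>p. nat_kernel triv (fst p) (fst (snd p)) (fst (snd (snd p))) (snd (snd (snd p))))"
    unfolding nat_kernel_def by (intro computable_intros computable_nat_same)
  from computable_comp[OF this, of "\<lambda>x. (s x, fs x, i x, j x)"] show ?thesis
    using assms by (simp add: computable_Pair)
qed

lemma computable_nat_gram:
  assumes "computable s" "computable fs" "computable i" "computable j"
  shows "computable (\<lambda>x. nat_gram triv (s x) (fs x) (i x) (j x))"
proof -
  have "computable (\<lambda>p. nat_gram triv (fst p) (fst (snd p)) (fst (snd (snd p))) (snd (snd (snd p))))"
    unfolding nat_gram_def by (intro computable_intros computable_nat_kernel)
  from computable_comp[OF this, of "\<lambda>x. (s x, fs x, i x, j x)"] show ?thesis
    using assms by (simp add: computable_Pair)
qed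

lemma computable_nat_step:
  assumes "computable s" "computable fs" "computable y"
  shows "computable (\<lambda>x. nat_step triv (s x) (fs x) (y x))"
proof -
  have "computable (\<lambda>p. nat_step triv (fst p) (fst (snd p)) (snd (snd p)))"
    unfolding nat_step_def by (intro computable_intros computable_nat_gram)
  from computable_comp[OF this, of "\<lambda>x. (s x, fs x, y x)"] show ?thesis
    using assms by (simp add: computable_Pair)
qed

lemma computable_nat_iterate:
  assumes "computable s" "computable fs" "computable k" "computable j"
  shows "computable (\<lambda>x. nat_iterate triv (s x) (fs x) (k x) (j x))"
proof -
  have "computable (\<lambda>p. nat_iterate triv (fst p) (fst (snd p)) (fst (snd (snd p))) (snd (snd (snd p))))"
    unfolding nat_iterate_def by (intro computable_intros computable_nat_step)
  from computable_comp[OF this, of "\<lambda>x. (s x, fs x, k x, j x)"] show ?thesis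
    using assms by (simp add: computable_Pair)
qed

lemma computable_nat_power_norm:
  assumes "computable s" "computable fs" "computable k"
  shows "computable (\<lambda>x. nat_power_norm triv (s x) (fs x) (k x))"
proof -
  have "computable (\<lambda>p. nat_power_norm triv (fst p) (fst (snd p)) (snd (snd p)))"
    unfolding nat_power_norm_def by (intro computable_intros computable_nat_iterate)
  from computable_comp[OF this, of "\<lambda>x. (s x, fs x, k x)"] show ?thesis
    using assms by (simp add: computable_Pair)
qed

lemma computable_nat_distinct:
  assumes "computable fs" shows "computable (\<lambda>x. nat_distinct triv (fs x))"
proof -
  have "computable (nat_distinct triv)"
    unfolding nat_distinct_def[abs_def] by (intro computable_intros computable_nat_same)
  from computable_comp[OF this assms] show ?thesis .
qed

lemma computable_nat_defect:
  assumes "computable s" "computable fs" shows "computable (\<lambda>x. nat_defect triv (s x) (fs x))"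
proof -
  have "computable (\<lambda>p. nat_defect triv (fst p) (snd p))"
    unfolding nat_defect_def by (intro computable_intros computable_nat_same)
  from computable_comp[OF this, of "\<lambda>x. (s x, fs x)"] show ?thesis
    using assms by (simp add: computable_Pair)
qed

lemma computable_lower_cert:
  assumes "computable s" "computable z" shows "computable (\<lambda>x. lower_cert triv (s x) (z x))"
  unfolding lower_cert_def by (intro computable_intros computable_nat_power_norm computable_nat_distinct assms)

lemma computable_upper_cert:
  assumes "computable s" "computable z" shows "computable (\<lambda>x. upper_cert triv (s x) (z x))"
  unfolding upper_cert_def
  by (intro computable_intros computable_nat_power_norm computable_nat_distinct computable_nat_defect assms)

lemma computable_best_lower: "computable (\<lambda>p. best_lower triv (fst p) (snd p))"
  unfolding best_lower_def by (intro computable_intros computable_lower_cert)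

lemma computable_best_upper: "computable (\<lambda>p. best_upper triv (fst p) (snd p))"
  unfolding best_upper_def by (intro computable_intros computable_upper_cert)

end

section \<open>Words and presented groups\<close>

text \<open>Needed because the integer kernel is matched with the convolution kernel only at valid
  list positions.\<close>

lemma gram_power_norm_cong:
  assumes "\<And>i j. i \<in> I \<Longrightarrow> j \<in> I \<Longrightarrow> K i j = L i j"
  shows "gram_power_norm I K k = gram_power_norm I L k"
proof -
  have "(mat_vec I (gram I K) ^^ k) \<xi> i = (mat_vec I (gram I L) ^^ k) \<xi> i" if "i \<in> I" for \<xi> i
    using that
  proof (induction k arbitrary: i)
    case (Suc k)
    have "gram I K i j = gram I L i j" if "j \<in> I" for j
      using Suc.prems that assms by (simp add: gram_def)
    then show ?case using Suc by (simp add: mat_vec_def)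
  qed simp
  then show ?thesis by (simp add: gram_power_norm_def)
qed

lemma nth_default_nat_iterate:
  "i < length fs \<Longrightarrow> nth_default 0 (nat_iterate triv s fs k j) i =
    (mat_vec {..<length fs} (gram {..<length fs} (nat_kernel triv s fs)) ^^ k) (\<lambda>i. of_bool (i = j)) i"
proof (induction k arbitrary: i)
  case 0
  then show ?case by (simp add: nat_iterate_def nth_default_def)
next
  case (Suc k)
  have "nat_iterate triv s fs (Suc k) j = nat_step triv s fs (nat_iterate triv s fs k j)"
    by (simp add: nat_iterate_def)
  moreover have "nat_gram triv s fs = gram {..<length fs} (nat_kernel triv s fs)"
    by (simp add: nat_gram_def gram_def fun_eq_iff)
  ultimately show ?case using Suc by (simp add: nat_step_def nth_default_def[of _ "map _ _"] mat_vec_def)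
qed

lemma nat_power_norm_eq:
  "nat_power_norm triv s fs k = gram_power_norm {..<length fs} (nat_kernel triv s fs) k"
  unfolding nat_power_norm_def gram_power_norm_def
  by (intro sum.cong refl) (simp add: nth_default_nat_iterate power2_eq_square)

section \<open>Values of words in the presented group\<close>

locale presentation =
  fixes A :: "'a set" and R :: "'a word set"
  assumes finite_presentation: "finite_presentation A R"
begin

abbreviation \<Gamma> :: "'a word set monoid" where "\<Gamma> \<equiv> presented_group A R"

definition word_value :: "'a word \<Rightarrow> 'a word set" where
  "word_value w = proj A R (reduce w)"

lemma finite_generators: "finite A" and relators: "R \<subseteq> carrier (free_group A)"
  using finite_presentation by (auto simp: finite_presentation_def)

sublocale \<Gamma>: group \<Gamma>
  by (rule group_presented_group[OF relators])

sublocale N: normal "relator_subgroup A R" "free_group A"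
  by (rule relator_subgroup_normal[OF relators])

text \<open>Unreduced words make the product plain concatenation, which is easy to compute; by
  \<open>foldr_reduce\<close>, reducing the factors first changes nothing.\<close>

lemma word_value_append:
  assumes "u \<in> words A" "v \<in> words A"
  shows "word_value (u @ v) = word_value u \<otimes>\<^bsub>\<Gamma>\<^esub> word_value v"
proof -
  have "reduce (u @ v) = reduce u \<otimes>\<^bsub>free_group A\<^esub> reduce v"
    using foldr_reduce[OF reduced_reduce, of u v]
    by (simp add: free_group_def reduce_append reduce_reduced[OF reduced_reduce])
  then show ?thesis
    using assms by (simp add: word_value_def proj_def presented_group_def FactGroup_def N.rcos_sum reduce_in_free_group)
qed

lemma word_value_Nil: "word_value [] = \<one>\<^bsub>\<Gamma>\<^esub>"
proof -
  have "reduce [] = \<one>\<^bsub>free_group A\<^esub>" by (simp add: reduce_def free_group_def)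
  then show ?thesis
    by (simp add: word_value_def proj_def presented_group_def FactGroup_def N.coset_join2 N.subset N.coset_mult_one)
qed

lemma carrier_eq: "carrier \<Gamma> = word_value ` words A"
proof -
  have "carrier (free_group A) = reduce ` words A"
  proof
    show "carrier (free_group A) \<subseteq> reduce ` words A"
      by (auto simp: free_group_def image_iff intro!: bexI reduce_reduced[symmetric])
  qed (use reduce_in_free_group in blast)
  then show ?thesis
    by (auto simp: presented_group_def FactGroup_def RCOSETS_def word_value_def proj_def)
qed

lemma word_value_closed [simp]: "w \<in> words A \<Longrightarrow> word_value w \<in> carrier \<Gamma>"
  by (simp add: carrier_eq)

definition inv_word :: "'a word \<Rightarrow> 'a word" where
  "inv_word w = map inv_letter (rev w)"

lemma inv_word_closed [simp]: "w \<in> words A \<Longrightarrow> inv_word w \<in> words A"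
  by (auto simp: inv_word_def words_def inv_letter_def in_lists_conv_set mem_Times_iff)

lemma word_value_inv_word:
  assumes "w \<in> words A" shows "word_value (inv_word w) = inv\<^bsub>\<Gamma>\<^esub> word_value w"
proof -
  have "word_value (inv_word w) \<otimes>\<^bsub>\<Gamma>\<^esub> word_value w = word_value (inv_word w @ w)"
    using assms by (simp add: word_value_append)
  also have "\<dots> = \<one>\<^bsub>\<Gamma>\<^esub>"
  proof -
    have "reduce (inv_word w @ w) = reduce []"
      unfolding inv_word_def reduce_rev_inverse by (simp add: reduce_def)
    then show ?thesis using word_value_Nil by (simp add: word_value_def)
  qed
  finally show ?thesis using assms by (simp add: \<Gamma>.inv_equality)
qed

lemma word_value_eq_iff:
  assumes "u \<in> words A" "v \<in> words A"
  shows "word_value (u @ inv_word v) = \<one>\<^bsub>\<Gamma>\<^esub> \<longleftrightarrow> word_value u = word_value v"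
  using assms by (simp add: word_value_append word_value_inv_word \<Gamma>.inv_solve_right')

definition value_list :: "'a formal_sum \<Rightarrow> (real \<times> 'a word set) list" where
  "value_list s = map (\<lambda>(c, w). (real_of_int c, word_value w)) s"

lemma represents_value_list: "represents (value_list s) (proj_ring A R (formal_sum_value s))"
  unfolding represents_def
proof
  fix \<phi> :: "'a word set \<Rightarrow> complex"
  define L where "L a = (\<Sum>g\<in>Poly_Mapping.keys a. of_int (Poly_Mapping.lookup a g) * \<phi> g)" for a
  \<comment> \<open>Keys of a sum may disappear by cancellation; the freedom to sum over a larger
    finite set makes \<open>L\<close> additive.\<close>
  have L: "L a = (\<Sum>g\<in>X. of_int (Poly_Mapping.lookup a g) * \<phi> g)" if "finite X" "Poly_Mapping.keys a \<subseteq> X" for a X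
    unfolding L_def using that by (intro sum.mono_neutral_left) (auto simp: in_keys_iff)
  have L_add: "L (a + b) = L a + L b" for a b
  proof -
    let ?X = "Poly_Mapping.keys a \<union> Poly_Mapping.keys b"
    have "L (a + b) = (\<Sum>g\<in>?X. of_int (Poly_Mapping.lookup (a + b) g) * \<phi> g)"
      by (rule L) (auto dest: subsetD[OF Poly_Mapping.keys_add])
    also have "\<dots> = (\<Sum>g\<in>?X. of_int (Poly_Mapping.lookup a g) * \<phi> g) + (\<Sum>g\<in>?X. of_int (Poly_Mapping.lookup b g) * \<phi> g)"
      by (simp add: Poly_Mapping.lookup_add distrib_right sum.distrib)
    also have "\<dots> = L a + L b" by (simp add: L[of ?X])
    finally show ?thesis .
  qed
  have L_single: "L (Poly_Mapping.single g c) = of_int c * \<phi> g" for g c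
    by (subst L[of "{g}"]) auto
  have proj_single: "proj_ring A R (Poly_Mapping.single w c) = Poly_Mapping.single (proj A R w) c" for w c
  proof -
    have single: "Poly_Mapping.single v c = frag_cmul c (frag_of v)" for v :: 'b
      by (intro poly_mapping_eqI) (simp add: lookup_single frag_cmul_def when_def)
    have "proj_ring A R (frag_cmul c (frag_of w)) = frag_cmul c (frag_of (proj A R w))"
      by (simp add: proj_ring_def frag_extend_cmul)
    then show ?thesis by (metis single)
  qed
  have "L (proj_ring A R (formal_sum_value s)) = (\<Sum>(c, g)\<leftarrow>value_list s. of_real c * \<phi> g)"
  proof (induction s)
    case Nil
    show ?case by (simp add: formal_sum_value_def proj_ring_def L_def value_list_def)
  next
    case (Cons a s)
    obtain c w where a: "a = (c, w)" by fastforce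
    have "proj_ring A R (formal_sum_value (a # s)) = Poly_Mapping.single (word_value w) c + proj_ring A R (formal_sum_value s)"
    proof -
      have "formal_sum_value (a # s) = Poly_Mapping.single (reduce w) c + formal_sum_value s"
        by (simp add: formal_sum_value_def a)
      then have "proj_ring A R (formal_sum_value (a # s)) =
          proj_ring A R (Poly_Mapping.single (reduce w) c) + proj_ring A R (formal_sum_value s)"
        by (simp only: proj_ring_def frag_extend_add)
      then show ?thesis by (simp only: proj_single word_value_def)
    qed
    then show ?case using Cons by (simp add: L_add L_single value_list_def a)
  qed
  then show "(\<Sum>g\<in>Poly_Mapping.keys (proj_ring A R (formal_sum_value s)).
      of_int (Poly_Mapping.lookup (proj_ring A R (formal_sum_value s)) g) * \<phi> g) = (\<Sum>(c, g)\<leftarrow>value_list s. of_real c * \<phi> g)"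
    by (simp add: L_def)
qed

text \<open>Decoding discards the letters that do not code a generator, so that every list is the code of
  some word and the decision procedure is never run on an invalid input.\<close>

definition valid_part :: "nat_word \<Rightarrow> nat_word" where
  "valid_part x = filter (\<lambda>l. fst l < card A) x"

definition word_of_nat_word :: "nat_word \<Rightarrow> 'a word" where
  "word_of_nat_word x = map (\<lambda>l. (from_nat_into A (fst l), snd l)) (valid_part x)"

definition nat_word_of_word :: "'a word \<Rightarrow> nat_word" where
  "nat_word_of_word w = map (\<lambda>l. (to_nat_on A (fst l), snd l)) w"

definition nat_sum_of_sum :: "'a formal_sum \<Rightarrow> nat_sum" where
  "nat_sum_of_sum s = map (\<lambda>(c, w). (c, nat_word_of_word w)) s"

section \<open>Transfer between words over the generators and words over numbers\<close>

lemma to_nat_on_bij: "bij_betw (to_nat_on A) A {..<card A}"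
  by (rule to_nat_on_finite[OF finite_generators])

lemma encode_nat_word_of_word: "encode (nat_word_of_word w) = word_code A w"
  by (simp add: nat_word_of_word_def encode_list_def word_code_def letter_code_def[abs_def] comp_def
      encode_prod_def encode_nat_def encode_bool_def)

lemma encode_nat_sum_of_sum: "encode (nat_sum_of_sum s) = formal_sum_code A s"
  unfolding nat_sum_of_sum_def encode_list_def[of "map _ s"] formal_sum_code_def
  by (simp add: comp_def case_prod_unfold encode_prod_def encode_int_def encode_nat_word_of_word)

lemma word_of_nat_word_closed [simp]: "word_of_nat_word x \<in> words A"
proof -
  have "from_nat_into A n \<in> A" if "n < card A" for n
    using that by (intro from_nat_into) auto
  then show ?thesis by (auto simp: word_of_nat_word_def words_def valid_part_def)
qed

lemma word_of_nat_word_of_word: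
  assumes "w \<in> words A" shows "word_of_nat_word (nat_word_of_word w) = w"
proof -
  have "fst l \<in> A" if "l \<in> set w" for l using assms that by (auto simp: words_def in_lists_conv_set)
  moreover have "to_nat_on A a < card A" if "a \<in> A" for a using to_nat_on_bij that by (auto simp: bij_betw_def)
  ultimately show ?thesis
    using countable_finite[OF finite_generators]
    by (simp add: word_of_nat_word_def nat_word_of_word_def valid_part_def filter_map comp_def map_idI)
qed

lemma nat_word_of_word_of_nat_word: "nat_word_of_word (word_of_nat_word x) = valid_part x"
proof -
  have "to_nat_on A (from_nat_into A n) = n" if "n < card A" for n
    using that to_nat_on_bij by (intro to_nat_on_from_nat_into) (auto simp: bij_betw_def)
  then show ?thesis by (auto simp: word_of_nat_word_def nat_word_of_word_def valid_part_def intro!: map_idI)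
qed

lemma computable_valid_part: "computable f \<Longrightarrow> computable (\<lambda>x. valid_part (f x))"
  unfolding valid_part_def by (intro computable_intros)

lemma word_of_nat_word_append: "word_of_nat_word (x @ y) = word_of_nat_word x @ word_of_nat_word y"
  by (simp add: word_of_nat_word_def valid_part_def)

lemma word_of_nat_word_inverse:
  "word_of_nat_word (rev (map (\<lambda>l. (fst l, \<not> snd l)) x)) = inv_word (word_of_nat_word x)"
  by (simp add: word_of_nat_word_def valid_part_def inv_word_def inv_letter_def rev_map rev_filter[symmetric] filter_map comp_def)

definition nat_trivial :: "nat_word \<Rightarrow> bool" where
  "nat_trivial x \<longleftrightarrow> word_value (word_of_nat_word x) = \<one>\<^bsub>\<Gamma>\<^esub>"

text \<open>The given program is only specified on codes of words over \<open>A\<close>, so inputs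
  first pass through \<open>valid_part\<close>, which does not change the decoded word.\<close>

lemma word_problem_decidable_iff: "word_problem_decidable A R \<longleftrightarrow> computable nat_trivial"
proof
  assume "word_problem_decidable A R"
  then obtain P where P: "\<And>w. w \<in> words A \<Longrightarrow>
      run P [word_code A w] = Some (if word_value w = \<one>\<^bsub>\<Gamma>\<^esub> then 1 else 0)"
    by (auto simp: word_problem_decidable_def word_value_def)
  have "run P [encode (valid_part x)] = Some (encode (nat_trivial x))" for x
    using P[of "word_of_nat_word x"]
    by (simp add: encode_nat_word_of_word[symmetric] nat_word_of_word_of_nat_word nat_trivial_def encode_bool_def)
  moreover obtain Q where "\<And>x. run Q [encode x] = Some (encode (valid_part x))"
    using computable_valid_part[OF computable_ident] by (auto simp: computable_def)
  ultimately have "run (Comp P [Q]) [encode x] = Some (encode (nat_trivial x))" for x by simp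
  then show "computable nat_trivial" unfolding computable_def by blast
next
  assume "computable nat_trivial"
  then obtain P where P: "\<And>x. run P [encode x] = Some (encode (nat_trivial x))"
    by (auto simp: computable_def)
  have "run P [word_code A w] = Some (if word_value w = \<one>\<^bsub>\<Gamma>\<^esub> then 1 else 0)" if "w \<in> words A" for w
    using P[of "nat_word_of_word w"] that
    by (simp add: encode_nat_word_of_word nat_trivial_def word_of_nat_word_of_word encode_bool_def)
  then show "word_problem_decidable A R" unfolding word_problem_decidable_def word_value_def by blast
qed

lemma nat_same_iff:
  "nat_same nat_trivial x y \<longleftrightarrow> word_value (word_of_nat_word x) = word_value (word_of_nat_word y)"
  by (simp add: nat_same_def nat_trivial_def word_of_nat_word_append word_of_nat_word_inverse word_value_eq_iff)

end

section \<open>Computability of the norm\<close>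

definition frac_real :: "nat \<times> nat \<Rightarrow> real" where
  "frac_real a = real (fst a) / real (Suc (snd a))"

lemma frac_real_eq: "frac_real a = real_of_rat (frac_value a)"
  by (simp add: frac_real_def frac_value_def of_rat_rat)

lemma frac_less_iff: "frac_less a b \<longleftrightarrow> frac_real a < frac_real b"
proof -
  have "frac_real a < frac_real b \<longleftrightarrow> real (fst a * Suc (snd b)) < real (fst b * Suc (snd a))"
    unfolding frac_real_def of_nat_mult by (simp only: divide_less_eq eq_divide_eq less_divide_eq) (simp add: field_simps)
  then show ?thesis unfolding frac_less_def of_nat_less_iff by simp
qed

lemma exists_frac_between:
  assumes "0 \<le> r" "r < s"
  shows "\<exists>a. r < frac_real a \<and> frac_real a < s"
proof -
  obtain x where x: "x \<in> \<rat>" "r < x" "x < s" using Rats_dense_in_real[OF assms(2)] by blast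
  then obtain m n where "n \<noteq> 0" "\<bar>x\<bar> = real m / real n" by (blast elim: Rats_abs_nat_div_natE)
  then have "x = frac_real (m, n - 1)" using x assms by (simp add: frac_real_def)
  then show ?thesis using x by blast
qed

text \<open>The valuation \<open>v\<close> is arbitrary so that the running minimum is covered too,
  with \<open>v\<close> the negated fraction.\<close>

lemma rec_nat_running_max:
  fixes v :: "'a \<Rightarrow> real" and a :: 'a and P :: "nat \<Rightarrow> bool" and f :: "nat \<Rightarrow> 'a"
  defines "best \<equiv> rec_nat a (\<lambda>c b. if P c \<and> v b < v (f c) then f c else b)"
  shows "mono (\<lambda>n. v (best n))"
    and "v a \<le> L \<Longrightarrow> (\<And>c. P c \<Longrightarrow> v (f c) \<le> L) \<Longrightarrow> v (best n) \<le> L"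
    and "P c \<Longrightarrow> v (f c) \<le> v (best (Suc c))"
proof -
  have Suc: "best (Suc n) = (if P n \<and> v (best n) < v (f n) then f n else best n)" for n
    by (simp add: best_def)
  show "mono (\<lambda>n. v (best n))" by (rule incseq_SucI) (simp add: Suc)
  show "v (best n) \<le> L" if "v a \<le> L" "\<And>c. P c \<Longrightarrow> v (f c) \<le> L"
    using that by (induction n) (auto simp: Suc, simp add: best_def)
  show "v (f c) \<le> v (best (Suc c))" if "P c" using that by (simp add: Suc)
qed

lemma SUP_eq_if_approximated:
  fixes f :: "nat \<Rightarrow> real"
  assumes le: "\<And>n. f n \<le> L" and approx: "\<And>r. r < L \<Longrightarrow> \<exists>n. r \<le> f n"
  shows "bdd_above (range f)" "(SUP n. f n) = L"
proof -
  show bdd: "bdd_above (range f)" using le by (intro bdd_aboveI2) auto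
  show "(SUP n. f n) = L"
  proof (rule antisym)
    show "(SUP n. f n) \<le> L" using le by (intro cSUP_least) auto
    show "L \<le> (SUP n. f n)"
    proof (rule dense_le)
      fix r assume "r < L"
      then obtain n where "r \<le> f n" using approx by blast
      also have "f n \<le> (SUP n. f n)" by (rule cSUP_upper[OF _ bdd]) simp
      finally show "r \<le> (SUP n. f n)" .
    qed
  qed
qed

lemma INF_eq_if_approximated:
  fixes f :: "nat \<Rightarrow> real"
  assumes ge: "\<And>n. L \<le> f n" and approx: "\<And>r. L < r \<Longrightarrow> \<exists>n. f n \<le> r"
  shows "bdd_below (range f)" "(INF n. f n) = L"
proof -
  show bdd: "bdd_below (range f)" using ge by (intro bdd_belowI2) auto
  show "(INF n. f n) = L"
  proof (rule antisym)
    show "L \<le> (INF n. f n)" using ge by (intro cINF_greatest) auto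
    show "(INF n. f n) \<le> L"
    proof (rule dense_ge)
      fix r assume "L < r"
      then obtain n where "f n \<le> r" using approx by blast
      moreover have "(INF n. f n) \<le> f n" by (rule cINF_lower[OF bdd]) simp
      ultimately show "(INF n. f n) \<le> r" by linarith
    qed
  qed
qed

lemma lower_bound_real_iff:
  fixes n p q S m :: nat
  shows "n * p ^ m \<le> S * Suc q ^ m \<longleftrightarrow> real n * frac_real (p, q) ^ m \<le> real S"
proof -
  have "n * p ^ m \<le> S * Suc q ^ m \<longleftrightarrow> real n * real p ^ m \<le> real S * real (Suc q) ^ m"
    by (simp only: of_nat_le_iff[where 'a = real, symmetric] of_nat_mult of_nat_power)
  also have "\<dots> \<longleftrightarrow> real n * real p ^ m / real (Suc q) ^ m \<le> real S"
    by (rule pos_divide_le_eq[symmetric]) simp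
  finally show ?thesis by (simp only: frac_real_def fst_conv snd_conv power_divide times_divide_eq_right)
qed

lemma upper_bound_real_iff:
  fixes n p q S D m :: nat
  assumes "0 < n"
  shows "D * Suc q \<le> p * n \<and> S * (n * Suc q) ^ m \<le> (p * n - D * Suc q) ^ m \<longleftrightarrow>
    real D / real n \<le> frac_real (p, q) \<and> real S \<le> (frac_real (p, q) - real D / real n) ^ m"
proof -
  have nq: "0 < real n * real (Suc q)" using assms by simp
  have "D * Suc q \<le> p * n \<longleftrightarrow> real D * real (Suc q) \<le> real p * real n"
    by (simp only: of_nat_le_iff[where 'a = real, symmetric] of_nat_mult)
  also have "\<dots> \<longleftrightarrow> real D / real n \<le> frac_real (p, q)"
    using assms by (simp only: frac_real_def fst_conv snd_conv) (simp add: field_simps)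
  finally have 1: "D * Suc q \<le> p * n \<longleftrightarrow> real D / real n \<le> frac_real (p, q)" .
  \<comment> \<open>Under the first conjunct, subtraction of naturals agrees with subtraction of
    reals.\<close>
  have "S * (n * Suc q) ^ m \<le> (p * n - D * Suc q) ^ m \<longleftrightarrow> real S \<le> (frac_real (p, q) - real D / real n) ^ m"
    if le: "D * Suc q \<le> p * n"
  proof -
    have "S * (n * Suc q) ^ m \<le> (p * n - D * Suc q) ^ m \<longleftrightarrow>
        real S * (real n * real (Suc q)) ^ m \<le> (real p * real n - real D * real (Suc q)) ^ m"
      by (simp only: of_nat_le_iff[where 'a = real, symmetric] of_nat_mult of_nat_power of_nat_diff[OF le])
    also have "\<dots> \<longleftrightarrow> real S \<le> (real p * real n - real D * real (Suc q)) ^ m / (real n * real (Suc q)) ^ m"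
      using nq by (simp only: pos_le_divide_eq zero_less_power)
    also have "(real p * real n - real D * real (Suc q)) ^ m / (real n * real (Suc q)) ^ m =
        ((real p * real n - real D * real (Suc q)) / (real n * real (Suc q))) ^ m"
      by (rule power_divide[symmetric])
    also have "(real p * real n - real D * real (Suc q)) / (real n * real (Suc q)) = frac_real (p, q) - real D / real n"
      using assms by (simp only: frac_real_def fst_conv snd_conv) (simp add: field_simps del: of_nat_Suc)
    finally show ?thesis .
  qed
  with 1 show ?thesis by blast
qed

section \<open>Meaning of the certificates in the presented group\<close>

context presentation
begin

definition nat_value :: "nat_word \<Rightarrow> 'a word set" where
  "nat_value x = word_value (word_of_nat_word x)"

definition nat_value_list :: "nat_sum \<Rightarrow> (real \<times> 'a word set) list" where
  "nat_value_list s = map (\<lambda>y. (real_of_int (fst y), nat_value (snd y))) s"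

lemma nat_value_closed [simp]: "nat_value x \<in> carrier \<Gamma>"
  by (simp add: nat_value_def)

lemma nat_value_append: "nat_value (x @ y) = nat_value x \<otimes>\<^bsub>\<Gamma>\<^esub> nat_value y"
  by (simp add: nat_value_def word_of_nat_word_append word_value_append)

lemma nat_same_iff_nat_value: "nat_same nat_trivial x y \<longleftrightarrow> nat_value x = nat_value y"
  by (simp add: nat_same_iff nat_value_def)

lemma nat_value_list_nat_sum_of_sum:
  "s \<in> formal_sums A \<Longrightarrow> nat_value_list (nat_sum_of_sum s) = value_list s"
  by (auto simp: nat_value_list_def nat_sum_of_sum_def value_list_def nat_value_def formal_sums_def
      in_lists_conv_set word_of_nat_word_of_word)

lemma nat_value_list_closed: "snd ` set (nat_value_list s) \<subseteq> carrier \<Gamma>"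
  by (auto simp: nat_value_list_def)

lemma nat_kernel_eq:
  assumes "i < length fs" "j < length fs"
  shows "real_of_int (nat_kernel nat_trivial s fs i j) =
    conv_kernel \<Gamma> (nat_value_list s) (map nat_value fs ! i) (map nat_value fs ! j)"
  by (induction s)
    (use assms in \<open>auto simp: nat_kernel_def nat_value_list_def nat_same_iff_nat_value nth_default_def nat_value_append\<close>)

lemma nat_power_norm_eq_conv_power_norm:
  "real_of_int (nat_power_norm nat_trivial s fs k) =
    \<Gamma>.conv_power_norm (nat_value_list s) (map nat_value fs) k"
  unfolding nat_power_norm_eq gram_power_norm_of_int[symmetric] \<Gamma>.conv_power_norm_def length_map
  by (rule gram_power_norm_cong) (simp add: nat_kernel_eq)

lemma nat_nat_power_norm:
  "real (nat (nat_power_norm nat_trivial s fs k)) = \<Gamma>.conv_power_norm (nat_value_list s) (map nat_value fs) k"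
proof -
  have "0 \<le> nat_power_norm nat_trivial s fs k" by (simp add: nat_power_norm_def sum_nonneg)
  then show ?thesis by (simp add: nat_power_norm_eq_conv_power_norm[symmetric])
qed

lemma nat_distinct_iff: "nat_distinct nat_trivial fs \<longleftrightarrow> distinct (map nat_value fs)"
  by (auto simp: nat_distinct_def distinct_conv_nth nat_same_iff_nat_value nth_default_def)

lemma nat_defect_eq:
  assumes "distinct (map nat_value fs)" "fs \<noteq> []"
  shows "real_of_int (nat_defect nat_trivial s fs) =
    length fs * folner_defect \<Gamma> (nat_value_list s) (set (map nat_value fs))"
proof -
  let ?gs = "map nat_value fs"
  let ?F = "set ?gs"
  have card: "card ?F = length fs" using assms distinct_card by fastforce
  have mem: "y \<in> ?F \<longleftrightarrow> (\<exists>i<length fs. nat_value (fs ! i) = y)" for y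
    unfolding in_set_conv_nth by (simp cong: conj_cong)
  have count: "(\<Sum>j<length fs. if \<forall>i<length fs. \<not> nat_same nat_trivial (nth_default [] fs i) (x @ nth_default [] fs j) then 1 else 0)
      = int (card {y \<in> ?F. nat_value x \<otimes>\<^bsub>\<Gamma>\<^esub> y \<notin> ?F})" for x
  proof -
    have "(\<Sum>j<length fs. if \<forall>i<length fs. \<not> nat_same nat_trivial (nth_default [] fs i) (x @ nth_default [] fs j) then 1 else 0)
        = (\<Sum>j<length fs. if nat_value x \<otimes>\<^bsub>\<Gamma>\<^esub> ?gs ! j \<notin> ?F then 1 else (0 :: int))"
    proof (intro sum.cong refl)
      fix j assume "j \<in> {..<length fs}"
      then have "(\<forall>i<length fs. \<not> nat_same nat_trivial (nth_default [] fs i) (x @ nth_default [] fs j)) \<longleftrightarrow>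
          nat_value x \<otimes>\<^bsub>\<Gamma>\<^esub> ?gs ! j \<notin> ?F"
        by (simp add: mem nat_same_iff_nat_value nth_default_def nat_value_append del: set_map)
      then show "(if \<forall>i<length fs. \<not> nat_same nat_trivial (nth_default [] fs i) (x @ nth_default [] fs j) then 1 else 0)
        = (if nat_value x \<otimes>\<^bsub>\<Gamma>\<^esub> ?gs ! j \<notin> ?F then 1 else (0 :: int))" by simp
    qed
    also have "\<dots> = (\<Sum>j<length ?gs. if nat_value x \<otimes>\<^bsub>\<Gamma>\<^esub> ?gs ! j \<notin> ?F then 1 else (0 :: int))" by simp
    \<comment> \<open>Distinctness makes list positions correspond to elements of \<open>?F\<close>,
      so counting positions counts elements.\<close>
    also have "\<dots> = (\<Sum>y\<in>?F. if nat_value x \<otimes>\<^bsub>\<Gamma>\<^esub> y \<notin> ?F then 1 else (0 :: int))"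
      using bij_betw_nth[OF assms(1) refl refl] by (rule sum.reindex_bij_betw)
    also have "\<dots> = int (card {y \<in> ?F. nat_value x \<otimes>\<^bsub>\<Gamma>\<^esub> y \<notin> ?F})"
      by (simp only: sum.If_cases[OF finite_set] sum_constant) (simp add: Int_def)
    finally show ?thesis .
  qed
  show ?thesis
    unfolding nat_defect_def count folner_defect_def card
  proof (induction s)
    case (Cons y s)
    then show ?case using assms(2)
      by (simp add: nat_value_list_def distrib_left)
  qed (simp add: nat_value_list_def)
qed

lemma nat_nat_defect:
  assumes "distinct (map nat_value fs)" "fs \<noteq> []"
  shows "real (nat (nat_defect nat_trivial s fs)) / real (length fs) =
    folner_defect \<Gamma> (nat_value_list s) (set (map nat_value fs))"
proof -
  note eq = nat_defect_eq[OF assms, of s]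
  have "0 \<le> real_of_int (nat_defect nat_trivial s fs)"
    unfolding eq by (intro mult_nonneg_nonneg folner_defect_nonneg) simp
  then have "real (nat (nat_defect nat_trivial s fs)) = real_of_int (nat_defect nat_trivial s fs)" by simp
  then show ?thesis using assms(2) by (simp add: eq)
qed

lemma lower_cert_iff:
  "lower_cert nat_trivial s (w, k, a) \<longleftrightarrow> (let gs = map nat_value (cert_words (w, k, a)) in
    gs \<noteq> [] \<and> distinct gs \<and> length gs * frac_real a ^ (4 * Suc k) \<le> \<Gamma>.conv_power_norm (nat_value_list s) gs (Suc k))"
  by (cases a) (simp only: lower_cert_def nat_distinct_iff lower_bound_real_iff nat_nat_power_norm fst_conv snd_conv
      Let_def length_map map_is_Nil_conv)

lemma upper_cert_iff:
  "upper_cert nat_trivial s (w, k, a) \<longleftrightarrow> (let gs = map nat_value (cert_words (w, k, a)); d = folner_defect \<Gamma> (nat_value_list s) (set gs) in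
    gs \<noteq> [] \<and> distinct gs \<and> d \<le> frac_real a \<and> \<Gamma>.conv_power_norm (nat_value_list s) gs (Suc k) \<le> (frac_real a - d) ^ (4 * Suc k))"
proof (cases "cert_words (w, k, a) \<noteq> [] \<and> distinct (map nat_value (cert_words (w, k, a)))")
  case True
  obtain p q where a: "a = (p, q)" by fastforce
  from True have "0 < length (cert_words (w, k, a))" by simp
  from True show ?thesis
    unfolding a upper_cert_def nat_distinct_iff fst_conv snd_conv Let_def
      upper_bound_real_iff[OF \<open>0 < length (cert_words (w, k, a))\<close>[unfolded a]]
    by (simp add: nat_nat_defect nat_nat_power_norm)
qed (auto simp: upper_cert_def nat_distinct_iff)

lemma exists_cert_words:
  assumes "set gs \<subseteq> carrier \<Gamma>"
  shows "\<exists>w. map nat_value (cert_words (w, ka)) = gs"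
proof -
  have "\<exists>x. nat_value (map (\<lambda>l. (fst l, snd l = (0 :: nat))) x) = g" if g: "g \<in> carrier \<Gamma>" for g
  proof -
    obtain u where u: "u \<in> words A" "g = word_value u" using g unfolding carrier_eq by blast
    \<comment> \<open>\<open>cert_words\<close> reads 0 as the sign \<open>True\<close>, hence the
      negation.\<close>
    have "map (\<lambda>l. (fst l, snd l = (0 :: nat))) (map (\<lambda>l. (fst l, of_bool (\<not> snd l))) (nat_word_of_word u)) = nat_word_of_word u"
      by (simp add: comp_def map_idI)
    then have "nat_value (map (\<lambda>l. (fst l, snd l = (0 :: nat))) (map (\<lambda>l. (fst l, of_bool (\<not> snd l))) (nat_word_of_word u))) = g"
      by (simp only: nat_value_def word_of_nat_word_of_word[OF u(1)] u(2))
    then show ?thesis by blast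
  qed
  then obtain x where x: "\<And>g. g \<in> carrier \<Gamma> \<Longrightarrow> nat_value (map (\<lambda>l. (fst l, snd l = (0 :: nat))) (x g)) = g" by metis
  have "map nat_value (cert_words (map x gs, ka)) = gs"
    using assms x by (auto simp: cert_words_def intro!: map_idI)
  then show ?thesis by blast
qed

section \<open>Soundness and completeness of the enumeration\<close>

context
  fixes s :: nat_sum and a :: "'a word set \<Rightarrow>\<^sub>0 int"
  assumes rep: "represents (nat_value_list s) a"
begin

lemma nat_value_set: "set (map nat_value fs) \<subseteq> carrier \<Gamma>"
  by auto

lemma lower_cert_sound:
  assumes "lower_cert nat_trivial s z"
  shows "frac_real (snd (snd z)) \<le> lambda_norm \<Gamma> a"
proof -
  obtain w k b where z: "z = (w, k, b)" by (metis prod.exhaust)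
  have "0 \<le> frac_real b" by (simp add: frac_real_def)
  with assms show ?thesis
    unfolding z lower_cert_iff Let_def fst_conv snd_conv
    by (intro \<Gamma>.lambda_norm_ge_conv_power_norm[OF rep nat_value_list_closed _ nat_value_set, of "cert_words (w, k, b)" _ k]) auto
qed

lemma upper_cert_sound:
  assumes "upper_cert nat_trivial s z"
  shows "lambda_norm \<Gamma> a \<le> frac_real (snd (snd z))"
proof -
  obtain w k b where z: "z = (w, k, b)" by (metis prod.exhaust)
  let ?gs = "map nat_value (cert_words (w, k, b))"
  let ?d = "folner_defect \<Gamma> (nat_value_list s) (set ?gs)"
  \<comment> \<open>The certificate bounds the compression by its fraction minus the defect;
    averaging gives the defect back.\<close>
  have "lambda_norm \<Gamma> a \<le> (frac_real b - ?d) + ?d"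
    using assms unfolding z upper_cert_iff Let_def
    by (intro \<Gamma>.lambda_norm_le_conv_power_norm[OF rep nat_value_list_closed _ nat_value_set, of _ _ k]) auto
  then show ?thesis by (simp add: z)
qed

lemma best_lower_le: "frac_real (best_lower nat_trivial s n) \<le> lambda_norm \<Gamma> a"
  unfolding best_lower_def frac_less_iff
  by (rule rec_nat_running_max(2)[where v = frac_real])
     (auto simp: lower_cert_sound frac_real_def[of "(0, 0)"] \<Gamma>.lambda_norm_nonneg[OF rep nat_value_list_closed])

lemma mono_best_lower: "mono (\<lambda>n. frac_real (best_lower nat_trivial s n))"
  unfolding best_lower_def frac_less_iff
  by (rule rec_nat_running_max(1)[where v = frac_real])

lemma best_lower_ge:
  assumes "lower_cert nat_trivial s z"
  shows "frac_real (snd (snd z)) \<le> frac_real (best_lower nat_trivial s (Suc (encode z)))"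
  unfolding best_lower_def frac_less_iff
  using rec_nat_running_max(3)[where v = frac_real and P = "\<lambda>c. lower_cert nat_trivial s (cert_of_nat c)"
      and f = "\<lambda>c. snd (snd (cert_of_nat c))" and c = "encode z"] assms by simp

lemma lambda_norm_le_l1_norm: "lambda_norm \<Gamma> a \<le> l1_norm (nat_value_list s)"
  by (intro \<Gamma>.lambda_norm_le[OF rep nat_value_list_closed] l1_norm_nonneg
      \<Gamma>.bounded_form_conv_kernel_l1 nat_value_list_closed)

lemma l1_norm_eq: "frac_real (nat (\<Sum>y\<leftarrow>s. if fst y < 0 then - fst y else fst y), 0) = l1_norm (nat_value_list s)"
proof -
  have "real_of_int (\<Sum>y\<leftarrow>t. if fst y < 0 then - fst y else fst y) = l1_norm (nat_value_list t)" for t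
    by (induction t) (auto simp: nat_value_list_def)
  moreover have "0 \<le> (\<Sum>y\<leftarrow>s. if fst y < 0 then - fst y else fst y)"
    by (intro sum_list_nonneg) auto
  ultimately show ?thesis by (simp add: frac_real_def)
qed

lemma best_upper_ge: "lambda_norm \<Gamma> a \<le> frac_real (best_upper nat_trivial s n)"
  using rec_nat_running_max(2)[where v = "\<lambda>b. - frac_real b" and L = "- lambda_norm \<Gamma> a"
      and P = "\<lambda>c. upper_cert nat_trivial s (cert_of_nat c)" and f = "\<lambda>c. snd (snd (cert_of_nat c))"
      and a = "(nat (\<Sum>y\<leftarrow>s. if fst y < 0 then - fst y else fst y), 0)" and n = n]
    lambda_norm_le_l1_norm upper_cert_sound
  by (simp add: best_upper_def frac_less_iff l1_norm_eq)

lemma antimono_best_upper: "antimono (\<lambda>n. frac_real (best_upper nat_trivial s n))"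
  using rec_nat_running_max(1)[where v = "\<lambda>b. - frac_real b"
      and P = "\<lambda>c. upper_cert nat_trivial s (cert_of_nat c)" and f = "\<lambda>c. snd (snd (cert_of_nat c))"
      and a = "(nat (\<Sum>y\<leftarrow>s. if fst y < 0 then - fst y else fst y), 0)"]
  by (simp add: best_upper_def frac_less_iff mono_def antimono_def)

lemma best_upper_le:
  assumes "upper_cert nat_trivial s z"
  shows "frac_real (best_upper nat_trivial s (Suc (encode z))) \<le> frac_real (snd (snd z))"
  using rec_nat_running_max(3)[where v = "\<lambda>b. - frac_real b"
      and P = "\<lambda>c. upper_cert nat_trivial s (cert_of_nat c)" and f = "\<lambda>c. snd (snd (cert_of_nat c))"
      and a = "(nat (\<Sum>y\<leftarrow>s. if fst y < 0 then - fst y else fst y), 0)" and c = "encode z"] assms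
  by (simp add: best_upper_def frac_less_iff del: old.nat.rec)

lemma best_lower_approximates:
  assumes amenable: "amenable \<Gamma>" and "r < lambda_norm \<Gamma> a"
  shows "\<exists>n. r \<le> frac_real (best_lower nat_trivial s n)"
proof (cases "0 \<le> r")
  case True
  \<comment> \<open>A certificate carries a fraction, so \<open>r\<close> is first replaced by one
    strictly between it and the norm.\<close>
  obtain b where b: "r < frac_real b" "frac_real b < lambda_norm \<Gamma> a"
    using exists_frac_between[OF True assms(2)] by blast
  then obtain gs k where gs: "distinct gs" "set gs \<subseteq> carrier \<Gamma>" "gs \<noteq> []"
    "length gs * frac_real b ^ (4 * Suc k) \<le> \<Gamma>.conv_power_norm (nat_value_list s) gs (Suc k)"
    using \<Gamma>.exists_conv_power_norm_ge[OF amenable rep nat_value_list_closed _ b(2)] True by auto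
  obtain w where w: "map nat_value (cert_words (w, k, b)) = gs" using exists_cert_words[OF gs(2)] by blast
  have "lower_cert nat_trivial s (w, k, b)" unfolding lower_cert_iff w Let_def using gs by simp
  from best_lower_ge[OF this] b(1)
  have "r \<le> frac_real (best_lower nat_trivial s (Suc (encode (w, k, b))))" by simp
  then show ?thesis by blast
next
  case False
  \<comment> \<open>For negative \<open>r\<close> the start value 0 is enough.\<close>
  then show ?thesis by (intro exI[of _ 0]) (simp add: best_lower_def frac_real_def)
qed

lemma best_upper_approximates:
  assumes amenable: "amenable \<Gamma>" and "lambda_norm \<Gamma> a < r"
  shows "\<exists>n. frac_real (best_upper nat_trivial s n) \<le> r"
proof -
  obtain b where b: "lambda_norm \<Gamma> a < frac_real b" "frac_real b < r"
    using exists_frac_between[OF \<Gamma>.lambda_norm_nonneg[OF rep nat_value_list_closed] assms(2)] by blast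
  then obtain gs k where gs: "distinct gs" "set gs \<subseteq> carrier \<Gamma>" "gs \<noteq> []"
    "folner_defect \<Gamma> (nat_value_list s) (set gs) \<le> frac_real b"
    "\<Gamma>.conv_power_norm (nat_value_list s) gs (Suc k) \<le> (frac_real b - folner_defect \<Gamma> (nat_value_list s) (set gs)) ^ (4 * Suc k)"
    using \<Gamma>.exists_conv_power_norm_le[OF amenable rep nat_value_list_closed b(1)] by auto
  obtain w where w: "map nat_value (cert_words (w, k, b)) = gs" using exists_cert_words[OF gs(2)] by blast
  have "upper_cert nat_trivial s (w, k, b)" unfolding upper_cert_iff w Let_def using gs by simp
  from best_upper_le[OF this] b(2)
  have "frac_real (best_upper nat_trivial s (Suc (encode (w, k, b)))) \<le> r" by simp
  then show ?thesis by blast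
qed

end

lemma group_ring_computable_if_word_problem_decidable:
  assumes amenable: "amenable \<Gamma>" and decidable: "word_problem_decidable A R"
  shows "group_ring_computable A R (lambda_norm \<Gamma>)"
proof -
  let ?lo = "best_lower nat_trivial" and ?up = "best_upper nat_trivial"
  have triv: "computable nat_trivial" using decidable by (simp add: word_problem_decidable_iff)
  \<comment> \<open>Two pairs of integers, each coded as \<open>nat_to_rat_surj\<close> expects;
    denominators are successors, hence nonzero.\<close>
  define out where "out x = ((int (fst (?lo (fst x) (snd x))), int (Suc (snd (?lo (fst x) (snd x))))),
     (int (fst (?up (fst x) (snd x))), int (Suc (snd (?up (fst x) (snd x))))))" for x :: "nat_sum \<times> nat"
  have "computable out"
    unfolding out_def[abs_def] by (intro computable_intros computable_best_lower[OF triv] computable_best_upper[OF triv])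
  then obtain P where P: "\<And>s n. run P [encode (s, n)] = Some (encode (out (s, n)))"
    by (auto simp: computable_def)
  obtain E where E: "\<And>xs. length xs = 2 \<Longrightarrow> run E xs = Some (prod_encode (xs ! 0, xs ! 1))"
    using rec_computable2_prod_encode by (auto simp: rec_computable2_def rec_computable_def)
  have run: "run (Comp P [Comp E [Proj 0, Proj 1]]) [formal_sum_code A s, n] = Some (encode (out (nat_sum_of_sum s, n)))" for s n
    using P[of "nat_sum_of_sum s" n] by (simp add: E encode_prod_def encode_nat_def encode_nat_sum_of_sum)
  have decode: "nat_to_rat_surj (encode (int (fst b), int (Suc (snd b)))) = frac_value b" for b
    unfolding nat_to_rat_surj_def encode_prod_def encode_int_def frac_value_def by simp
  show ?thesis
    unfolding group_ring_computable_def
  proof (intro exI ballI conjI allI)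
    fix s assume s: "s \<in> formal_sums A"
    let ?s = "nat_sum_of_sum s" and ?N = "lambda_norm \<Gamma> (proj_ring A R (formal_sum_value s))"
    have rep: "represents (nat_value_list ?s) (proj_ring A R (formal_sum_value s))"
      using represents_value_list[of s] by (simp add: nat_value_list_nat_sum_of_sum[OF s])
    show "run (Comp P [Comp E [Proj 0, Proj 1]]) [formal_sum_code A s, n] = Some (prod_encode
        (encode (int (fst (?lo ?s n)), int (Suc (snd (?lo ?s n)))), encode (int (fst (?up ?s n)), int (Suc (snd (?up ?s n))))))" for n
      unfolding run out_def by (simp add: encode_prod_def)
    show "nat_to_rat_surj (encode (int (fst (?lo ?s n)), int (Suc (snd (?lo ?s n))))) = frac_value (?lo ?s n)" for n
      by (rule decode)
    show "nat_to_rat_surj (encode (int (fst (?up ?s n)), int (Suc (snd (?up ?s n))))) = frac_value (?up ?s n)" for n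
      by (rule decode)
    show "mono (\<lambda>n. frac_value (?lo ?s n))"
      using mono_best_lower[OF rep] by (simp add: mono_def frac_real_eq of_rat_less_eq)
    show "antimono (\<lambda>n. frac_value (?up ?s n))"
      using antimono_best_upper[OF rep] by (simp add: antimono_def frac_real_eq of_rat_less_eq)
    note sup = SUP_eq_if_approximated[where f = "\<lambda>n. frac_real (?lo ?s n)", OF best_lower_le[OF rep] best_lower_approximates[OF rep amenable]]
    note inf = INF_eq_if_approximated[where f = "\<lambda>n. frac_real (?up ?s n)", OF best_upper_ge[OF rep] best_upper_approximates[OF rep amenable]]
    show "bdd_above (range (\<lambda>n. real_of_rat (frac_value (?lo ?s n))))" "(SUP n. real_of_rat (frac_value (?lo ?s n))) = ?N"
      using sup by (simp_all add: frac_real_eq)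
    show "bdd_below (range (\<lambda>n. real_of_rat (frac_value (?up ?s n))))" "(INF n. real_of_rat (frac_value (?up ?s n))) = ?N"
      using inf by (simp_all add: frac_real_eq)
  qed
qed

end

text \<open>Multiplying by \<open>y * y\<close> instead of \<open>y\<close> covers negative
  denominators, which a given algorithm may produce.\<close>

lemma less_fraction_iff:
  fixes x y :: int
  assumes "y \<noteq> 0"
  shows "real_of_int x / real_of_int y < 1 \<longleftrightarrow> x * y < y * y"
    and "1 / 2 < real_of_int x / real_of_int y \<longleftrightarrow> y * y < 2 * x * y"
proof -
  have y: "0 < real_of_int y * real_of_int y" using assms by (metis not_real_square_gt_zero of_int_eq_0_iff)
  have eq: "real_of_int x / real_of_int y = (real_of_int x * real_of_int y) / (real_of_int y * real_of_int y)"
    using assms by simp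
  have "real_of_int x / real_of_int y < 1 \<longleftrightarrow> real_of_int (x * y) < real_of_int (y * y)"
    unfolding eq pos_divide_less_eq[OF y] by simp
  then show "real_of_int x / real_of_int y < 1 \<longleftrightarrow> x * y < y * y" by (simp only: of_int_less_iff)
  have "1 / 2 < real_of_int x / real_of_int y \<longleftrightarrow> real_of_int (y * y) < real_of_int (2 * x * y)"
    unfolding eq pos_less_divide_eq[OF y] by (simp add: field_simps)
  then show "1 / 2 < real_of_int x / real_of_int y \<longleftrightarrow> y * y < 2 * x * y" by (simp only: of_int_less_iff)
qed

section \<open>Deciding the word problem from the norm\<close>

context presentation
begin

text \<open>Stands for \<open>1 - x\<close>. Invalid letters are removed so that the sum comes from
  words over \<open>A\<close>, where the algorithm for the norm is specified.\<close>

definition difference_sum :: "nat_word \<Rightarrow> nat_sum" where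
  "difference_sum x = [(1, []), (- 1, valid_part x)]"

text \<open>For trivial \<open>x\<close> the two terms of the kernel cancel. Otherwise the
  compression to the unit element is the 1-by-1 matrix with entry 1.\<close>

lemma lambda_norm_difference:
  assumes "represents (nat_value_list (difference_sum x)) a"
  shows "nat_trivial x \<Longrightarrow> lambda_norm \<Gamma> a \<le> 0" and "\<not> nat_trivial x \<Longrightarrow> 1 \<le> lambda_norm \<Gamma> a"
proof -
  have "nat_value [] = \<one>\<^bsub>\<Gamma>\<^esub>"
    by (simp add: nat_value_def word_of_nat_word_def valid_part_def word_value_Nil)
  moreover have "nat_value (valid_part x) = nat_value x"
    by (simp add: nat_value_def word_of_nat_word_def valid_part_def)
  ultimately have list: "nat_value_list (difference_sum x) = [(1, \<one>\<^bsub>\<Gamma>\<^esub>), (- 1, nat_value x)]"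
    by (simp add: nat_value_list_def difference_sum_def)
  have triv: "nat_trivial x \<longleftrightarrow> nat_value x = \<one>\<^bsub>\<Gamma>\<^esub>" by (simp add: nat_trivial_def nat_value_def)
  show "lambda_norm \<Gamma> a \<le> 0" if "nat_trivial x"
    by (rule \<Gamma>.lambda_norm_le[OF assms nat_value_list_closed])
       (use that in \<open>simp_all add: list triv bounded_form_def\<close>)
  show "1 \<le> lambda_norm \<Gamma> a" if "\<not> nat_trivial x"
  proof -
    have "bounded_form {\<one>\<^bsub>\<Gamma>\<^esub>} (conv_kernel \<Gamma> (nat_value_list (difference_sum x))) (lambda_norm \<Gamma> a)"
      by (rule \<Gamma>.bounded_form_lambda_norm[OF assms nat_value_list_closed]) auto
    from this[unfolded bounded_form_def, rule_format, of "\<lambda>_. 1" "\<lambda>_. 1"] show ?thesis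
      using that by (auto simp: list triv L2_set_def)
  qed
qed

text \<open>The norm of \<open>1 - x\<close> is 0 or at least 1, so some upper approximation falls
  below 1 or some lower one exceeds 1/2; an unbounded search waits for the first such event.\<close>

lemma word_problem_decidable_if_group_ring_computable:
  assumes "group_ring_computable A R (lambda_norm \<Gamma>)"
  shows "word_problem_decidable A R"
proof -
  obtain P where P': "\<forall>s\<in>formal_sums A. \<exists>p q :: nat \<Rightarrow> rat.
        (\<forall>n. \<exists>i j. run P [formal_sum_code A s, n] = Some (prod_encode (i, j)) \<and>
                   nat_to_rat_surj i = p n \<and> nat_to_rat_surj j = q n) \<and>
        mono p \<and> antimono q \<and>
        bdd_above (range (\<lambda>n. real_of_rat (p n))) \<and>
        bdd_below (range (\<lambda>n. real_of_rat (q n))) \<and>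
        (SUP n. real_of_rat (p n)) = lambda_norm \<Gamma> (proj_ring A R (formal_sum_value s)) \<and>
        (INF n. real_of_rat (q n)) = lambda_norm \<Gamma> (proj_ring A R (formal_sum_value s))"
    using assms unfolding group_ring_computable_def by (rule exE)
  note P = bspec[OF P']
  define s where "s x = [(1, []), (- 1 :: int, word_of_nat_word x)]" for x
  define N where "N x = lambda_norm \<Gamma> (proj_ring A R (formal_sum_value (s x)))" for x
  have s: "s x \<in> formal_sums A" for x
    using word_of_nat_word_closed[of x] by (simp add: s_def formal_sums_def) (simp add: words_def)
  have sum: "nat_sum_of_sum (s x) = difference_sum x" for x
    using nat_word_of_word_of_nat_word[of x]
    by (simp add: s_def nat_sum_of_sum_def difference_sum_def) (simp add: nat_word_of_word_def)
  have rep: "represents (nat_value_list (difference_sum x)) (proj_ring A R (formal_sum_value (s x)))" for x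
    using represents_value_list[of "s x"] by (simp add: nat_value_list_nat_sum_of_sum[OF s, symmetric] sum)
  \<comment> \<open>The coding of quadruples of integers is bijective, so every output number can be
    read as one.\<close>
  have "\<exists>z :: (int \<times> int) \<times> (int \<times> int). run P [formal_sum_code A (s x), n] = Some (encode z)" for x n
  proof -
    obtain i where "run P [formal_sum_code A (s x), n] = Some i" using P[OF s, of x] by blast
    moreover have "surj (encode :: (int \<times> int) \<times> (int \<times> int) \<Rightarrow> nat)"
      by (intro surj_encode_prod surj_encode_int)
    then obtain z :: "(int \<times> int) \<times> (int \<times> int)" where "i = encode z" by (metis surjD)
    ultimately show ?thesis by blast
  qed
  then obtain out :: "nat_word \<Rightarrow> nat \<Rightarrow> (int \<times> int) \<times> (int \<times> int)"
    where out: "\<And>x n. run P [formal_sum_code A (s x), n] = Some (encode (out x n))" by metis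
  define val where "val b = real_of_rat (Fract (fst b) (snd b))" for b
  have approx: "val (fst (out x n)) \<le> N x" "N x \<le> val (snd (out x n))"
    "r < N x \<Longrightarrow> \<exists>n. r < val (fst (out x n))" "N x < r \<Longrightarrow> \<exists>n. val (snd (out x n)) < r" for x n r
  proof -
    obtain p q :: "nat \<Rightarrow> rat" where pq: "\<And>n. \<exists>i j. run P [formal_sum_code A (s x), n] = Some (prod_encode (i, j)) \<and>
                   nat_to_rat_surj i = p n \<and> nat_to_rat_surj j = q n"
      and p: "bdd_above (range (\<lambda>n. real_of_rat (p n)))" "(SUP n. real_of_rat (p n)) = N x"
      and q: "bdd_below (range (\<lambda>n. real_of_rat (q n)))" "(INF n. real_of_rat (q n)) = N x"
      using P[OF s, of x] unfolding N_def by blast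
    have val: "val (fst (out x n)) = real_of_rat (p n) \<and> val (snd (out x n)) = real_of_rat (q n)" for n
    proof -
      obtain i j where ij: "run P [formal_sum_code A (s x), n] = Some (prod_encode (i, j))"
        "nat_to_rat_surj i = p n" "nat_to_rat_surj j = q n" using pq by blast
      have "i = encode (fst (out x n))" "j = encode (snd (out x n))"
        using ij(1) out[of x n] by (simp_all add: encode_prod_def[of "out x n"])
      then show ?thesis using ij(2,3)
        by (simp add: val_def nat_to_rat_surj_def encode_prod_def encode_int_def)
    qed
    show "val (fst (out x n)) \<le> N x" using cSUP_upper[OF _ p(1), of n] val p(2) by simp
    show "N x \<le> val (snd (out x n))" using cINF_lower[OF q(1), of n] val q(2) by simp
    show "\<exists>n. r < val (fst (out x n))" if "r < N x"
      using that less_cSUP_iff[OF _ p(1), of r] p(2) val by auto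
    show "\<exists>n. val (snd (out x n)) < r" if "N x < r"
      using that cINF_less_iff[OF _ q(1), of r] q(2) val by auto
  qed
  have "computable (\<lambda>z. out (fst z) (snd z))"
  proof -
    have "computable difference_sum"
      unfolding difference_sum_def[abs_def] by (intro computable_intros computable_valid_part)
    then have "computable (\<lambda>z :: nat_word \<times> nat. difference_sum (fst z))"
      by (rule computable_comp) (intro computable_intros)
    then obtain Q where Q: "\<And>z :: nat_word \<times> nat. run Q [encode z] = Some (encode (difference_sum (fst z)))"
      unfolding computable_def by blast
    have "computable (\<lambda>z :: nat_word \<times> nat. snd z)" by (intro computable_intros)
    then obtain T where T: "\<And>z :: nat_word \<times> nat. run T [encode z] = Some (snd z)"
      unfolding computable_def encode_nat_def by blast
    have "run (Comp P [Q, T]) [encode z] = Some (encode (out (fst z) (snd z)))" for z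
      using out[of "fst z" "snd z"] by (simp add: Q T encode_nat_sum_of_sum[symmetric] sum)
    then show ?thesis unfolding computable_def by blast
  qed
  note computable_out = computable_comp[OF this, of "\<lambda>z. (f z, g z)" for f g, simplified]
  have val_eq: "val b = real_of_int (fst b) / real_of_int (snd b)" for b
    by (simp only: val_def Fract_of_int_quotient of_rat_divide of_rat_of_int_eq)
  \<comment> \<open>A zero denominator is possible in an output; such a fraction has the value
    0.\<close>
  have val_less: "val b < 1 \<longleftrightarrow> snd b = 0 \<or> fst b * snd b < snd b * snd b" for b
    using less_fraction_iff(1)[of "snd b" "fst b"] by (cases "snd b = 0") (simp_all add: val_eq)
  have val_greater: "1 / 2 < val b \<longleftrightarrow> snd b \<noteq> 0 \<and> snd b * snd b < 2 * fst b * snd b" for b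
    using less_fraction_iff(2)[of "snd b" "fst b"] by (cases "snd b = 0") (simp_all add: val_eq)
  define small where "small x n \<longleftrightarrow> snd (snd (out x n)) = 0 \<or> fst (snd (out x n)) * snd (snd (out x n)) < snd (snd (out x n)) * snd (snd (out x n))" for x n
  define large where "large x n \<longleftrightarrow> snd (fst (out x n)) \<noteq> 0 \<and> snd (fst (out x n)) * snd (fst (out x n)) < 2 * fst (fst (out x n)) * snd (fst (out x n))" for x n
  have small: "small x n \<longleftrightarrow> val (snd (out x n)) < 1" for x n by (simp only: small_def val_less)
  have large: "large x n \<longleftrightarrow> 1 / 2 < val (fst (out x n))" for x n by (simp only: large_def val_greater)
  have norm: "if nat_trivial x then N x \<le> 0 else 1 \<le> N x" for x
    using lambda_norm_difference[OF rep] by (simp add: N_def)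
  have stop: "\<exists>n. small x n \<or> large x n" for x
    using norm[of x] approx(3)[of "1 / 2" x] approx(4)[of x 1] by (fastforce simp: small large split: if_splits)
  define time where "time x = (LEAST n. small x n \<or> large x n)" for x
  \<comment> \<open>\<open>small\<close> forces the norm below 1 and \<open>large\<close> forces it
    above 1/2, so, given \<open>norm\<close>, whichever stops the search is conclusive.\<close>
  have "small x (time x) \<longleftrightarrow> nat_trivial x" for x
  proof -
    have "small x (time x) \<or> large x (time x)" unfolding time_def by (rule LeastI_ex[OF stop])
    then show ?thesis
      using norm[of x] approx(1,2)[of x "time x"] by (auto simp: small large split: if_splits)
  qed
  moreover have "computable time"
    unfolding time_def[abs_def] small_def large_def
    by (intro computable_Least computable_intros computable_out) (use stop in \<open>auto simp: small_def large_def\<close>)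
  then have "computable (\<lambda>x. small x (time x))"
    unfolding small_def by (intro computable_intros computable_out)
  ultimately show ?thesis by (simp add: word_problem_decidable_iff)
qed

end

theorem theorem1p3:
  fixes A :: "'a set" and R :: "'a word set"
  assumes "finite_presentation A R"
    and "amenable (presented_group A R)"
  shows "word_problem_decidable A R \<longleftrightarrow>
    group_ring_computable A R (lambda_norm (presented_group A R))"
proof -
  interpret presentation A R by standard (rule assms)
  show ?thesis
    using group_ring_computable_if_word_problem_decidable[OF assms(2)]
      word_problem_decidable_if_group_ring_computable by blast
qed

end
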